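(* $\widetilde{\mathcal U}_{\mathbb Z}^0\subseteq\widetilde{\mathcal U}_{\mathbb Z}$ and $\widetilde{\mathcal U}_{\mathbb Z}=\widetilde{\mathcal U}_{\mathbb Z}^-\widetilde{\mathcal U}_{\mathbb Z}^0\widetilde{\mathcal U}_{\mathbb Z}^+$.
   Context: $\mathbb N=\{0,1,2,\dots\}$. For $a$ in a unital $\mathbb Q$-algebra: $a^{(k)}=a^k/k!$, $\binom ak=a(a-1)\cdots(a-k+1)/k!$. The Lie algebra of type $A_2^{(2)}$ (and its enveloping algebra $\widetilde{\mathcal U}$, as associative algebra) is generated over $\mathbb Q$ by $\{c,h_r,x_r^\pm,X_{2r+1}^\pm\mid r\in\mathbb Z\}$ (a basis of the Lie algebra) with relations: $c$ central; $[h_r,h_s]=\delta_{r+s,0}\,2r(2+(-1)^{r-1})c$; $[h_r,x_s^\pm]=\pm2(2+(-1)^{r-1})x_{r+s}^\pm$; for $s$ odd, $[h_r,X_s^\pm]=\pm4X_{r+s}^\pm$ if $r$ is even and $0$ if $r$ is odd; $[x_r^\pm,x_s^\pm]=0$ if $r+s$ is even and $\pm(-1)^sX_{r+s}^\pm$ if $r+s$ is odd; $[x_r^\pm,X_s^\pm]=[X_r^\pm,X_s^\pm]=0$; $[x_r^+,x_s^-]=h_{r+s}+\delta_{r+s,0}\,rc$; $[x_r^\pm,X_s^\mp]=\pm(-1)^r4x_{r+s}^\mp$ ($s$ odd); $[X_r^+,X_s^-]=8h_{r+s}+4\delta_{r+s,0}\,rc$ ($r,s$ odd). Define $\varepsilon_r=-1$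 if $4\mid r$ and $\varepsilon_r=1$ otherwise, and $\tilde h_{\pm k}$ by $\sum_{k\ge0}\tilde h_{\pm k}u^k=\exp\big(\sum_{r>0}(-1)^{r-1}\frac{\varepsilon_rh_{\pm r}}{r}u^r\big)$. $\mathbb Z$-subalgebras of $\widetilde{\mathcal U}$: $\widetilde{\mathcal U}_{\mathbb Z}$ is generated by $\{(x_r^+)^{(k)},(x_r^-)^{(k)}\mid r\in\mathbb Z,k\in\mathbb N\}$; $\widetilde{\mathcal U}_{\mathbb Z}^\pm$ by $\{(x_r^\pm)^{(k)}\mid r\in\mathbb Z,k\in\mathbb N\}$; $\widetilde{\mathcal U}_{\mathbb Z}^0$ by $\tilde h_k,\tilde h_{-k}$ ($k>0$) and $\binom{h_0}{k},\binom ck$ ($k\in\mathbb N$). Products of subalgebras denote the $\mathbb Z$-span of products of elements. *)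

theory Defs
  imports
    "HOL-Library.Poly_Mapping"
    "HOL-Computational_Algebra.Formal_Power_Series"
begin

text \<open>
  The free associative unital \<open>\<rat>\<close>-algebra on a set of letters is the monoid algebra over the free
  monoid of words; the wrapper \<open>word\<close> writes concatenation additively, so that the convolution
  product of \<open>Poly_Mapping\<close> is the product of noncommutative polynomials.
\<close>

datatype 'a word = Word (letters: "'a list")

instantiation word :: (type) monoid_add
begin
definition zero_word :: "'a word" where "zero_word = Word []"
definition plus_word :: "'a word \<Rightarrow> 'a word \<Rightarrow> 'a word"
  where "plus_word v w = Word (letters v @ letters w)"
instance
proof
  fix a b c :: "'a word"
  show "a + b + c = a + (b + c)" by (simp add: plus_word_def)
  show "0 + a = a" by (simp add: plus_word_def zero_word_def)
  show "a + 0 = a" by (simp add: plus_word_def zero_word_def)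
qed
end

datatype pmsign = PlusS | MinusS

fun sgn_of :: "pmsign \<Rightarrow> int" where
  "sgn_of PlusS = 1"
| "sgn_of MinusS = - 1"

fun flip :: "pmsign \<Rightarrow> pmsign" where
  "flip PlusS = MinusS"
| "flip MinusS = PlusS"

text \<open>\<open>GenBigX \<sigma> m\<close> stands for $X^{\sigma}_{2m+1}$: there are no even-indexed generators $X^\pm$.\<close>

datatype gen = GenC | GenH int | GenX pmsign int | GenBigX pmsign int

type_synonym free_alg = "gen word \<Rightarrow>\<^sub>0 rat"

definition fgen :: "gen \<Rightarrow> free_alg"
  where "fgen y = Poly_Mapping.single (Word [y]) 1"

abbreviation (input) fc :: free_alg where "fc \<equiv> fgen GenC"
abbreviation (input) fh :: "int \<Rightarrow> free_alg" where "fh r \<equiv> fgen (GenH r)"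
abbreviation (input) fx :: "pmsign \<Rightarrow> int \<Rightarrow> free_alg" where "fx \<sigma> r \<equiv> fgen (GenX \<sigma> r)"

text \<open>Only used for odd \<open>r\<close>, where \<open>r = 2 * (r div 2) + 1\<close>.\<close>
abbreviation (input) fX :: "pmsign \<Rightarrow> int \<Rightarrow> free_alg" where "fX \<sigma> r \<equiv> fgen (GenBigX \<sigma> (r div 2))"

definition commutator :: "'a::ring \<Rightarrow> 'a \<Rightarrow> 'a"
  where "commutator a b = a * b - b * a"

text \<open>\<open>alt n\<close> is $(-1)^n$ for integer \<open>n\<close>.\<close>
definition alt :: "int \<Rightarrow> int"
  where "alt n = (if even n then 1 else - 1)"

definition kdelta :: "int \<Rightarrow> int"
  where "kdelta n = (if n = 0 then 1 else 0)"

inductive_set relators :: "free_alg set" where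
  c_central: "commutator fc (fgen y) \<in> relators"
| h_h: "commutator (fh r) (fh s)
          - of_int (kdelta (r + s) * (2 * r * (2 + alt (r - 1)))) * fc \<in> relators"
| h_x: "commutator (fh r) (fx \<sigma> s)
          - of_int (sgn_of \<sigma> * (2 * (2 + alt (r - 1)))) * fx \<sigma> (r + s) \<in> relators"
| h_X_even: "odd s \<Longrightarrow> even r \<Longrightarrow>
     commutator (fh r) (fX \<sigma> s) - of_int (sgn_of \<sigma> * 4) * fX \<sigma> (r + s) \<in> relators"
| h_X_odd: "odd s \<Longrightarrow> odd r \<Longrightarrow> commutator (fh r) (fX \<sigma> s) \<in> relators"
| x_x_even: "even (r + s) \<Longrightarrow> commutator (fx \<sigma> r) (fx \<sigma> s) \<in> relators"
| x_x_odd: "odd (r + s) \<Longrightarrow>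
     commutator (fx \<sigma> r) (fx \<sigma> s) - of_int (sgn_of \<sigma> * alt s) * fX \<sigma> (r + s) \<in> relators"
| x_X: "odd s \<Longrightarrow> commutator (fx \<sigma> r) (fX \<sigma> s) \<in> relators"
| X_X: "odd r \<Longrightarrow> odd s \<Longrightarrow> commutator (fX \<sigma> r) (fX \<sigma> s) \<in> relators"
| xp_xm: "commutator (fx PlusS r) (fx MinusS s)
          - (fh (r + s) + of_int (kdelta (r + s) * r) * fc) \<in> relators"
| x_X_opp: "odd s \<Longrightarrow>
     commutator (fx \<sigma> r) (fX (flip \<sigma>) s)
       - of_int (sgn_of \<sigma> * alt r * 4) * fx (flip \<sigma>) (r + s) \<in> relators"
| Xp_Xm: "odd r \<Longrightarrow> odd s \<Longrightarrow>
     commutator (fX PlusS r) (fX MinusS s)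
       - (8 * fh (r + s) + of_int (4 * kdelta (r + s) * r) * fc) \<in> relators"

inductive_set rel_ideal :: "free_alg set" where
  zero: "0 \<in> rel_ideal"
| gen: "p \<in> relators \<Longrightarrow> p \<in> rel_ideal"
| add: "p \<in> rel_ideal \<Longrightarrow> q \<in> rel_ideal \<Longrightarrow> p + q \<in> rel_ideal"
| mult_left: "p \<in> rel_ideal \<Longrightarrow> a * p \<in> rel_ideal"
| mult_right: "p \<in> rel_ideal \<Longrightarrow> p * a \<in> rel_ideal"

lemma rel_ideal_uminus: "p \<in> rel_ideal \<Longrightarrow> - p \<in> rel_ideal"
  using rel_ideal.mult_left[of p "- 1"] by simp

lemma rel_ideal_diff: "p \<in> rel_ideal \<Longrightarrow> q \<in> rel_ideal \<Longrightarrow> p - q \<in> rel_ideal"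
  using rel_ideal.add[of p "- q"] rel_ideal_uminus[of q] by simp

text \<open>The ideal is proper (every relator has vanishing constant term), as class \<open>ring_1\<close> requires
  \<open>0 \<noteq> 1\<close>.\<close>

abbreviation (input) aug :: "free_alg \<Rightarrow> rat"
  where "aug p \<equiv> Poly_Mapping.lookup p 0"

lemma aug_mult: "aug (p * q) = aug p * aug q"
proof -
  have eq: "(0 = l + k) \<longleftrightarrow> (l = 0 \<and> k = 0)" for l k :: "gen word"
    by (cases l; cases k) (auto simp: plus_word_def zero_word_def)
  have "Sum_any (\<lambda>k. Poly_Mapping.lookup q k when 0 = l + k) = (aug q when l = 0)" for l
  proof (cases "l = 0")
    case True
    have "(\<lambda>k. Poly_Mapping.lookup q k when 0 = l + k) = (\<lambda>k. Poly_Mapping.lookup q k when k = 0)"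
      using True by (auto simp: when_def fun_eq_iff)
    then show ?thesis using True by simp
  next
    case False
    then show ?thesis by (simp add: eq)
  qed
  then show ?thesis
    by (simp add: times_poly_mapping.rep_eq prod_fun_def mult_when)
qed

lemma aug_fgen: "aug (fgen y) = 0"
  by (simp add: fgen_def lookup_single zero_word_def when_def)

lemma aug_commutator: "aug (commutator p q) = 0"
  by (simp add: commutator_def aug_mult lookup_minus)

lemma aug_relators: "p \<in> relators \<Longrightarrow> aug p = 0"
  by (induction rule: relators.induct)
     (simp_all add: aug_commutator aug_mult aug_fgen lookup_minus lookup_add)

lemma aug_rel_ideal: "p \<in> rel_ideal \<Longrightarrow> aug p = 0"
  by (induction rule: rel_ideal.induct) (simp_all add: aug_relators aug_mult lookup_add)

lemma one_notin_rel_ideal: "1 \<notin> rel_ideal"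
  using aug_rel_ideal[of 1] by (auto simp: lookup_one)

quotient_type uea = free_alg / "\<lambda>p q. p - q \<in> rel_ideal"
proof (rule equivpI)
  show "reflp (\<lambda>p q. p - q \<in> rel_ideal)"
    by (simp add: reflp_def rel_ideal.zero)
  show "symp (\<lambda>p q. p - q \<in> rel_ideal)"
    by (rule sympI) (metis minus_diff_eq rel_ideal_uminus)
  show "transp (\<lambda>p q. p - q \<in> rel_ideal)"
    by (rule transpI) (metis diff_add_cancel add_diff_eq rel_ideal.add)
qed

instantiation uea :: ring_1
begin

lift_definition zero_uea :: uea is 0 .
lift_definition one_uea :: uea is 1 .
lift_definition plus_uea :: "uea \<Rightarrow> uea \<Rightarrow> uea" is "(+)"
  by (metis add_diff_add rel_ideal.add)
lift_definition minus_uea :: "uea \<Rightarrow> uea \<Rightarrow> uea" is "(-)"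
proof -
  fix p q r s :: free_alg
  assume "p - q \<in> rel_ideal" "r - s \<in> rel_ideal"
  then have "(p - q) - (r - s) \<in> rel_ideal" by (rule rel_ideal_diff)
  then show "(p - r) - (q - s) \<in> rel_ideal" by (simp add: algebra_simps)
qed
lift_definition uminus_uea :: "uea \<Rightarrow> uea" is uminus
proof -
  fix p q :: free_alg
  assume "p - q \<in> rel_ideal"
  then have "- (p - q) \<in> rel_ideal" by (rule rel_ideal_uminus)
  then show "- p - - q \<in> rel_ideal" by simp
qed
lift_definition times_uea :: "uea \<Rightarrow> uea \<Rightarrow> uea" is "(*)"
proof -
  fix p q r s :: free_alg
  assume "p - q \<in> rel_ideal" "r - s \<in> rel_ideal"
  then have "(p - q) * r + q * (r - s) \<in> rel_ideal"
    by (intro rel_ideal.add rel_ideal.mult_left rel_ideal.mult_right)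
  then show "p * r - q * s \<in> rel_ideal" by (simp add: algebra_simps)
qed

instance
  by standard
     (transfer, simp add: algebra_simps rel_ideal.zero rel_ideal_uminus one_notin_rel_ideal;
      use one_notin_rel_ideal rel_ideal_uminus in force)+

end

lift_definition qscale :: "rat \<Rightarrow> uea \<Rightarrow> uea" (infixr "*\<^sub>Q" 75)
  is "\<lambda>q p. Poly_Mapping.single 0 q * p"
proof -
  fix q and p p' :: free_alg
  assume "p - p' \<in> rel_ideal"
  then have "Poly_Mapping.single 0 q * (p - p') \<in> rel_ideal" by (rule rel_ideal.mult_left)
  then show "Poly_Mapping.single 0 q * p - Poly_Mapping.single 0 q * p' \<in> rel_ideal"
    by (simp add: algebra_simps)
qed

lift_definition ugen :: "gen \<Rightarrow> uea" is fgen .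

definition c_el :: uea where "c_el = ugen GenC"
definition h_el :: "int \<Rightarrow> uea" where "h_el r = ugen (GenH r)"
definition x_el :: "pmsign \<Rightarrow> int \<Rightarrow> uea" where "x_el \<sigma> r = ugen (GenX \<sigma> r)"

definition divpow :: "uea \<Rightarrow> nat \<Rightarrow> uea"
  where "divpow a k = (1 / fact k) *\<^sub>Q a ^ k"

definition ubinom :: "uea \<Rightarrow> nat \<Rightarrow> uea"
  where "ubinom a k = (1 / fact k) *\<^sub>Q prod_list (map (\<lambda>i. a - of_nat i) [0..<k])"

definition eps :: "nat \<Rightarrow> int"
  where "eps r = (if 4 dvd r then - 1 else 1)"

definition uexp :: "uea fps"
  where "uexp = Abs_fps (\<lambda>n. (1 / fact n) *\<^sub>Q 1)"

definition log_series :: "pmsign \<Rightarrow> uea fps"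
  where "log_series \<sigma> = Abs_fps (\<lambda>r. if r = 0 then 0
           else ((- 1) ^ (r - 1) * of_int (eps r) / of_nat r) *\<^sub>Q h_el (sgn_of \<sigma> * int r))"

text \<open>\<open>htilde \<sigma> k\<close> is $\tilde h_{\sigma k}$, for \<open>k \<ge> 0\<close>; the two signs are separate series. The
  composition \<open>oo\<close> is the usual exponential because \<open>log_series \<sigma>\<close> has no constant term.\<close>
definition htilde :: "pmsign \<Rightarrow> nat \<Rightarrow> uea"
  where "htilde \<sigma> k = fps_nth (uexp oo log_series \<sigma>) k"

inductive_set subring_gen :: "'a::ring_1 set \<Rightarrow> 'a set" for S where
  base: "a \<in> S \<Longrightarrow> a \<in> subring_gen S"
| zero: "0 \<in> subring_gen S"
| one: "1 \<in> subring_gen S"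
| diff: "a \<in> subring_gen S \<Longrightarrow> b \<in> subring_gen S \<Longrightarrow> a - b \<in> subring_gen S"
| mult: "a \<in> subring_gen S \<Longrightarrow> b \<in> subring_gen S \<Longrightarrow> a * b \<in> subring_gen S"

global_interpretation int_module: module "\<lambda>(n::int) (a::uea). of_int n * a"
  defines int_span = int_module.span
  by unfold_locales (simp_all add: algebra_simps)

definition UZ :: "uea set"
  where "UZ = subring_gen {divpow (x_el \<sigma> r) k | \<sigma> r k. True}"

definition UZ_pm :: "pmsign \<Rightarrow> uea set"
  where "UZ_pm \<sigma> = subring_gen {divpow (x_el \<sigma> r) k | r k. True}"

definition UZ_0 :: "uea set"
  where "UZ_0 = subring_gen
    ({htilde \<sigma> k | \<sigma> k. k > 0} \<union> {ubinom (h_el 0) k | k. True} \<union> {ubinom c_el k | k. True})"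

end

theory Submission
  imports Defs "HOL-Computational_Algebra.Computational_Algebra"
begin

text \<open>
  Collect the divided powers in generating functions. Both \<open>exp (u x\<^sup>+\<^sub>r) exp (v x\<^sup>-\<^sub>s)\<close> and a suitable ordered
  product of exponentials of currents in \<open>x\<^sup>-\<close>, \<open>X\<^sup>-\<close>, \<open>h\<close>, \<open>X\<^sup>+\<close>, \<open>x\<^sup>+\<close> solve the same linear
  differential equation in \<open>u\<close>, hence agree. The scalar series in the nilpotent factors have integral
  coefficients, so these factors and their inverses are integral; therefore the Cartan factor has
  coefficients in \<open>UZ\<close>. For \<open>r + s = \<plusminus> m\<close> it is the exponential of a weighted sum of the \<open>h\<close> of index
  divisible by \<open>m\<close>. The weights are ghost sequences of integral series, so its coefficients are integral
  polynomials in the \<open>htilde\<close>. Conversely, modulo the \<open>htilde\<close> of smaller index, the factor for a divisor \<open>m\<close>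
  of \<open>k\<close> contributes an integral multiple of the \<open>k\<close>-th one to \<open>UZ\<close>, and these multiples have no common
  prime divisor.

  Conjugation by the generating function of the \<open>htilde\<close> multiplies the current of the \<open>x\<^sub>r\<close> by
  \<open>phi = (1 + u\<^sup>2) ((1 - u) / (1 + u))\<^sup>3\<close>. Its coefficients of odd index are even, which absorbs the
  denominators \<open>2\<close> coming from \<open>[x\<^sub>r, x\<^sub>s] = \<plusminus> X\<^sub>r\<^sub>+\<^sub>s\<close>. Straightening an arbitrary product of divided powers
  then terminates by induction on the total degree.
\<close>

text \<open>For odd m = r + s the index parity of h decides between the factors 2 and 6 in its
  bracket with x, and x of different parity do not commute. The solution of the differential
  equation then has a Cartan factor with logarithm 1/2 log (1 + 2u - u^2), where u^n carries h of
  index m n: up to the usual (-1)^(n-1)/n the weights are 1, 3, 7, 17, ... (\<open>dseq\<close>).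
  They cause two obstacles. Their own series, the square root of 1 - 2u - u^2, is not integral: its
  coefficient at u^4 is -3/2. The signs \<open>eps\<close> cure this, since -17 in place of 17
  restores the ghost congruences at powers of 2. And the weights are not \<plusminus> 1, so one m
  alone only yields multiples of the \<open>htilde\<close>. Combining several m works because an
  integral ghost sequence with first term 1 is 1 modulo q at all powers of a prime q.\<close>

unbundle fps_syntax

section \<open>Algebras over the rationals and divided powers\<close>

class rat_algebra = ring_1 +
  fixes qof :: "rat \<Rightarrow> 'a"
  assumes qof_1 [simp]: "qof 1 = 1"
    and qof_add: "qof (p + q) = qof p + qof q"
    and qof_mult: "qof (p * q) = qof p * qof q"
    and qof_central: "qof q * a = a * qof q"
begin

lemma qof_0 [simp]: "qof 0 = 0"
  using qof_add[of 0 0] by simp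

lemma qof_minus: "qof (- p) = - qof p"
  using qof_add[of p "- p"] by (simp add: eq_neg_iff_add_eq_0 add.commute)

lemma qof_diff: "qof (p - q) = qof p - qof q"
  using qof_add[of p "- q"] by (simp add: qof_minus)

lemma qof_of_nat [simp]: "qof (of_nat n) = of_nat n"
  by (induction n) (simp_all add: qof_add)

lemma qof_of_int [simp]: "qof (of_int n) = of_int n"
  by (cases n rule: int_diff_cases) (simp add: qof_diff)

lemma qof_numeral [simp]: "qof (numeral n) = numeral n"
  using qof_of_nat[of "numeral n"] by simp

lemma qof_power: "qof (p ^ n) = qof p ^ n"
  by (induction n) (simp_all add: qof_mult)

lemma qof_sum: "qof (sum f A) = (\<Sum>x\<in>A. qof (f x))"
  by (induction A rule: infinite_finite_induct) (simp_all add: qof_add)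

lemma qof_left_commute: "a * (qof q * b) = qof q * (a * b)"
  by (metis mult.assoc qof_central)

text \<open>Torsion-freeness: identities between divided powers are proved after multiplication by
  \<open>Suc k\<close>, where \<open>dpow_Suc\<close> replaces all handling of factorials.\<close>

lemma of_nat_mult_cancel:
  assumes "of_nat n * a = of_nat n * b" "n > 0"
  shows "a = b"
proof -
  have "qof (1 / of_nat n) * (of_nat n * c) = c" for c
    using assms(2) by (simp flip: mult.assoc qof_of_nat qof_mult)
  then show ?thesis using assms(1) by metis
qed

definition dpow :: "'a \<Rightarrow> nat \<Rightarrow> 'a"
  where "dpow a k = qof (1 / fact k) * a ^ k"

lemma dpow_0 [simp]: "dpow a 0 = 1"
  by (simp add: dpow_def)

lemma dpow_1 [simp]: "dpow a (Suc 0) = a"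
  by (simp add: dpow_def)

lemma dpow_0_left: "dpow 0 k = (if k = 0 then 1 else 0)"
  by (cases k) (simp_all add: dpow_def)

lemma dpow_Suc: "of_nat (Suc k) * dpow a (Suc k) = a * dpow a k"
proof -
  have "of_nat (Suc k) * dpow a (Suc k) = qof (of_nat (Suc k) * (1 / fact (Suc k))) * (a * a ^ k)"
    by (simp only: dpow_def qof_mult qof_of_nat mult.assoc power_Suc)
  also have "of_nat (Suc k) * (1 / fact (Suc k)) = (1 / fact k :: rat)"
    by (simp del: of_nat_Suc)
  finally show ?thesis by (simp add: dpow_def qof_left_commute)
qed

lemma dpow_commute: assumes "a * b = b * a" shows "dpow a k * b = b * dpow a k"
  by (simp add: dpow_def qof_left_commute mult.assoc power_commuting_commutes[OF assms])

lemma dpow_Suc_right: "of_nat (Suc k) * dpow a (Suc k) = dpow a k * a"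
  by (simp only: dpow_Suc dpow_commute[OF refl])

lemma power_mult_commuting:
  assumes "a * b = b * a" shows "(a * b) ^ k = a ^ k * b ^ k"
proof (induction k)
  case (Suc k)
  have "a ^ k * b = b * a ^ k" using assms by (rule power_commuting_commutes)
  with Suc show ?case by (simp add: mult.assoc) (metis mult.assoc)
qed simp

lemma dpow_mult_commuting:
  assumes "a * b = b * a"
  shows "dpow (a * b) k = dpow a k * b ^ k"
  by (simp add: dpow_def power_mult_commuting[OF assms] mult.assoc)

lemma dpow_qof_mult: "dpow (qof q * a) k = qof (q ^ k) * dpow a k"
  using dpow_mult_commuting[of a "qof q" k]
  by (metis qof_central qof_power)

lemma dpow_of_int_mult: "dpow (of_int n * a) k = of_int (n ^ k) * dpow a k"
  using dpow_qof_mult[of "of_int n" a k] by (simp add: qof_power)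

lemma dpow_unique:
  assumes "D 0 = 1" "\<And>k. of_nat (Suc k) * D (Suc k) = a * D k"
  shows "D k = dpow a k"
proof (induction k)
  case (Suc k)
  have "of_nat (Suc k) * D (Suc k) = of_nat (Suc k) * dpow a (Suc k)"
    by (simp only: assms(2) dpow_Suc Suc)
  then show ?case by (rule of_nat_mult_cancel) simp
qed (use assms in simp)

text \<open>The hypothesis says that \<open>Z i\<close> is \<open>(- ad a)\<^sup>i (Z 0) / i!\<close>.\<close>
lemma dpow_conj:
  assumes "\<And>i. Z i * a = a * Z i + of_nat (Suc i) * Z (Suc i)"
  shows "Z 0 * dpow a k = (\<Sum>i\<le>k. dpow a (k - i) * Z i)"
proof (induction k)
  case (Suc k)
  have "of_nat (Suc k) * (Z 0 * dpow a (Suc k)) = Z 0 * (of_nat (Suc k) * dpow a (Suc k))"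
    by (metis mult.assoc mult_of_nat_commute)
  also have "\<dots> = (Z 0 * dpow a k) * a"
    by (simp only: dpow_Suc_right mult.assoc)
  also have "\<dots> = (\<Sum>i\<le>k. dpow a (k - i) * (Z i * a))"
    by (simp add: Suc sum_distrib_right mult.assoc)
  also have "\<dots> = (\<Sum>i\<le>k. of_nat (Suc k - i) * (dpow a (Suc k - i) * Z i))
      + (\<Sum>i\<le>k. of_nat (Suc i) * (dpow a (k - i) * Z (Suc i)))"
  proof (subst sum.distrib[symmetric], rule sum.cong[OF refl])
    fix i assume "i \<in> {..k}"
    then have "of_nat (Suc k - i) * dpow a (Suc k - i) = dpow a (k - i) * a"
      using dpow_Suc_right[of "k - i" a] by (simp only: Suc_diff_le atMost_iff)
    then have "of_nat (Suc k - i) * (dpow a (Suc k - i) * Z i) = dpow a (k - i) * (a * Z i)"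
      by (metis mult.assoc)
    moreover have "dpow a (k - i) * (of_nat (Suc i) * Z (Suc i))
        = of_nat (Suc i) * (dpow a (k - i) * Z (Suc i))"
      by (metis mult.assoc mult_of_nat_commute)
    ultimately show "dpow a (k - i) * (Z i * a) = of_nat (Suc k - i) * (dpow a (Suc k - i) * Z i)
        + of_nat (Suc i) * (dpow a (k - i) * Z (Suc i))"
      by (simp only: assms distrib_left)
  qed
  also have "(\<Sum>i\<le>k. of_nat (Suc k - i) * (dpow a (Suc k - i) * Z i))
      = (\<Sum>i\<le>Suc k. of_nat (Suc k - i) * (dpow a (Suc k - i) * Z i))"
    by simp
  also have "(\<Sum>i\<le>k. of_nat (Suc i) * (dpow a (k - i) * Z (Suc i)))
      = (\<Sum>i\<le>Suc k. of_nat i * (dpow a (Suc k - i) * Z i))"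
    by (subst sum.atMost_Suc_shift) simp
  also have "(\<Sum>i\<le>Suc k. of_nat (Suc k - i) * (dpow a (Suc k - i) * Z i)) + \<dots>
      = (\<Sum>i\<le>Suc k. of_nat (Suc k) * (dpow a (Suc k - i) * Z i))"
    by (subst sum.distrib[symmetric], rule sum.cong[OF refl])
      (simp only: flip: distrib_right of_nat_add, simp)
  finally have "of_nat (Suc k) * (Z 0 * dpow a (Suc k))
      = of_nat (Suc k) * (\<Sum>i\<le>Suc k. dpow a (Suc k - i) * Z i)"
    by (simp only: sum_distrib_left)
  then show ?case by (rule of_nat_mult_cancel) simp
qed simp

text \<open>Multiplying the k-th sum by a + b raises one of the two exponents; the weights so
  produced add up to \<open>Suc k\<close>, which is the recursion in
  \<open>dpow_unique\<close>.\<close>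

lemma dpow_add:
  assumes "a * b = b * a"
  shows "dpow (a + b) k = (\<Sum>i\<le>k. dpow a (k - i) * dpow b i)"
proof (rule dpow_unique[symmetric])
  fix k
  let ?D = "\<lambda>k. \<Sum>i\<le>k. dpow a (k - i) * dpow b i"
  have "(a + b) * ?D k = (\<Sum>i\<le>k. of_nat (Suc k - i) * (dpow a (Suc k - i) * dpow b i))
      + (\<Sum>i\<le>k. of_nat (Suc i) * (dpow a (k - i) * dpow b (Suc i)))"
  proof (subst sum.distrib[symmetric], unfold distrib_right sum_distrib_left,
      intro sum.cong refl arg_cong2[of _ _ _ _ "(+)"])
    fix i assume "i \<in> {..k}"
    then have "of_nat (Suc k - i) * dpow a (Suc k - i) = a * dpow a (k - i)"
      using dpow_Suc[of "k - i" a] by (simp only: Suc_diff_le atMost_iff)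
    then show "a * (dpow a (k - i) * dpow b i) = of_nat (Suc k - i) * (dpow a (Suc k - i) * dpow b i)"
      by (metis mult.assoc)
    have "b * dpow a (k - i) = dpow a (k - i) * b"
      by (rule dpow_commute[symmetric]) (rule assms)
    then show "b * (dpow a (k - i) * dpow b i) = of_nat (Suc i) * (dpow a (k - i) * dpow b (Suc i))"
      by (metis mult.assoc mult_of_nat_commute dpow_Suc)
  qed
  also have "(\<Sum>i\<le>k. of_nat (Suc k - i) * (dpow a (Suc k - i) * dpow b i))
      = (\<Sum>i\<le>Suc k. of_nat (Suc k - i) * (dpow a (Suc k - i) * dpow b i))"
    by simp
  also have "(\<Sum>i\<le>k. of_nat (Suc i) * (dpow a (k - i) * dpow b (Suc i)))
      = (\<Sum>i\<le>Suc k. of_nat i * (dpow a (Suc k - i) * dpow b i))"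
    by (subst sum.atMost_Suc_shift) simp
  also have "(\<Sum>i\<le>Suc k. of_nat (Suc k - i) * (dpow a (Suc k - i) * dpow b i)) + \<dots>
      = (\<Sum>i\<le>Suc k. of_nat (Suc k) * (dpow a (Suc k - i) * dpow b i))"
    by (subst sum.distrib[symmetric], rule sum.cong[OF refl])
      (simp only: flip: distrib_right of_nat_add, simp)
  finally show "of_nat (Suc k) * ?D (Suc k) = (a + b) * ?D k"
    by (simp only: sum_distrib_left)
qed simp

end

instantiation rat :: rat_algebra
begin
definition qof_rat :: "rat \<Rightarrow> rat" where [simp]: "qof_rat q = q"
instance by standard simp_all
end

text \<open>Closure under power series lets the same lemmas serve rational scalars,
  \<open>uea\<close>, \<open>uea fps\<close> and the two-variable series
  \<open>uea fps fps\<close>.\<close>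

instantiation fps :: (rat_algebra) rat_algebra
begin
definition qof_fps :: "rat \<Rightarrow> 'a fps" where "qof_fps q = fps_const (qof q)"
instance
proof
  fix q :: rat and a :: "'a fps"
  show "qof q * a = a * qof q"
    by (rule fps_ext) (simp add: qof_fps_def, rule qof_central)
qed (simp_all add: qof_fps_def qof_add qof_mult)
end

lemma qof_mult_nth [simp]: "(qof q * f) $ n = qof q * f $ n"
  by (simp add: qof_fps_def)

lemma qof_nth: "qof q $ n = (if n = 0 then qof q else 0)"
  by (simp add: qof_fps_def)

subsection \<open>Exponentials of power series\<close>

text \<open>The infinite sum of the \<open>P k\<close>, exact as soon as \<open>P k\<close> has
  order at least k: later terms then do not reach coefficient n.\<close>

definition fsum :: "(nat \<Rightarrow> 'a::comm_monoid_add fps) \<Rightarrow> 'a fps"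
  where "fsum P = Abs_fps (\<lambda>n. \<Sum>k\<le>n. P k $ n)"

definition ord_ge :: "'a::zero fps \<Rightarrow> nat \<Rightarrow> bool"
  where "ord_ge f m \<longleftrightarrow> (\<forall>i<m. f $ i = 0)"

lemma ord_ge_0 [simp]: "ord_ge f 0"
  by (simp add: ord_ge_def)

lemma ord_ge_1 [simp]: "ord_ge f (Suc 0) \<longleftrightarrow> f $ 0 = 0"
  by (simp add: ord_ge_def)

lemma ord_ge_mult:
  fixes f g :: "'a::ring_1 fps"
  assumes "ord_ge f a" "ord_ge g b"
  shows "ord_ge (f * g) (a + b)"
  unfolding ord_ge_def
proof (intro allI impI)
  fix n assume n: "n < a + b"
  have "f $ i * g $ (n - i) = 0" if "i \<in> {0..n}" for i
  proof -
    have "i < a \<or> n - i < b" using n that by auto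
    then show ?thesis using assms by (auto simp: ord_ge_def)
  qed
  then show "(f * g) $ n = 0" unfolding fps_mult_nth by (rule sum.neutral[rule_format])
qed

lemma ord_ge_dpow:
  fixes a :: "'a::rat_algebra fps"
  assumes "a $ 0 = 0" shows "ord_ge (dpow a k) k"
proof -
  have "ord_ge (a ^ k) k"
  proof (induction k)
    case (Suc k)
    then show ?case using ord_ge_mult[of a 1 "a ^ k" k] assms by simp
  qed simp
  then show ?thesis by (simp add: dpow_def ord_ge_def)
qed

lemma fsum_nth:
  assumes "\<And>k. ord_ge (P k) k" "n < N"
  shows "fsum P $ n = (\<Sum>k<N. P k $ n)"
  unfolding fsum_def fps_nth_Abs_fps
  by (rule sum.mono_neutral_left) (use assms in \<open>auto simp: ord_ge_def\<close>)

lemma fsum_mult_left: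
  assumes "\<And>k. ord_ge (P k) k"
  shows "f * fsum P = fsum (\<lambda>k. f * P k :: 'a::ring_1 fps)"
proof (rule fps_ext)
  fix n
  have "(f * fsum P) $ n = (\<Sum>i=0..n. \<Sum>k<Suc n. f $ i * P k $ (n - i))"
    unfolding fps_mult_nth by (rule sum.cong) (simp_all add: fsum_nth[OF assms, of _ "Suc n"] sum_distrib_left del: sum.lessThan_Suc)
  also have "\<dots> = (\<Sum>k<Suc n. (f * P k) $ n)"
    by (subst sum.swap) (simp add: fps_mult_nth del: sum.lessThan_Suc)
  finally show "(f * fsum P) $ n = fsum (\<lambda>k. f * P k) $ n"
    by (simp only: fsum_def fps_nth_Abs_fps lessThan_Suc_atMost)
qed

lemma fsum_mult_right:
  assumes "\<And>k. ord_ge (P k) k"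
  shows "fsum P * f = fsum (\<lambda>k. P k * f :: 'a::ring_1 fps)"
proof (rule fps_ext)
  fix n
  have "(fsum P * f) $ n = (\<Sum>i=0..n. \<Sum>k<Suc n. P k $ i * f $ (n - i))"
    unfolding fps_mult_nth by (rule sum.cong) (simp_all add: fsum_nth[OF assms, of _ "Suc n"] sum_distrib_right del: sum.lessThan_Suc)
  also have "\<dots> = (\<Sum>k<Suc n. (P k * f) $ n)"
    by (subst sum.swap) (simp add: fps_mult_nth del: sum.lessThan_Suc)
  finally show "(fsum P * f) $ n = fsum (\<lambda>k. P k * f) $ n"
    by (simp only: fsum_def fps_nth_Abs_fps lessThan_Suc_atMost)
qed

lemma fsum_Cauchy:
  fixes P Q :: "nat \<Rightarrow> 'a::ring_1 fps"
  assumes P: "\<And>k. ord_ge (P k) k" and Q: "\<And>k. ord_ge (Q k) k"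
  shows "fsum P * fsum Q = fsum (\<lambda>k. \<Sum>i\<le>k. P (k - i) * Q i)"
proof (rule fps_ext)
  fix n
  have ord: "ord_ge (P k * Q i) (k + i)" for k i
    by (rule ord_ge_mult[OF P Q])
  have "(fsum P * fsum Q) $ n = (\<Sum>i\<le>n. (P i * fsum Q) $ n)"
    unfolding fsum_mult_right[OF P] by (simp add: fsum_def)
  also have "\<dots> = (\<Sum>i\<le>n. \<Sum>j\<le>n. (P i * Q j) $ n)"
    unfolding fsum_mult_left[OF Q] by (simp add: fsum_def)
  also have "\<dots> = (\<Sum>(i, j)\<in>{..n} \<times> {..n}. (P i * Q j) $ n)"
    by (simp add: sum.cartesian_product)
  also have "\<dots> = (\<Sum>(i, j)\<in>{(i, j). i + j \<le> n}. (P i * Q j) $ n)"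
    by (rule sum.mono_neutral_right)
      (use ord in \<open>auto simp: ord_ge_def, meson linorder_not_less\<close>)
  also have "\<dots> = (\<Sum>k\<le>n. \<Sum>i\<le>k. (P i * Q (k - i)) $ n)"
    by (rule sum.triangle_reindex_eq)
  also have "\<dots> = (\<Sum>k\<le>n. \<Sum>i\<le>k. (P (k - i) * Q i) $ n)"
  proof (rule sum.cong[OF refl])
    fix k
    show "(\<Sum>i\<le>k. (P i * Q (k - i)) $ n) = (\<Sum>i\<le>k. (P (k - i) * Q i) $ n)"
      by (rule sum.reindex_bij_witness[of _ "\<lambda>i. k - i" "\<lambda>i. k - i"]) auto
  qed
  finally show "(fsum P * fsum Q) $ n = fsum (\<lambda>k. \<Sum>i\<le>k. P (k - i) * Q i) $ n"
    by (simp add: fsum_def fps_sum_nth)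
qed

lemma fsum_finite:
  assumes "\<And>k. ord_ge (P k) k" "\<And>k. k \<ge> N \<Longrightarrow> P k = 0"
  shows "fsum P = (\<Sum>k<N. P k)"
proof (rule fps_ext)
  fix n
  have "fsum P $ n = (\<Sum>k<max N (Suc n). P k $ n)"
    by (rule fsum_nth[OF assms(1)]) simp
  also have "\<dots> = (\<Sum>k<N. P k $ n)"
    by (rule sum.mono_neutral_right) (use assms(2) in \<open>auto simp: not_less\<close>)
  finally show "fsum P $ n = (\<Sum>k<N. P k) $ n" by (simp add: fps_sum_nth)
qed

lemma fsum_split_first:
  assumes "\<And>k. ord_ge (P k) k"
  shows "fsum P = P 0 + fsum (\<lambda>k. P (Suc k))"
proof (rule fps_ext)
  fix n
  have "(\<Sum>k\<le>n. P k $ n) = (\<Sum>k\<le>Suc n. P k $ n)"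
    using assms[of "Suc n"] by (simp add: ord_ge_def)
  then show "fsum P $ n = (P 0 + fsum (\<lambda>k. P (Suc k))) $ n"
    unfolding fsum_def fps_nth_Abs_fps by (simp add: sum.atMost_Suc_shift del: sum.atMost_Suc)
qed

definition fexp :: "'a::rat_algebra fps \<Rightarrow> 'a fps"
  where "fexp a = fsum (dpow a)"

lemma fexp_nth_0 [simp]: "fexp a $ 0 = 1"
  by (simp add: fexp_def fsum_def)

lemma fexp_0 [simp]: "fexp 0 = 1"
  by (rule fps_ext) (simp add: fexp_def fsum_def dpow_0_left if_distrib[of "\<lambda>f. f $ _"] cong: if_cong)

lemma fexp_nth: "a $ 0 = 0 \<Longrightarrow> n < N \<Longrightarrow> fexp a $ n = (\<Sum>k<N. dpow a k $ n)"
  unfolding fexp_def by (rule fsum_nth) (rule ord_ge_dpow)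

lemma fexp_add:
  assumes "a $ 0 = 0" "b $ 0 = 0" "a * b = b * a"
  shows "fexp (a + b) = fexp a * fexp b"
  unfolding fexp_def fsum_Cauchy[OF ord_ge_dpow ord_ge_dpow, OF assms(1,2)]
  by (rule arg_cong[of _ _ fsum], rule ext, rule dpow_add[OF assms(3)])

lemma fexp_uminus:
  assumes "a $ 0 = 0"
  shows "fexp a * fexp (- a) = 1" "fexp (- a) * fexp a = 1"
proof -
  have "fexp (a + - a) = fexp a * fexp (- a)" "fexp (- a + a) = fexp (- a) * fexp a"
    by (rule fexp_add; simp add: assms)+
  then show "fexp a * fexp (- a) = 1" "fexp (- a) * fexp a = 1"
    by (simp_all only: add.right_inverse add.left_inverse fexp_0)
qed

lemma fexp_commute:
  assumes "a $ 0 = 0" "a * b = b * a"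
  shows "fexp a * b = b * fexp a"
  unfolding fexp_def
  by (simp add: fsum_mult_left[OF ord_ge_dpow] fsum_mult_right[OF ord_ge_dpow] assms(1) dpow_commute[OF assms(2)])

text \<open>Up to sign \<open>Z i\<close> is an i-fold commutator with a, divided by i!. As a has no
  constant term, each commutator raises the order by one, so the sum of the \<open>Z i\<close>
  converges.\<close>

lemma ord_ge_ad_sequence:
  fixes Z :: "nat \<Rightarrow> 'a::rat_algebra fps"
  assumes "a $ 0 = 0" and Z: "\<And>i. Z i * a = a * Z i + of_nat (Suc i) * Z (Suc i)"
  shows "ord_ge (Z i) i"
proof (induction i)
  case (Suc i)
  have *: "of_nat (Suc i) * Z (Suc i) = Z i * a - a * Z i"
    using Z[of i] by (simp add: algebra_simps)
  have "ord_ge (Z i * a) (i + 1)" "ord_ge (a * Z i) (1 + i)"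
    using ord_ge_mult[OF Suc, of a 1] ord_ge_mult[OF _ Suc, of a 1] assms(1) by simp_all
  then have "ord_ge (of_nat (Suc i) * Z (Suc i)) (Suc i)"
    unfolding * by (simp add: ord_ge_def)
  moreover have "(of_nat (Suc i) * Z (Suc i)) $ n = of_nat (Suc i) * Z (Suc i) $ n" for n
    using qof_mult_nth[of "of_nat (Suc i)" "Z (Suc i)" n] by (simp only: qof_of_nat)
  ultimately show ?case
    unfolding ord_ge_def by (metis mult_zero_right of_nat_mult_cancel zero_less_Suc)
qed simp

text \<open>Conjugation by an exponential is the exponential of \<open>ad\<close>: summed over k,
  \<open>dpow_conj\<close> becomes a Cauchy product.\<close>

lemma fexp_conj:
  assumes "a $ 0 = 0" and Z: "\<And>i. Z i * a = a * Z i + of_nat (Suc i) * Z (Suc i)"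
  shows "Z 0 * fexp a = fexp a * fsum Z"
  unfolding fexp_def fsum_mult_left[OF ord_ge_dpow[OF assms(1)]]
    fsum_Cauchy[OF ord_ge_dpow[OF assms(1)] ord_ge_ad_sequence[OF assms]]
  by (rule arg_cong[of _ _ fsum], rule ext, rule dpow_conj[OF Z])

text \<open>The longest chain that occurs under commutation with x^- is x^+ -> h -> x^- -> X^- -> 0,
  hence three commutators.\<close>

lemma fexp_conj3:
  fixes a Z0 Z1 Z2 Z3 :: "'a::rat_algebra fps"
  assumes "a $ 0 = 0" "Z0 * a = a * Z0 + Z1" "Z1 * a = a * Z1 + 2 * Z2" "Z2 * a = a * Z2 + 3 * Z3"
    "Z3 * a = a * Z3"
  shows "Z0 * fexp a = fexp a * (Z0 + Z1 + Z2 + Z3)"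
proof -
  define Z where "Z i = (if i = 0 then Z0 else if i = 1 then Z1 else if i = 2 then Z2
    else if i = 3 then Z3 else 0)" for i :: nat
  have Z: "Z i * a = a * Z i + of_nat (Suc i) * Z (Suc i)" for i
  proof -
    consider "i = 0" | "i = 1" | "i = 2" | "i = 3" | "i > 3" by linarith
    then show ?thesis by cases (use assms in \<open>simp_all add: Z_def\<close>)
  qed
  have "fsum Z = (\<Sum>i<4. Z i)"
    by (rule fsum_finite[OF ord_ge_ad_sequence[OF assms(1) Z]]) (simp add: Z_def)
  also have "\<dots> = Z0 + Z1 + Z2 + Z3"
    by (simp add: Z_def eval_nat_numeral)
  finally have sum: "fsum Z = Z0 + Z1 + Z2 + Z3" .
  have "Z 0 = Z0" by (simp add: Z_def)
  then show ?thesis using fexp_conj[OF assms(1) Z] by (simp only: sum)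
qed

lemma fexp_conj':
  assumes "a $ 0 = 0" and Z: "\<And>i. a * Z i = Z i * a + of_nat (Suc i) * Z (Suc i)"
  shows "fexp a * Z 0 = fsum Z * fexp a"
proof -
  have "Z 0 * fexp (- a) = fexp (- a) * fsum Z"
    by (rule fexp_conj) (use assms in simp_all)
  then have "fexp a * (Z 0 * fexp (- a)) * fexp a = fexp a * (fexp (- a) * fsum Z) * fexp a"
    by simp
  also have "fexp a * (Z 0 * fexp (- a)) * fexp a = fexp a * Z 0"
    by (simp add: mult.assoc fexp_uminus(2)[OF assms(1)])
  also have "fexp a * (fexp (- a) * fsum Z) * fexp a = fsum Z * fexp a"
    by (simp add: fexp_uminus(1)[OF assms(1)] flip: mult.assoc)
  finally show ?thesis .
qed

text \<open>Acting on each coefficient by an additive map is what lets the derivation pass through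
  \<open>fsum\<close>. The instances are \<open>fps_XD\<close> and \<open>inner_XD\<close>.\<close>

definition coeff_derivation :: "('a::rat_algebra fps \<Rightarrow> 'a fps) \<Rightarrow> bool"
  where "coeff_derivation \<theta> \<longleftrightarrow> (\<forall>f g. \<theta> (f * g) = \<theta> f * g + f * \<theta> g)
    \<and> (\<exists>D. (\<forall>f n. \<theta> f $ n = D n (f $ n)) \<and> (\<forall>n a b. D n (a + b) = D n a + D n b)
         \<and> (\<forall>n q a. D n (qof q * a) = qof q * D n a))"

lemma coeff_derivation_fexp:
  assumes \<theta>: "coeff_derivation \<theta>" and a0: "a $ 0 = 0" and comm: "\<theta> a * a = a * \<theta> a"
  shows "\<theta> (fexp a) = \<theta> a * fexp a"
proof -
  obtain D where D: "\<And>f n. \<theta> f $ n = D n (f $ n)" and D_add: "\<And>n a b. D n (a + b) = D n a + D n b"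
      and D_qof: "\<And>n q a. D n (qof q * a) = qof q * D n a"
    using \<theta> unfolding coeff_derivation_def by blast
  have mult: "\<theta> (f * g) = \<theta> f * g + f * \<theta> g" for f g
    using \<theta> unfolding coeff_derivation_def by blast
  have D0: "D n 0 = 0" for n using D_add[of n 0 0] by simp
  have qof: "\<theta> (qof q * f) = qof q * \<theta> f" for q f
    by (rule fps_ext) (simp add: D D_qof)
  have one: "\<theta> 1 = 0" using mult[of 1 1] by simp
  have D_sum: "D n (\<Sum>k\<in>A. f k) = (\<Sum>k\<in>A. D n (f k))" if "finite A" for n A and f :: "nat \<Rightarrow> _"
    using that by (induction A rule: finite_induct) (simp_all add: D0 D_add)
  have fsum: "\<theta> (fsum P) = fsum (\<lambda>k. \<theta> (P k))" for P
    by (rule fps_ext) (simp add: D fsum_def D_sum)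
  have Suc: "\<theta> (dpow a (Suc k)) = \<theta> a * dpow a k" for k
  proof (induction k)
    case (Suc k)
    have "of_nat (Suc (Suc k)) * \<theta> (dpow a (Suc (Suc k))) = \<theta> (a * dpow a (Suc k))"
      by (simp only: dpow_Suc[symmetric] qof[of "of_nat _", simplified qof_of_nat])
    also have "\<dots> = \<theta> a * dpow a (Suc k) + \<theta> a * (a * dpow a k)"
      using comm by (simp add: mult Suc flip: mult.assoc)
    also have "\<theta> a * (a * dpow a k) = of_nat (Suc k) * (\<theta> a * dpow a (Suc k))"
      by (metis dpow_Suc mult.assoc mult_of_nat_commute)
    also have "\<theta> a * dpow a (Suc k) + \<dots> = of_nat (Suc (Suc k)) * (\<theta> a * dpow a (Suc k))"
      by (simp add: algebra_simps)
    finally show ?case by (rule of_nat_mult_cancel) simp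
  qed simp
  have "\<theta> (fexp a) = fsum (\<lambda>k. \<theta> (dpow a k))"
    by (simp add: fexp_def fsum)
  also have "ord_ge (\<theta> (dpow a k)) k" for k
    using ord_ge_dpow[OF a0, of k] by (simp add: ord_ge_def D D0)
  then have "fsum (\<lambda>k. \<theta> (dpow a k)) = fsum (\<lambda>k. \<theta> a * dpow a k)"
    by (subst fsum_split_first) (simp_all add: one Suc)
  finally show ?thesis
    by (simp add: fexp_def fsum_mult_left ord_ge_dpow a0)
qed

text \<open>Coefficient n of the image depends additively on the single coefficient
  \<open>e n\<close>, and \<open>e n \<le> n\<close> keeps it within the truncation of
  \<open>fsum\<close>. This covers the substitutions \<open>inner_0\<close>, \<open>diag\<close>,
  \<open>spread\<close> and \<open>altz\<close>.\<close>

lemma fexp_hom: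
  fixes \<phi> :: "'a::rat_algebra fps \<Rightarrow> 'b::rat_algebra fps"
  assumes mult: "\<And>f g. \<phi> (f * g) = \<phi> f * \<phi> g" and qof: "\<And>q. \<phi> (qof q) = qof q"
    and L: "\<And>f n. \<phi> f $ n = L n (f $ e n)" and L_add: "\<And>n a b. L n (a + b) = L n a + L n b"
    and e: "\<And>n. e n \<le> n" and e0: "e 0 = 0" and a0: "a $ 0 = 0"
  shows "\<phi> (fexp a) = fexp (\<phi> a)"
proof -
  have L0: "L n 0 = 0" for n using L_add[of n 0 0] by simp
  have pow: "\<phi> (a ^ k) = \<phi> a ^ k" for k
    by (induction k) (simp_all add: mult qof[of 1, simplified])
  have dpow: "\<phi> (dpow a k) = dpow (\<phi> a) k" for k
    by (simp add: dpow_def mult qof pow)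
  have L_sum: "L n (\<Sum>k\<in>A. f k) = (\<Sum>k\<in>A. L n (f k))" if "finite A" for n A and f :: "nat \<Rightarrow> _"
    using that by (induction A rule: finite_induct) (simp_all add: L0 L_add)
  show ?thesis
  proof (rule fps_ext)
    fix n
    have "\<phi> (fexp a) $ n = (\<Sum>k<Suc n. \<phi> (dpow a k) $ n)"
      using e[of n] by (simp add: L fexp_nth[OF a0, of _ "Suc n"] L_sum del: sum.lessThan_Suc)
    also have "\<dots> = fexp (\<phi> a) $ n"
      using a0 by (subst fexp_nth[of _ _ "Suc n"]) (simp_all add: L e0 L0 flip: dpow)
    finally show "\<phi> (fexp a) $ n = fexp (\<phi> a) $ n" .
  qed
qed

subsection \<open>Two-variable series\<close>

lemma XD_mult: "fps_XD (f * g) = fps_XD f * g + f * fps_XD (g :: 'a::ring_1 fps)"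
proof (rule fps_ext)
  fix n
  have "of_nat n * (f $ i * g $ (n - i)) = of_nat i * (f $ i * g $ (n - i)) + of_nat (n - i) * (f $ i * g $ (n - i))"
    if "i \<in> {0..n}" for i
    using that by (simp flip: distrib_right of_nat_add)
  moreover have "f $ i * (of_nat (n - i) * g $ (n - i)) = of_nat (n - i) * (f $ i * g $ (n - i))" for i
    by (metis mult.assoc mult_of_nat_commute)
  ultimately have "of_nat n * (f $ i * g $ (n - i))
      = of_nat i * f $ i * g $ (n - i) + f $ i * (of_nat (n - i) * g $ (n - i))" if "i \<in> {0..n}" for i
    using that by (simp only: mult.assoc)
  then show "fps_XD (f * g) $ n = (fps_XD f * g + f * fps_XD g) $ n"
    unfolding fps_XD_nth fps_add_nth fps_mult_nth sum_distrib_left sum.distrib[symmetric]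
    by (rule sum.cong[OF refl])
qed

lemma XD_add: "fps_XD (f + g) = fps_XD f + fps_XD (g :: 'a::ring_1 fps)"
  by (rule fps_ext) (simp add: algebra_simps)

lemma XD_qof_mult: "fps_XD (qof q * f) = qof q * fps_XD f"
  by (rule fps_ext) (simp add: qof_left_commute)

lemma coeff_derivation_XD: "coeff_derivation fps_XD"
  unfolding coeff_derivation_def
  by (intro conjI allI XD_mult exI[of _ "\<lambda>n a. of_nat n * a"])
    (simp_all add: distrib_left qof_left_commute)

text \<open>As Y has no constant term, n times coefficient n of the difference is a combination of
  its earlier coefficients.\<close>

lemma XD_ode_unique:
  fixes F G Y :: "'a::rat_algebra fps"
  assumes "fps_XD F = Y * F" "fps_XD G = Y * G" "Y $ 0 = 0" "F $ 0 = G $ 0"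
  shows "F = G"
proof -
  define D where "D = F - G"
  have D: "fps_XD D = Y * D"
    unfolding D_def right_diff_distrib assms(1,2)[symmetric] by (rule fps_ext) (simp add: right_diff_distrib)
  have "D $ n = 0" for n
  proof (induction n rule: less_induct)
    case (less n)
    show ?case
    proof (cases "n = 0")
      case False
      have "of_nat n * D $ n = (Y * D) $ n" using D by (metis fps_XD_nth)
      also have "\<dots> = 0"
        unfolding fps_mult_nth
      proof (rule sum.neutral, rule ballI)
        fix i assume "i \<in> {0..n}"
        then show "Y $ i * D $ (n - i) = 0"
          using less[of "n - i"] assms(3) False by (cases "i = 0") auto
      qed
      finally show ?thesis using of_nat_mult_cancel[of n "D $ n" 0] False by simp
    qed (simp add: D_def assms)
  qed
  then show ?thesis by (simp add: D_def fps_eq_iff)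
qed

definition inner_XD :: "'a::rat_algebra fps fps \<Rightarrow> 'a fps fps"
  where "inner_XD f = Abs_fps (\<lambda>n. fps_XD (f $ n))"

lemma inner_XD_nth: "inner_XD f $ n = fps_XD (f $ n)"
  by (simp add: inner_XD_def)

lemma inner_XD_mult: "inner_XD (f * g) = inner_XD f * g + f * inner_XD g"
proof (rule fps_ext)
  fix n
  have "fps_XD (\<Sum>i\<in>A. h i) = (\<Sum>i\<in>A. fps_XD (h i))" if "finite A" for A and h :: "nat \<Rightarrow> 'a fps"
    using that by (induction A rule: finite_induct) (simp_all add: XD_add, simp add: fps_eq_iff)
  then show "inner_XD (f * g) $ n = (inner_XD f * g + f * inner_XD g) $ n"
    by (simp add: inner_XD_def fps_mult_nth XD_mult sum.distrib)
qed

lemma coeff_derivation_inner_XD: "coeff_derivation inner_XD"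
  unfolding coeff_derivation_def
  by (intro conjI allI inner_XD_mult exI[of _ "\<lambda>n. fps_XD"])
    (simp_all add: inner_XD_def XD_add XD_qof_mult)

text \<open>Sets the inner variable, hence \<open>varu\<close>, to 0: the initial condition for the
  equation in \<open>varu\<close>.\<close>

definition inner_0 :: "'a::rat_algebra fps fps \<Rightarrow> 'a fps"
  where "inner_0 f = Abs_fps (\<lambda>n. f $ n $ 0)"

lemma inner_0_mult: "inner_0 (f * g) = inner_0 f * inner_0 g"
  by (rule fps_ext) (simp add: inner_0_def fps_mult_nth fps_sum_nth)

lemma inner_0_fexp: "a $ 0 = 0 \<Longrightarrow> inner_0 (fexp a) = fexp (inner_0 a)"
  by (rule fexp_hom[where L = "\<lambda>n c. c $ 0" and e = "\<lambda>n. n"])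
    (simp_all add: inner_0_mult, simp_all add: inner_0_def fps_eq_iff qof_nth)

text \<open>Induction on the outer degree. Once the lower coefficients agree, the inner derivation
  kills coefficient n of the difference; this coefficient is then constant in the inner variable,
  and \<open>inner_0\<close> settles constants.\<close>

lemma inner_XD_ode_unique:
  fixes F G Y :: "'a::rat_algebra fps fps"
  assumes F: "inner_XD F = Y * F" and G: "inner_XD G = Y * G" and Y: "Y $ 0 = 0"
    and eq: "inner_0 F = inner_0 G"
  shows "F = G"
proof -
  define D where "D = F - G"
  have D: "inner_XD D = Y * D"
    unfolding D_def right_diff_distrib F[symmetric] G[symmetric]
    by (rule fps_ext, rule fps_ext) (simp add: inner_XD_def right_diff_distrib)
  have D0: "D $ n $ 0 = 0" for n
    using eq by (simp add: D_def inner_0_def fps_eq_iff)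
  have "D $ n = 0" for n
  proof (induction n rule: less_induct)
    case (less n)
    have "fps_XD (D $ n) = (Y * D) $ n" using D by (metis inner_XD_nth)
    also have "\<dots> = 0"
      unfolding fps_mult_nth
    proof (rule sum.neutral, rule ballI)
      fix i assume "i \<in> {0..n}"
      then show "Y $ i * D $ (n - i) = 0"
        using less[of "n - i"] Y by (cases "i = 0") auto
    qed
    finally have *: "of_nat k * D $ n $ k = 0" for k
      by (metis fps_XD_nth fps_zero_nth)
    have "D $ n $ k = 0" for k
      using of_nat_mult_cancel[of k "D $ n $ k" 0] *[of k] D0[of n] by (cases "k = 0") auto
    then show ?case by (simp add: fps_eq_iff)
  qed
  then show ?thesis by (simp add: D_def fps_eq_iff)
qed

text \<open>With the outer variable \<open>s\<close> and the inner variable \<open>w\<close>, the two variables of the exponential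
  generating functions are \<open>varu = s w\<close> and \<open>varv = s\<close>, so that all exponents have positive order in
  \<open>s\<close>, and \<open>inner_XD\<close> is the derivation \<open>varu d/dvaru\<close>; \<open>diag f\<close> is \<open>f (varu varv)\<close>.\<close>

definition varu :: "'a::rat_algebra fps fps" where "varu = fps_X * fps_const fps_X"
definition varv :: "'a::rat_algebra fps fps" where "varv = fps_X"

definition diag :: "'a::rat_algebra fps \<Rightarrow> 'a fps fps"
  where "diag f = Abs_fps (\<lambda>n. Abs_fps (\<lambda>k. if n = 2 * k then f $ k else 0))"

lemma diag_nth: "diag f $ n $ k = (if n = 2 * k then f $ k else 0)"
  by (simp add: diag_def)

lemma varu_nth: "(varu * f) $ n $ k = (if n = 0 \<or> k = 0 then 0 else f $ (n - 1) $ (k - 1))"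
  by (simp add: varu_def mult.assoc)

lemma varv_nth: "(varv * f) $ n $ k = (if n = 0 then 0 else f $ (n - 1) $ k)"
  by (simp add: varv_def)

lemma varu_commute: "varu * f = f * varu"
proof -
  have "fps_const fps_X * f = f * fps_const (fps_X :: 'a fps)"
    by (rule fps_ext) (simp add: fps_mult_fps_X_commute)
  then show ?thesis
    by (simp add: varu_def mult.assoc) (metis fps_mult_fps_X_commute mult.assoc)
qed

lemma varv_commute: "varv * f = f * varv"
  by (simp add: varv_def fps_mult_fps_X_commute)

lemma varu_nth_0 [simp]: "varu $ 0 = 0" and varv_nth_0 [simp]: "varv $ 0 = 0"
  by (simp_all add: varu_def varv_def)

lemma diag_add: "diag (f + g) = diag f + diag g"
  by (rule fps_ext, rule fps_ext) (simp add: diag_nth)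

lemma diag_0 [simp]: "diag 0 = 0"
  by (rule fps_ext, rule fps_ext) (simp add: diag_nth)

lemma diag_mult: "diag (f * g) = diag f * diag g"
proof (rule fps_ext, rule fps_ext)
  fix n k
  have "(diag f * diag g) $ n $ k = (\<Sum>i=0..n. \<Sum>j=0..k. diag f $ i $ j * diag g $ (n - i) $ (k - j))"
    by (simp add: fps_mult_nth fps_sum_nth)
  also have "\<dots> = (\<Sum>j=0..k. \<Sum>i=0..n. if i = 2 * j then f $ j * diag g $ (n - 2 * j) $ (k - j) else 0)"
    by (subst sum.swap, intro sum.cong) (auto simp: diag_nth)
  also have "\<dots> = (\<Sum>j=0..k. if 2 * j \<le> n then f $ j * diag g $ (n - 2 * j) $ (k - j) else 0)"
    by (simp add: sum.delta)
  also have "\<dots> = (\<Sum>j=0..k. if n = 2 * k then f $ j * g $ (k - j) else 0)"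
    by (intro sum.cong) (auto simp: diag_nth)
  also have "\<dots> = diag (f * g) $ n $ k"
    by (simp add: diag_nth fps_mult_nth)
  finally show "diag (f * g) $ n $ k = (diag f * diag g) $ n $ k" by simp
qed

lemma diag_qof: "diag (qof q) = qof q"
  by (rule fps_ext, rule fps_ext) (simp add: diag_nth qof_nth)

lemma diag_fexp: "a $ 0 = 0 \<Longrightarrow> diag (fexp a) = fexp (diag a)"
  by (rule fexp_hom[where L = "\<lambda>n c. Abs_fps (\<lambda>k. if n = 2 * k then c else 0)" and e = "\<lambda>n. n div 2"])
    (auto simp: diag_mult diag_qof fps_eq_iff diag_nth)

lemma diag_nth_0: "f $ 0 = 0 \<Longrightarrow> diag f $ 0 = 0"
  by (rule fps_ext) (simp add: diag_nth)

lemma varu_varv: "varu * varv = diag fps_X"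
  by (rule fps_ext, rule fps_ext) (auto simp: varu_nth diag_nth varv_def fps_X_def)

lemma inner_XD_varu: "inner_XD varu = varu"
  by (rule fps_ext, rule fps_ext) (simp add: inner_XD_def varu_def fps_X_def)

lemma inner_XD_varv: "inner_XD varv = 0"
  by (rule fps_ext, rule fps_ext) (simp add: inner_XD_def varv_def fps_X_def)

lemma inner_XD_diag: "inner_XD (diag f) = diag (fps_XD f)"
  by (rule fps_ext, rule fps_ext) (simp add: inner_XD_def diag_nth)

lemma inner_0_varu [simp]: "inner_0 (varu * f) = 0"
  by (rule fps_ext) (simp add: inner_0_def varu_nth)

lemma inner_0_varv: "inner_0 (varv * f) = fps_X * inner_0 f"
  by (rule fps_ext) (simp add: inner_0_def varv_nth)

lemma inner_0_diag: "inner_0 (diag f) = fps_const (f $ 0)"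
  by (rule fps_ext) (simp add: inner_0_def diag_nth)

subsection \<open>Brackets of generating series\<close>

text \<open>A current: the generating series of p with scalar weights f. The noncommutative content
  sits in p, so identities between currents reduce to identities between rational series.\<close>

definition ser :: "rat fps \<Rightarrow> (nat \<Rightarrow> 'a::rat_algebra) \<Rightarrow> 'a fps"
  where "ser f p = Abs_fps (\<lambda>j. qof (f $ j) * p j)"

lemma ser_nth: "ser f p $ n = qof (f $ n) * p n"
  by (simp add: ser_def)

lemma ser_add: "ser (f + g) p = ser f p + ser g p"
  by (rule fps_ext) (simp add: ser_nth qof_add distrib_right)

lemma ser_minus: "ser (- f) p = - ser f p"
  by (rule fps_ext) (simp add: ser_nth qof_minus)

lemma ser_0 [simp]: "ser 0 p = 0"
  by (rule fps_ext) (simp add: ser_nth)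

lemma ser_qof: "ser (qof q * f) p = qof q * ser f p"
  by (rule fps_ext) (simp add: ser_nth qof_mult mult.assoc)

lemma ser_XD: "fps_XD (ser f p) = ser (fps_XD f) p"
  by (rule fps_ext) (simp add: ser_nth qof_mult mult.assoc)

lemma ser_shift: "fps_X * ser f (\<lambda>j. p (Suc j)) = ser (fps_X * f) p"
proof (rule fps_ext)
  fix n
  show "(fps_X * ser f (\<lambda>j. p (Suc j))) $ n = ser (fps_X * f) p $ n"
    by (cases n) (simp_all add: ser_nth)
qed

lemma qof_mult_qof_mult: "qof a * x * (qof b * y) = qof a * (qof b * (x * y))"
  by (simp only: mult.assoc qof_left_commute[of x])

text \<open>A bracket depending only on i + j turns the double sum into a convolution, that is, into
  the product f g. The hypothesis is restricted to the supports of f and g so that index parities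
  may enter it.\<close>

lemma ser_bracket:
  assumes "\<And>i j. f $ i \<noteq> 0 \<Longrightarrow> g $ j \<noteq> 0 \<Longrightarrow> p i * q j = q j * p i + qof A * r (i + j)"
  shows "ser f p * ser g q = ser g q * ser f p + ser (qof A * (f * g)) r"
proof (rule fps_ext)
  fix n
  have gf: "(ser g q * ser f p) $ n = (\<Sum>i=0..n. qof (f $ i) * (qof (g $ (n - i)) * (q (n - i) * p i)))"
    unfolding fps_mult_nth ser_nth
    by (rule sum.reindex_bij_witness[of _ "\<lambda>i. n - i" "\<lambda>i. n - i"])
      (auto simp: qof_mult_qof_mult intro: qof_left_commute)
  have "(ser f p * ser g q) $ n = (\<Sum>i=0..n. qof (f $ i) * (qof (g $ (n - i)) * (p i * q (n - i))))"
    by (simp add: fps_mult_nth ser_nth qof_mult_qof_mult)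
  also have "\<dots> = (\<Sum>i=0..n. qof (f $ i) * (qof (g $ (n - i)) * (q (n - i) * p i))
      + qof (A * (f $ i * g $ (n - i))) * r n)"
  proof (rule sum.cong[OF refl])
    fix i assume i: "i \<in> {0..n}"
    show "qof (f $ i) * (qof (g $ (n - i)) * (p i * q (n - i)))
      = qof (f $ i) * (qof (g $ (n - i)) * (q (n - i) * p i)) + qof (A * (f $ i * g $ (n - i))) * r n"
    proof (cases "f $ i = 0 \<or> g $ (n - i) = 0")
      case False
      have "qof (f $ i) * (qof (g $ (n - i)) * (qof A * r n)) = qof (A * (f $ i * g $ (n - i))) * r n"
        by (simp add: mult_ac flip: qof_mult mult.assoc[where 'a = 'a])
      then show ?thesis using False i assms[of i "n - i"] by (simp add: distrib_left)
    qed auto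
  qed
  also have "\<dots> = (ser g q * ser f p) $ n + qof (\<Sum>i=0..n. A * (f $ i * g $ (n - i))) * r n"
    by (simp add: gf sum.distrib qof_sum sum_distrib_right)
  also have "(\<Sum>i=0..n. A * (f $ i * g $ (n - i))) = (qof A * (f * g)) $ n"
    unfolding qof_mult_nth qof_rat_def unfolding fps_mult_nth sum_distrib_left ..
  finally show "(ser f p * ser g q) $ n = (ser g q * ser f p + ser (qof A * (f * g)) r) $ n"
    by (simp add: ser_nth)
qed

text \<open>Commutation with a Cartan current multiplies f by a scalar series \<open>\<phi>\<close>
  and need not terminate; the iterates add up to multiplication by
  \<open>fexp \<phi>\<close>.\<close>

lemma fexp_conj_infinite:
  fixes p :: "nat \<Rightarrow> 'a::rat_algebra" and W :: "'a fps fps"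
  assumes a: "a $ 0 = 0" and \<phi>0: "\<phi> $ 0 = 0"
    and br: "\<And>f. W * diag (ser f p) * a = a * (W * diag (ser f p)) + W * diag (ser (\<phi> * f) p)"
  shows "W * diag (ser f p) * fexp a = fexp a * (W * diag (ser (fexp \<phi> * f) p))"
proof -
  define Z where "Z i = W * diag (ser (dpow \<phi> i * f) p)" for i
  have "Z i * a = a * Z i + of_nat (Suc i) * Z (Suc i)" for i
  proof -
    have "\<phi> * (dpow \<phi> i * f) = of_nat (Suc i) * (dpow \<phi> (Suc i) * f)"
      by (metis dpow_Suc mult.assoc)
    then have "W * diag (ser (\<phi> * (dpow \<phi> i * f)) p) = of_nat (Suc i) * Z (Suc i)"
      using ser_qof[of "of_nat (Suc i)" "dpow \<phi> (Suc i) * f" p]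
        diag_mult[of "of_nat (Suc i)" "ser (dpow \<phi> (Suc i) * f) p"]
        diag_qof[of "of_nat (Suc i)", where 'a = 'a]
        qof_left_commute[of W "of_nat (Suc i)" "diag (ser (dpow \<phi> (Suc i) * f) p)"]
      unfolding Z_def by (simp only: qof_of_nat)
    then show ?thesis unfolding Z_def br by simp
  qed
  then have "Z 0 * fexp a = fexp a * fsum Z" by (rule fexp_conj[OF a])
  moreover have "fsum Z = W * diag (ser (fexp \<phi> * f) p)"
  proof -
    have "fsum (\<lambda>i. diag (ser (dpow \<phi> i * f) p)) = diag (ser (fexp \<phi> * f) p)"
    proof (rule fps_ext, rule fps_ext)
      fix n k
      have "(fexp \<phi> * f) $ k = (\<Sum>i\<le>n. (dpow \<phi> i * f) $ k)" if "n = 2 * k"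
      proof -
        have "fexp \<phi> * f = fsum (\<lambda>i. dpow \<phi> i * f)"
          by (simp add: fexp_def fsum_mult_right ord_ge_dpow \<phi>0)
        also have "ord_ge (dpow \<phi> i * f) i" for i
          using ord_ge_mult[OF ord_ge_dpow[OF \<phi>0] ord_ge_0, of i f] by simp
        then have "fsum (\<lambda>i. dpow \<phi> i * f) $ k = (\<Sum>i<Suc n. (dpow \<phi> i * f) $ k)"
          using that by (intro fsum_nth) auto
        finally show ?thesis by (simp only: lessThan_Suc_atMost)
      qed
      then show "fsum (\<lambda>i. diag (ser (dpow \<phi> i * f) p)) $ n $ k = diag (ser (fexp \<phi> * f) p) $ n $ k"
        by (simp add: fsum_def fps_sum_nth diag_nth ser_nth qof_sum sum_distrib_right)
    qed
    moreover have "ord_ge (diag (ser (dpow \<phi> i * f) p)) i" for i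
    proof -
      have "ord_ge (dpow \<phi> i * f) i"
        using ord_ge_mult[OF ord_ge_dpow[OF \<phi>0] ord_ge_0, of i f] by simp
      then show ?thesis by (auto simp: ord_ge_def fps_eq_iff diag_nth ser_nth)
    qed
    ultimately show ?thesis
      unfolding Z_def by (simp flip: fsum_mult_left)
  qed
  ultimately show ?thesis by (simp add: Z_def)
qed

text \<open>The prefactor c is a central monomial recording the excess of one variable over the
  other; the remaining dependence, on the product of \<open>varu\<close> and \<open>varv\<close>, is
  put in by \<open>diag\<close>.\<close>

definition cur :: "'a::rat_algebra fps fps \<Rightarrow> (nat \<Rightarrow> 'a) \<Rightarrow> rat fps \<Rightarrow> 'a fps fps"
  where "cur c p f = c * diag (ser f p)"

lemma cur_add: "cur c p (f + g) = cur c p f + cur c p g"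
  by (simp add: cur_def ser_add diag_add distrib_left)

lemma cur_0 [simp]: "cur c p 0 = 0"
  by (simp add: cur_def)

lemma cur_minus: "cur c p (- f) = - cur c p f"
  using cur_add[of c p f "- f"] by (simp add: eq_neg_iff_add_eq_0 add.commute)

lemma cur_numeral: "cur c p (numeral n * f) = numeral n * cur c p f"
proof -
  have "cur c p (qof q * f) = qof q * cur c p f" for q
    by (simp only: cur_def ser_qof diag_mult diag_qof qof_left_commute[of c])
  from this[of "numeral n"] show ?thesis by (simp only: qof_numeral)
qed

lemma cur_nth_0 [simp]: "c $ 0 = 0 \<Longrightarrow> cur c p f $ 0 = 0"
  by (simp add: cur_def)

lemma cur_1_nth_0 [simp]: "f $ 0 = 0 \<Longrightarrow> cur 1 p f $ 0 = 0"
  by (simp add: cur_def diag_nth_0 ser_nth)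

lemma cur_bracket:
  assumes c: "\<And>x. c * x = x * c" and d: "\<And>x. d * x = x * d"
    and br: "\<And>i j. f $ i \<noteq> 0 \<Longrightarrow> g $ j \<noteq> 0 \<Longrightarrow> p i * q j = q j * p i + qof A * r (i + j)"
  shows "cur c p f * cur d q g = cur d q g * cur c p f + cur (c * d) r (qof A * (f * g))"
proof -
  have "cur c p f * cur d q g = c * d * diag (ser f p * ser g q)"
    by (simp add: cur_def diag_mult mult.assoc) (metis d mult.assoc)
  also have "ser f p * ser g q = ser g q * ser f p + ser (qof A * (f * g)) r"
    using br by (rule ser_bracket)
  also have "c * d * diag (ser g q * ser f p + ser (qof A * (f * g)) r)
      = c * d * (diag (ser g q) * diag (ser f p)) + cur (c * d) r (qof A * (f * g))"
    by (simp add: cur_def diag_add diag_mult distrib_left)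
  also have "c * d * (diag (ser g q) * diag (ser f p)) = cur d q g * cur c p f"
    unfolding cur_def by (metis c mult.assoc)
  finally show ?thesis .
qed

lemma cur_commute:
  assumes c: "\<And>x. c * x = x * c" and d: "\<And>x. d * x = x * d"
    and br: "\<And>i j. f $ i \<noteq> 0 \<Longrightarrow> g $ j \<noteq> 0 \<Longrightarrow> p i * q j = q j * p i"
  shows "cur c p f * cur d q g = cur d q g * cur c p f"
  using cur_bracket[OF c d, of f g p q 0 p] br by simp

text \<open>The bracket of x^+ and x^- has index \<open>Suc (i + j)\<close>; the extra 1 is matched
  by the product of their prefactors \<open>varu\<close> and \<open>varv\<close>.\<close>

lemma cur_shift: "cur (varu * varv) (\<lambda>j. p (Suc j)) f = cur 1 p (fps_X * f)"
  by (simp add: cur_def varu_varv flip: diag_mult ser_shift)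

lemma inner_XD_cur_1: "inner_XD (cur 1 p f) = cur 1 p (fps_XD f)"
  by (simp add: cur_def inner_XD_diag ser_XD)

lemma inner_XD_cur_varv: "inner_XD (cur varv p f) = cur varv p (fps_XD f)"
  by (simp add: cur_def inner_XD_mult inner_XD_varv inner_XD_diag ser_XD)

lemma inner_XD_cur_varv2: "inner_XD (cur (varv * varv) p f) = cur (varv * varv) p (fps_XD f)"
  by (simp add: cur_def inner_XD_mult inner_XD_varv inner_XD_diag ser_XD)

lemma inner_XD_cur_varu: "inner_XD (cur varu p f) = cur varu p (f + fps_XD f)"
  by (simp add: cur_def inner_XD_mult inner_XD_varu inner_XD_diag ser_XD ser_add diag_add distrib_left)

lemma inner_XD_cur_varu2:
  "inner_XD (cur (varu * varu) p f) = cur (varu * varu) p (2 * f + fps_XD f)"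
proof -
  have "inner_XD (cur (varu * varu) p f) = cur (varu * varu) p (f + f + fps_XD f)"
    unfolding cur_add unfolding cur_def
    by (simp add: inner_XD_mult inner_XD_varu inner_XD_diag ser_XD distrib_left distrib_right mult.assoc)
  then show ?thesis unfolding mult_2 .
qed

lemma inner_XD_fexp:
  assumes "a $ 0 = 0" "inner_XD a * a = a * inner_XD a"
  shows "inner_XD (fexp a) = inner_XD a * fexp a"
  by (rule coeff_derivation_fexp[OF coeff_derivation_inner_XD assms])

text \<open>For odd r + s the brackets depend on the parity of the indices, so every scalar series
  is split into its even and its odd part.\<close>

definition parity :: "bool \<Rightarrow> rat fps \<Rightarrow> bool"
  where "parity d f \<longleftrightarrow> (\<forall>n. f $ n \<noteq> 0 \<longrightarrow> even n = d)"

lemma parity_mult: "parity d f \<Longrightarrow> parity e g \<Longrightarrow> parity (d = e) (f * g)"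
  unfolding parity_def
proof (intro allI impI)
  fix n assume f: "\<forall>n. f $ n \<noteq> 0 \<longrightarrow> even n = d" and g: "\<forall>n. g $ n \<noteq> 0 \<longrightarrow> even n = e"
    and "(f * g) $ n \<noteq> 0"
  then obtain i where i: "i \<in> {0..n}" "f $ i * g $ (n - i) \<noteq> 0"
    unfolding fps_mult_nth by (meson sum.not_neutral_contains_not_neutral)
  then have "even i = d" "even (n - i) = e" "n = i + (n - i)" using f g by auto
  then show "even n = (d = e)" by (metis even_add)
qed

lemma parity_add: "parity d f \<Longrightarrow> parity d g \<Longrightarrow> parity d (f + g)"
  unfolding parity_def fps_add_nth by (metis add.right_neutral)

lemma parity_minus: "parity d f \<Longrightarrow> parity d (- f)"
  by (simp add: parity_def)

lemma parity_XD: "parity d f \<Longrightarrow> parity d (fps_XD f)"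
  by (auto simp: parity_def)

lemma parity_X: "parity False fps_X"
  by (auto simp: parity_def fps_X_def)

lemma parity_1: "parity True 1"
  by (auto simp: parity_def)

lemma parity_qof: "parity d f \<Longrightarrow> parity d (qof q * f)"
  by (auto simp: parity_def)

subsection \<open>The straightening formulas\<close>

lemma varv2_commute: "varv * varv * f = f * (varv * varv)"
  by (metis mult.assoc varv_commute)

lemma varu2_commute: "varu * varu * f = f * (varu * varu)"
  by (metis mult.assoc varu_commute)

lemma XD_1 [simp]: "fps_XD 1 = (0 :: 'a::ring_1 fps)"
  by (rule fps_ext) simp

lemma inner_0_cur_1: "f $ 0 = 0 \<Longrightarrow> inner_0 (cur 1 p f) = 0"
  by (simp add: cur_def inner_0_diag ser_nth)

lemma inner_0_cur_varu [simp]: "inner_0 (cur varu p f) = 0" "inner_0 (cur (varu * varu) p f) = 0"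
  by (simp_all add: cur_def mult.assoc)

lemma inner_0_cur_varv: "inner_0 (cur varv p f) = fps_X * fps_const (qof (f $ 0) * p 0)"
  by (simp add: cur_def inner_0_varv inner_0_diag ser_nth)

lemma inner_0_cur_varv2: "f $ 0 = 0 \<Longrightarrow> inner_0 (cur (varv * varv) p f) = 0"
  by (simp add: cur_def inner_0_varv inner_0_diag ser_nth mult.assoc)

lemma cur_bracket_neg:
  assumes "\<And>x. c * x = x * c" "\<And>x. d * x = x * d"
    and br: "\<And>i j. f $ i \<noteq> 0 \<Longrightarrow> g $ j \<noteq> 0 \<Longrightarrow> p i * q j = q j * p i - numeral k * r (i + j)"
  shows "cur c p f * cur d q g = cur d q g * cur c p f + cur (c * d) r (- (numeral k * (f * g)))"
proof -
  have "cur c p f * cur d q g = cur d q g * cur c p f + cur (c * d) r (qof (- numeral k) * (f * g))"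
    by (rule cur_bracket[OF assms(1,2)]) (simp_all add: br qof_minus)
  then show ?thesis by (simp add: qof_minus)
qed

lemma cur_bracket_neg_1:
  assumes "\<And>x. c * x = x * c" "\<And>x. d * x = x * d"
    and br: "\<And>i j. f $ i \<noteq> 0 \<Longrightarrow> g $ j \<noteq> 0 \<Longrightarrow> p i * q j = q j * p i - r (i + j)"
  shows "cur c p f * cur d q g = cur d q g * cur c p f + cur (c * d) r (- (f * g))"
  using cur_bracket_neg[OF assms(1,2), of f g p q Num.One r] br by simp

lemmas cur_bracket_h_left = cur_bracket_neg[where c = 1, simplified]
lemmas cur_bracket_h_right = cur_bracket_neg[where d = 1, simplified]

lemma fexp_conj_cur:
  assumes "a $ 0 = 0" "\<phi> $ 0 = 0"
    and "\<And>f. cur c p f * a = a * cur c p f + cur c p (\<phi> * f)"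
  shows "cur c p f * fexp a = fexp a * cur c p (fexp \<phi> * f)"
  unfolding cur_def by (rule fexp_conj_infinite[OF assms(1,2)]) (use assms(3) in \<open>simp add: cur_def\<close>)

lemma conj_trans: "a * m = m * b \<Longrightarrow> b * n = n * c \<Longrightarrow> a * (m * n) = m * n * (c :: 'a::semigroup_mult)"
  by (metis mult.assoc)

text \<open>The relations of \<open>xplus r s\<close>, \<open>xminus r s\<close> and
  \<open>hh r s\<close> for even r + s, freed from r and s: a current algebra of type A_1. The shift
  \<open>Suc\<close> arises because the indices r + (r + s) i and s + (r + s) j add up to (r + s)(i
  + j + 1).\<close>

locale even_currents =
  fixes xp xm h :: "nat \<Rightarrow> 'a::rat_algebra"
  assumes xp_xm: "xp i * xm j = xm j * xp i + h (Suc (i + j))"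
    and xp_h: "0 < j \<Longrightarrow> xp i * h j = h j * xp i - 2 * xp (i + j)"
    and h_xm: "0 < i \<Longrightarrow> h i * xm j = xm j * h i - 2 * xm (i + j)"
    and h_h: "0 < i \<Longrightarrow> 0 < j \<Longrightarrow> h i * h j = h j * h i"
    and xp_xp: "xp i * xp j = xp j * xp i"
    and xm_xm: "xm i * xm j = xm j * xm i"
begin

text \<open>The conditions on b and \<open>\<eta>\<close> are what the equation in
  \<open>varu\<close> imposes: \<open>b\<close> matches the x^- part left over when x^+ crosses the
  first factor, \<open>\<eta>\<close> matches the h part, and \<open>exp\<close> the effect of the
  Cartan factor on the x^+ current.\<close>

theorem straightening:
  fixes b \<eta> :: "rat fps"
  assumes b0: "b $ 0 = 1" and b: "fps_XD b = - (fps_X * b\<^sup>2)"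
    and \<eta>0: "\<eta> $ 0 = 0" and \<eta>: "fps_XD \<eta> = fps_X * b" and exp: "fexp (- (2 * \<eta>)) = b + fps_XD b"
  shows "fexp (cur varu xp 1) * fexp (cur varv xm 1)
    = fexp (cur varv xm b) * fexp (cur 1 h \<eta>) * fexp (cur varu xp b)"
proof (rule inner_XD_ode_unique[where Y = "cur varu xp 1"])
  have XP_XM: "cur varu xp f * cur varv xm g = cur varv xm g * cur varu xp f + cur 1 h (fps_X * (f * g))" for f g
    using cur_bracket[OF varu_commute varv_commute, where p = xp and q = xm and A = 1
        and r = "\<lambda>j. h (Suc j)" and f = f and g = g]
    by (simp add: cur_shift xp_xm)
  have H_XM: "cur 1 h f * cur varv xm g = cur varv xm g * cur 1 h f + cur varv xm (- (2 * (f * g)))"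
    if "f $ 0 = 0" for f g
    by (rule cur_bracket_h_left[OF varv_commute], rule h_xm) (use that gr0I in fastforce)
  have XP_H: "cur varu xp f * cur 1 h g = cur 1 h g * cur varu xp f + cur varu xp (- (2 * g) * f)"
    if "g $ 0 = 0" for f g
  proof -
    have "cur varu xp f * cur 1 h g = cur 1 h g * cur varu xp f + cur varu xp (- (2 * (f * g)))"
      by (rule cur_bracket_h_right[OF varu_commute], rule xp_h) (use that in \<open>auto intro!: gr0I\<close>)
    then show ?thesis by (simp add: mult.commute[of f] mult.assoc)
  qed
  have XM_XM: "cur varv xm f * cur varv xm g = cur varv xm g * cur varv xm f" for f g
    by (rule cur_commute) (rule varv_commute xm_xm)+
  have XP_XP: "cur varu xp f * cur varu xp g = cur varu xp g * cur varu xp f" for f g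
    by (rule cur_commute) (rule varu_commute xp_xp)+
  have H_H: "cur 1 h f * cur 1 h g = cur 1 h g * cur 1 h f" if "f $ 0 = 0" "g $ 0 = 0" for f g
    by (rule cur_commute, simp_all, rule h_h) (use that in \<open>auto intro!: gr0I\<close>)
  let ?M = "fexp (cur varv xm b)" and ?H = "fexp (cur 1 h \<eta>)" and ?P = "fexp (cur varu xp b)"
  have M: "cur varu xp 1 * ?M = ?M * (cur varu xp 1 + cur 1 h (fps_X * b) + cur varv xm (- (fps_X * b\<^sup>2)) + 0)"
  proof (rule fexp_conj3)
    show "cur 1 h (fps_X * b) * cur varv xm b
        = cur varv xm b * cur 1 h (fps_X * b) + 2 * cur varv xm (- (fps_X * b\<^sup>2))"
      by (simp add: H_XM cur_minus cur_numeral power2_eq_square mult.assoc)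
  qed (simp_all add: XP_XM XM_XM)
  have H: "cur varu xp 1 * ?H = ?H * cur varu xp (b + fps_XD b)"
    using fexp_conj_cur[of "cur 1 h \<eta>" "- (2 * \<eta>)" varu xp 1] XP_H[OF \<eta>0] \<eta>0
    by (simp add: exp)
  have dM: "inner_XD ?M = ?M * cur varv xm (- (fps_X * b\<^sup>2))"
    using inner_XD_fexp[of "cur varv xm b"] XM_XM[of b]
    by (simp add: inner_XD_cur_varv b fexp_commute)
  have dH: "inner_XD ?H = cur 1 h (fps_X * b) * ?H"
    using inner_XD_fexp[of "cur 1 h \<eta>"] by (simp add: inner_XD_cur_1 \<eta> \<eta>0 H_H)
  have dP: "inner_XD ?P = cur varu xp (b + fps_XD b) * ?P"
    using inner_XD_fexp[of "cur varu xp b"] by (simp add: inner_XD_cur_varu XP_XP)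
  show "inner_XD (?M * ?H * ?P) = cur varu xp 1 * (?M * ?H * ?P)"
  proof -
    have "cur varu xp 1 * (?M * ?H * ?P) = cur varu xp 1 * ?M * ?H * ?P"
      by (simp only: mult.assoc)
    also have "\<dots> = ?M * (cur varu xp 1 * ?H) * ?P + ?M * (cur 1 h (fps_X * b) * ?H) * ?P
        + ?M * cur varv xm (- (fps_X * b\<^sup>2)) * ?H * ?P"
      unfolding M by (simp only: distrib_left distrib_right mult.assoc add_0_right)
    \<comment> \<open>Each of the three terms is the derivative of one factor.\<close>
    also have "\<dots> = ?M * ?H * inner_XD ?P + ?M * inner_XD ?H * ?P + inner_XD ?M * ?H * ?P"
      by (simp only: H dM dH dP mult.assoc)
    also have "\<dots> = inner_XD (?M * ?H * ?P)"
      unfolding inner_XD_mult[of "?M * ?H" ?P] inner_XD_mult[of ?M ?H]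
      by (simp only: distrib_right add_ac)
    finally show ?thesis ..
  qed
  show "inner_XD (fexp (cur varu xp 1) * fexp (cur varv xm 1))
      = cur varu xp 1 * (fexp (cur varu xp 1) * fexp (cur varv xm 1))"
    using inner_XD_fexp[of "cur varu xp 1"] inner_XD_fexp[of "cur varv xm 1"]
    by (simp add: inner_XD_mult inner_XD_cur_varu inner_XD_cur_varv mult.assoc)
  show "inner_0 (fexp (cur varu xp 1) * fexp (cur varv xm 1)) = inner_0 (?M * ?H * ?P)"
    by (simp add: inner_0_mult inner_0_fexp inner_0_cur_1 \<eta>0 b0 inner_0_cur_varv)
qed simp

end

text \<open>The same for odd r + s, where x of opposite index parity bracket into X. Only the
  current xp travels, from the left end to the right, and this is why Xp and Xm enter the relations
  differently.\<close>

locale odd_currents =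
  fixes xp xm h Xp Xm :: "nat \<Rightarrow> 'a::rat_algebra"
  assumes xp_xm: "xp i * xm j = xm j * xp i + h (Suc (i + j))"
    and xp_h: "0 < j \<Longrightarrow> xp i * h j = h j * xp i - (if even j then 2 else 6) * xp (i + j)"
    and h_xm: "0 < i \<Longrightarrow> h i * xm j = xm j * h i - (if even i then 2 else 6) * xm (i + j)"
    and h_h: "0 < i \<Longrightarrow> 0 < j \<Longrightarrow> h i * h j = h j * h i"
    and xp_xp_even: "even (i + j) \<Longrightarrow> xp i * xp j = xp j * xp i"
    and xm_xm_even: "even (i + j) \<Longrightarrow> xm i * xm j = xm j * xm i"
    and xp_xp_odd: "even i \<Longrightarrow> odd j \<Longrightarrow> xp i * xp j = xp j * xp i - Xp (i + j)"
    and xm_xm_odd: "even i \<Longrightarrow> odd j \<Longrightarrow> xm i * xm j = xm j * xm i - Xm (i + j)"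
    and xp_Xp: "odd j \<Longrightarrow> xp i * Xp j = Xp j * xp i"
    and xm_Xm: "odd j \<Longrightarrow> xm i * Xm j = Xm j * xm i"
    and Xp_Xp: "odd i \<Longrightarrow> odd j \<Longrightarrow> Xp i * Xp j = Xp j * Xp i"
    and Xm_Xm: "odd i \<Longrightarrow> odd j \<Longrightarrow> Xm i * Xm j = Xm j * Xm i"
    and xp_Xm: "odd j \<Longrightarrow> xp i * Xm j = Xm j * xp i + (if even i then 4 else - 4) * xm (Suc (i + j))"
    and h_Xm: "0 < i \<Longrightarrow> odd j \<Longrightarrow> h i * Xm j = Xm j * h i - (if even i then 4 else 0) * Xm (i + j)"
begin

text \<open>Even and odd currents do not commute, so their exponentials are kept apart and a third
  factor absorbs their bracket in X. The equations result from comparing the h, x^-, X^-, x^+ and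
  X^+ parts once \<open>?XP 1\<close> has been carried across.\<close>

theorem straightening:
  fixes b0 b1 y yp \<eta>0 \<eta>1 :: "rat fps"
  assumes par: "parity True b0" "parity False b1" "parity False y" "parity False yp"
      "parity True \<eta>0" "parity False \<eta>1"
    and b00: "b0 $ 0 = 1" and \<eta>00: "\<eta>0 $ 0 = 0"
    and b0: "fps_XD b0 = 4 * (fps_X * y) - 6 * (fps_X * b0 * b1)"
    and b1: "fps_XD b1 = - (3 * (fps_X * b0\<^sup>2)) - fps_X * b1\<^sup>2"
    and y: "fps_XD y = fps_XD b0 * b1 - fps_X * b0 ^ 3 + 3 * (fps_X * b0 * b1\<^sup>2) - 4 * (fps_X * b1 * y)"
    and yp: "2 * yp + fps_XD yp = b0 * (b1 + fps_XD b1)"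
    and \<eta>: "fps_XD \<eta>0 = fps_X * b1" "fps_XD \<eta>1 = fps_X * b0"
    and exp: "fexp (- (2 * \<eta>0) - 6 * \<eta>1) = b0 + fps_XD b0 + (b1 + fps_XD b1)"
  shows "fexp (cur varu xp 1) * fexp (cur varv xm 1)
    = (fexp (cur varv xm b0) * fexp (cur varv xm b1) * fexp (cur (varv * varv) Xm y))
      * fexp (cur 1 h (\<eta>0 + \<eta>1))
      * (fexp (cur varu xp b0) * fexp (cur varu xp b1) * fexp (cur (varu * varu) Xp yp))"
proof (rule inner_XD_ode_unique[where Y = "cur varu xp 1"])
  have zero: "f $ 0 = 0" if "parity False f" for f
    using that by (auto simp: parity_def)
  note z = zero[OF par(2)] zero[OF par(3)] zero[OF par(4)] zero[OF par(6)] \<eta>00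
  let ?XP = "cur varu xp" and ?XM = "cur varv xm" and ?HH = "cur 1 h"
    and ?YM = "cur (varv * varv) Xm" and ?YP = "cur (varu * varu) Xp"
  have XP_XM: "?XP f * ?XM g = ?XM g * ?XP f + ?HH (fps_X * (f * g))" for f g
    using cur_bracket[OF varu_commute varv_commute, where p = xp and q = xm and A = 1
        and r = "\<lambda>j. h (Suc j)" and f = f and g = g]
    by (simp add: cur_shift xp_xm)
  have H_XM0: "?HH f * ?XM g = ?XM g * ?HH f + ?XM (- (2 * (f * g)))" if "f $ 0 = 0" "parity True f" for f g
    by (rule cur_bracket_h_left[OF varv_commute], subst h_xm)
      (use that in \<open>auto simp: parity_def intro!: gr0I\<close>)
  have H_XM1: "?HH f * ?XM g = ?XM g * ?HH f + ?XM (- (6 * (f * g)))" if "parity False f" for f g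
    by (rule cur_bracket_h_left[OF varv_commute], subst h_xm)
      (use that in \<open>auto simp: parity_def intro!: gr0I\<close>)
  have XP_H0: "?XP f * ?HH g = ?HH g * ?XP f + ?XP (- (2 * g) * f)" if "g $ 0 = 0" "parity True g" for f g
  proof -
    have "?XP f * ?HH g = ?HH g * ?XP f + ?XP (- (2 * (f * g)))"
      by (rule cur_bracket_h_right[OF varu_commute], subst xp_h)
        (use that in \<open>auto simp: parity_def intro!: gr0I\<close>)
    then show ?thesis by (simp add: mult.commute[of f] mult.assoc)
  qed
  have XP_H1: "?XP f * ?HH g = ?HH g * ?XP f + ?XP (- (6 * g) * f)" if "parity False g" for f g
  proof -
    have "?XP f * ?HH g = ?HH g * ?XP f + ?XP (- (6 * (f * g)))"
      by (rule cur_bracket_h_right[OF varu_commute], subst xp_h)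
        (use that in \<open>auto simp: parity_def intro!: gr0I\<close>)
    then show ?thesis by (simp add: mult.commute[of f] mult.assoc)
  qed
  have XM_same: "?XM f * ?XM g = ?XM g * ?XM f" if "parity d f" "parity d g" for f g d
    by (rule cur_commute[OF varv_commute varv_commute])
      (rule xm_xm_even, use that in \<open>auto simp: parity_def\<close>)
  have XP_same: "?XP f * ?XP g = ?XP g * ?XP f" if "parity d f" "parity d g" for f g d
    by (rule cur_commute[OF varu_commute varu_commute])
      (rule xp_xp_even, use that in \<open>auto simp: parity_def\<close>)
  have XM_01: "?XM f * ?XM g = ?XM g * ?XM f + ?YM (- (f * g))" if "parity True f" "parity False g" for f g
    by (rule cur_bracket_neg_1[OF varv_commute varv_commute], rule xm_xm_odd)
      (use that in \<open>auto simp: parity_def\<close>)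
  have XP_01: "?XP f * ?XP g = ?XP g * ?XP f + ?YP (- (f * g))" if "parity True f" "parity False g" for f g
    by (rule cur_bracket_neg_1[OF varu_commute varu_commute], rule xp_xp_odd)
      (use that in \<open>auto simp: parity_def\<close>)
  have XM_YM: "?XM f * ?YM g = ?YM g * ?XM f" if "parity False g" for f g
    by (rule cur_commute[OF varv_commute varv2_commute])
      (rule xm_Xm, use that in \<open>auto simp: parity_def\<close>)
  have XP_YP: "?XP f * ?YP g = ?YP g * ?XP f" if "parity False g" for f g
    by (rule cur_commute[OF varu_commute varu2_commute])
      (rule xp_Xp, use that in \<open>auto simp: parity_def\<close>)
  have YM_YM: "?YM f * ?YM g = ?YM g * ?YM f" if "parity False f" "parity False g" for f g
    by (rule cur_commute[OF varv2_commute varv2_commute])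
      (rule Xm_Xm, use that in \<open>auto simp: parity_def\<close>)
  have YP_YP: "?YP f * ?YP g = ?YP g * ?YP f" if "parity False f" "parity False g" for f g
    by (rule cur_commute[OF varu2_commute varu2_commute])
      (rule Xp_Xp, use that in \<open>auto simp: parity_def\<close>)
  have H_H: "?HH f * ?HH g = ?HH g * ?HH f" if "f $ 0 = 0" "g $ 0 = 0" for f g
    by (rule cur_commute, simp_all, rule h_h) (use that in \<open>auto intro!: gr0I\<close>)
  have XP_YM: "?XP f * ?YM g = ?YM g * ?XP f + ?XM (4 * (fps_X * (f * g)))"
    if "parity True f" "parity False g" for f g
  proof -
    have "?XP f * ?YM g = ?YM g * ?XP f + cur (varu * (varv * varv)) (\<lambda>j. xm (Suc j)) (qof 4 * (f * g))"
      by (rule cur_bracket[OF varu_commute varv2_commute]) (use xp_Xm that in \<open>auto simp: parity_def\<close>)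
    also have "varu * (varv * varv) = varv * (varu * (varv :: 'a fps fps))"
      using varv_commute[of "varu * varv :: 'a fps fps"] by (simp only: mult.assoc)
    also have "cur (varv * (varu * varv)) (\<lambda>j. xm (Suc j)) (qof 4 * (f * g))
        = varv * cur (varu * varv) (\<lambda>j. xm (Suc j)) (qof 4 * (f * g))"
      by (simp add: cur_def mult.assoc)
    also have "\<dots> = ?XM (4 * (fps_X * (f * g)))"
      by (simp add: cur_shift) (simp add: cur_def mult.left_commute)
    finally show ?thesis .
  qed
  have H_YM0: "?HH f * ?YM g = ?YM g * ?HH f + ?YM (- (4 * (f * g)))"
    if "f $ 0 = 0" "parity True f" "parity False g" for f g
    by (rule cur_bracket_h_left[OF varv2_commute], subst h_Xm)
      (use that in \<open>auto simp: parity_def intro!: gr0I\<close>)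
  have H_YM1: "?HH f * ?YM g = ?YM g * ?HH f" if "parity False f" "parity False g" for f g
    by (rule cur_commute[OF _ varv2_commute], simp, subst h_Xm)
      (use that in \<open>auto simp: parity_def intro!: gr0I\<close>)

  let ?M0 = "fexp (?XM b0)" and ?M1 = "fexp (?XM b1)" and ?MY = "fexp (?YM y)" and ?H = "fexp (?HH (\<eta>0 + \<eta>1))"
    and ?P0 = "fexp (?XP b0)" and ?P1 = "fexp (?XP b1)" and ?PY = "fexp (?YP yp)"
  let ?g0 = "b0 + fps_XD b0" and ?g1 = "b1 + fps_XD b1"
  have pX: "parity False (fps_X * f)" if "parity True f" for f
    using parity_mult[OF parity_X that] by simp
  have pX': "parity True (fps_X * f)" if "parity False f" for f
    using parity_mult[OF parity_X that] by simp
  have pm: "parity (d = e) (f * g)" if "parity d f" "parity e g" for d e f g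
    by (rule parity_mult[OF that])
  have p00: "parity True (b0 * b0)" and p01: "parity False (b0 * b1)" and p11: "parity True (b1 * b1)"
    using pm[OF par(1) par(1)] pm[OF par(1) par(2)] pm[OF par(2) par(2)] by simp_all
  \<comment> \<open>The full chain of commutators: x^+ gives h; h gives x^- with factor 6, as
    \<open>fps_X * b0\<close> is odd; odd and even x^- give X^-.\<close>
  have M0: "?XP 1 * ?M0 = ?M0 * (?XP 1 + ?HH (fps_X * b0) + ?XM (- (3 * (fps_X * (b0 * b0)))) + ?YM (- (fps_X * (b0 * (b0 * b0)))))"
  proof (rule fexp_conj3)
    show "?HH (fps_X * b0) * ?XM b0 = ?XM b0 * ?HH (fps_X * b0) + 2 * ?XM (- (3 * (fps_X * (b0 * b0))))"
      by (simp add: H_XM1 pX par cur_minus cur_numeral mult.assoc)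
    have "parity False (- (3 * (fps_X * (b0 * b0))))"
      using parity_minus[OF parity_qof[OF pX[OF p00], of 3]] by simp
    from XM_01[OF par(1) this] have "?XM (- (3 * (fps_X * (b0 * b0)))) * ?XM b0
        = ?XM b0 * ?XM (- (3 * (fps_X * (b0 * b0)))) + ?YM (b0 * - (3 * (fps_X * (b0 * b0))))"
      by (simp add: cur_minus)
    also have "b0 * - (3 * (fps_X * (b0 * b0))) = 3 * (- (fps_X * (b0 * (b0 * b0))))"
      by (simp add: mult_ac)
    finally show "?XM (- (3 * (fps_X * (b0 * b0)))) * ?XM b0 = ?XM b0 * ?XM (- (3 * (fps_X * (b0 * b0))))
        + 3 * ?YM (- (fps_X * (b0 * (b0 * b0))))"
      by (simp only: cur_numeral)
    show "?YM (- (fps_X * (b0 * (b0 * b0)))) * ?XM b0 = ?XM b0 * ?YM (- (fps_X * (b0 * (b0 * b0))))"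
      using XM_YM[OF pX[OF parity_mult[OF par(1) p00, simplified]]] by (simp add: cur_minus)
  qed (simp_all add: XP_XM)
  have M1: "?XP 1 * ?M1 = ?M1 * (?XP 1 + ?HH (fps_X * b1) + ?XM (- (fps_X * (b1 * b1))) + 0)"
  proof (rule fexp_conj3)
    show "?HH (fps_X * b1) * ?XM b1 = ?XM b1 * ?HH (fps_X * b1) + 2 * ?XM (- (fps_X * (b1 * b1)))"
      by (simp add: H_XM0 pX' par cur_minus cur_numeral mult.assoc)
    show "?XM (- (fps_X * (b1 * b1))) * ?XM b1 = ?XM b1 * ?XM (- (fps_X * (b1 * b1))) + 3 * 0"
      using XM_same[OF parity_minus[OF pX[OF p11]] par(2)] by simp
  qed (simp_all add: XP_XM)
  have M1h: "?HH (fps_X * b0) * ?M1 = ?M1 * (?HH (fps_X * b0) + ?XM (- (6 * (fps_X * (b0 * b1))))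
      + ?YM (3 * (fps_X * (b0 * (b1 * b1)))) + 0)"
  proof (rule fexp_conj3)
    show "?HH (fps_X * b0) * ?XM b1 = ?XM b1 * ?HH (fps_X * b0) + ?XM (- (6 * (fps_X * (b0 * b1))))"
      by (simp add: H_XM1 pX par mult.assoc)
    have "parity True (- (6 * (fps_X * (b0 * b1))))"
      using parity_minus[OF parity_qof[OF pX'[OF p01], of 6]] by simp
    from XM_01[OF this par(2)] have "?XM (- (6 * (fps_X * (b0 * b1)))) * ?XM b1
        = ?XM b1 * ?XM (- (6 * (fps_X * (b0 * b1)))) + ?YM (- (- (6 * (fps_X * (b0 * b1))) * b1))" .
    also have "- (- (6 * (fps_X * (b0 * b1))) * b1) = 2 * (3 * (fps_X * (b0 * (b1 * b1))))"
      by (simp add: mult_ac)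
    finally show "?XM (- (6 * (fps_X * (b0 * b1)))) * ?XM b1 = ?XM b1 * ?XM (- (6 * (fps_X * (b0 * b1))))
        + 2 * ?YM (3 * (fps_X * (b0 * (b1 * b1))))"
      by (simp only: cur_numeral)
    show "?YM (3 * (fps_X * (b0 * (b1 * b1)))) * ?XM b1 = ?XM b1 * ?YM (3 * (fps_X * (b0 * (b1 * b1)))) + 3 * 0"
      using XM_YM[OF parity_qof[OF pX[OF parity_mult[OF par(1) p11, simplified]], of 3]] by simp
  qed simp_all
  have M1x: "?XM (- (3 * (fps_X * (b0 * b0)))) * ?M1 = ?M1 * ?XM (- (3 * (fps_X * (b0 * b0))))"
    using fexp_commute[of "?XM b1"] XM_same[OF parity_qof[OF pX[OF p00], of "- 3"] par(2)] z
    by (simp add: qof_minus)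
  have M1y: "?YM f * ?M1 = ?M1 * ?YM f" if "parity False f" for f
    using fexp_commute[of "?XM b1" "?YM f"] XM_YM[OF that] by simp
  show "inner_XD (fexp (?XP 1) * fexp (?XM 1)) = ?XP 1 * (fexp (?XP 1) * fexp (?XM 1))"
    using inner_XD_fexp[of "?XP 1"] inner_XD_fexp[of "?XM 1"]
    by (simp add: inner_XD_mult inner_XD_cur_varu inner_XD_cur_varv mult.assoc)
  have MYx: "?XP 1 * ?MY = ?MY * (?XP 1 + ?XM (4 * (fps_X * y)) + 0 + 0)"
    by (rule fexp_conj3) (use XP_YM[OF parity_1 par(3)] in \<open>simp_all add: XM_YM par\<close>)
  have MYh1: "?HH (fps_X * b1) * ?MY = ?MY * (?HH (fps_X * b1) + ?YM (- (4 * (fps_X * b1 * y))) + 0 + 0)"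
  proof (rule fexp_conj3)
    have "parity False (- (4 * (fps_X * b1 * y)))"
      using parity_minus[OF parity_qof[OF pm[OF pX'[OF par(2)] par(3)], of 4]] by simp
    then show "?YM (- (4 * (fps_X * b1 * y))) * ?YM y = ?YM y * ?YM (- (4 * (fps_X * b1 * y))) + 2 * 0"
      using YM_YM[OF _ par(3)] by simp
  qed (simp_all add: H_YM0 pX' par)
  have MYh0: "?HH (fps_X * b0) * ?MY = ?MY * ?HH (fps_X * b0)"
    using fexp_commute[of "?YM y" "?HH (fps_X * b0)"] H_YM1[OF pX[OF par(1)] par(3)] by simp
  have MYxm: "?XM f * ?MY = ?MY * ?XM f" for f
    using fexp_commute[of "?YM y" "?XM f"] XM_YM[OF par(3)] by simp
  have MYy: "?YM f * ?MY = ?MY * ?YM f" if "parity False f" for f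
    using fexp_commute[of "?YM y" "?YM f"] YM_YM[OF that par(3)] by simp

  have odd1: "parity False (- (fps_X * (b0 * (b0 * b0))))"
    using parity_minus[OF pX[OF pm[OF par(1) p00, simplified]]] .
  have odd2: "parity False (3 * (fps_X * (b0 * (b1 * b1))))"
    using parity_qof[OF pX[OF pm[OF par(1) p11, simplified]], of 3] by simp
  \<comment> \<open>What the current \<open>?XP 1\<close> becomes after crossing the first two
    factors (\<open>?A2\<close>) and all three (\<open>?A3\<close>).\<close>
  let ?A2 = "?XP 1 + ?HH (fps_X * b1) + ?XM (- (fps_X * (b1 * b1))) + (?HH (fps_X * b0)
    + ?XM (- (6 * (fps_X * (b0 * b1)))) + ?YM (3 * (fps_X * (b0 * (b1 * b1))))) + ?XM (- (3 * (fps_X * (b0 * b0))))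
    + ?YM (- (fps_X * (b0 * (b0 * b0))))"
  let ?A3 = "?XP 1 + ?XM (4 * (fps_X * y)) + (?HH (fps_X * b1) + ?YM (- (4 * (fps_X * b1 * y))))
    + ?XM (- (fps_X * (b1 * b1))) + (?HH (fps_X * b0)
    + ?XM (- (6 * (fps_X * (b0 * b1)))) + ?YM (3 * (fps_X * (b0 * (b1 * b1))))) + ?XM (- (3 * (fps_X * (b0 * b0))))
    + ?YM (- (fps_X * (b0 * (b0 * b0))))"
  have A2: "(?XP 1 + ?HH (fps_X * b0) + ?XM (- (3 * (fps_X * (b0 * b0)))) + ?YM (- (fps_X * (b0 * (b0 * b0))))) * ?M1
      = ?M1 * ?A2"
    by (simp only: distrib_right distrib_left M1 M1h M1x M1y[OF odd1] add_0_right mult_zero_right)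
  have A3: "?A2 * ?MY = ?MY * ?A3"
    by (simp only: distrib_right distrib_left MYx MYh0 MYh1 MYxm MYy[OF odd1] MYy[OF odd2] add_0_right mult_zero_right)
  let ?N = "?M0 * ?M1 * ?MY"
  \<comment> \<open>The logarithmic derivative of \<open>?N\<close>, written on its right. The last
    term arises when \<open>?XM (fps_XD b0)\<close> is moved past \<open>?M1\<close>.\<close>
  let ?C = "?XM (fps_XD b0) + ?XM (fps_XD b1) + ?YM (fps_XD y) + ?YM (- (fps_XD b0 * b1))"
  have "?A3 = ?XP 1 + (?HH (fps_X * b0) + ?HH (fps_X * b1))
      + (?XM (4 * (fps_X * y)) + ?XM (- (fps_X * (b1 * b1))) + ?XM (- (6 * (fps_X * (b0 * b1)))) + ?XM (- (3 * (fps_X * (b0 * b0)))))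
      + (?YM (- (4 * (fps_X * b1 * y))) + ?YM (3 * (fps_X * (b0 * (b1 * b1)))) + ?YM (- (fps_X * (b0 * (b0 * b0)))))"
    by (simp only: add_ac)
  \<comment> \<open>Here the equations for b0, b1 and then y enter: the x^- and X^- terms collapse
    to those of \<open>?C\<close>.\<close>
  also have "?XM (4 * (fps_X * y)) + ?XM (- (fps_X * (b1 * b1))) + ?XM (- (6 * (fps_X * (b0 * b1)))) + ?XM (- (3 * (fps_X * (b0 * b0))))
      = ?XM (fps_XD b0) + ?XM (fps_XD b1)"
    by (simp only: b0 b1 flip: cur_add) (rule arg_cong[of _ _ ?XM], simp add: power2_eq_square algebra_simps)
  also have "?YM (- (4 * (fps_X * b1 * y))) + ?YM (3 * (fps_X * (b0 * (b1 * b1)))) + ?YM (- (fps_X * (b0 * (b0 * b0))))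
      = ?YM (fps_XD y) + ?YM (- (fps_XD b0 * b1))"
    by (simp only: y flip: cur_add) (rule arg_cong[of _ _ ?YM], simp add: power2_eq_square power3_eq_cube algebra_simps)
  finally have A3': "?A3 = ?XP 1 + (?HH (fps_X * b0) + ?HH (fps_X * b1)) + ?C"
    by (simp only: add_ac)
  have N: "?XP 1 * ?N = ?N * (?XP 1 + (?HH (fps_X * b0) + ?HH (fps_X * b1)) + ?C)"
    using conj_trans[OF conj_trans[OF M0 A2] A3] unfolding A3' .

  have dM0: "inner_XD ?M0 = ?M0 * ?XM (fps_XD b0)"
    using inner_XD_fexp[of "?XM b0"] XM_same[OF parity_XD[OF par(1)] par(1)] fexp_commute[of "?XM b0" "?XM (fps_XD b0)"]
    by (simp add: inner_XD_cur_varv)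
  have dM1: "inner_XD ?M1 = ?M1 * ?XM (fps_XD b1)"
    using inner_XD_fexp[of "?XM b1"] XM_same[OF parity_XD[OF par(2)] par(2)] fexp_commute[of "?XM b1" "?XM (fps_XD b1)"]
    by (simp add: inner_XD_cur_varv)
  have dMY: "inner_XD ?MY = ?MY * ?YM (fps_XD y)"
    using inner_XD_fexp[of "?YM y"] YM_YM[OF parity_XD[OF par(3)] par(3)] fexp_commute[of "?YM y" "?YM (fps_XD y)"]
    by (simp add: inner_XD_cur_varv2)
  have "?XM (fps_XD b0) * ?M1 = ?M1 * (?XM (fps_XD b0) + ?YM (- (fps_XD b0 * b1)) + 0 + 0)"
    by (rule fexp_conj3) (use XM_01[OF parity_XD[OF par(1)] par(2)]
      XM_YM[OF pm[OF parity_XD[OF par(1)] par(2), simplified]] in \<open>simp_all add: cur_minus\<close>)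
  then have d01: "inner_XD (?M0 * ?M1) = ?M0 * ?M1 * (?XM (fps_XD b0) + ?XM (fps_XD b1) + ?YM (- (fps_XD b0 * b1)))"
    by (simp add: inner_XD_mult dM0 dM1 mult.assoc distrib_left add_ac)
  have swap: "(?XM (fps_XD b0) + ?XM (fps_XD b1) + ?YM (- (fps_XD b0 * b1))) * ?MY
      = ?MY * (?XM (fps_XD b0) + ?XM (fps_XD b1) + ?YM (- (fps_XD b0 * b1)))"
    using MYy[OF parity_minus[OF pm[OF parity_XD[OF par(1)] par(2), simplified]]]
    by (simp add: distrib_left distrib_right MYxm)
  have dN: "inner_XD ?N = ?N * ?C"
    unfolding inner_XD_mult[of "?M0 * ?M1"] d01 dMY
    by (simp only: mult.assoc swap) (simp only: distrib_left add_ac)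

  have dP0: "inner_XD ?P0 = ?XP ?g0 * ?P0"
    using inner_XD_fexp[of "?XP b0"] XP_same[OF parity_add[OF par(1) parity_XD[OF par(1)]] par(1)]
    by (simp add: inner_XD_cur_varu)
  have dP1: "inner_XD ?P1 = ?XP ?g1 * ?P1"
    using inner_XD_fexp[of "?XP b1"] XP_same[OF parity_add[OF par(2) parity_XD[OF par(2)]] par(2)]
    by (simp add: inner_XD_cur_varu)
  have g1: "parity False ?g1" using par(2) by (simp add: parity_add parity_XD)
  have b0g1: "parity False (b0 * ?g1)" using pm[OF par(1) g1] by simp
  have dPY: "inner_XD ?PY = ?YP (b0 * ?g1) * ?PY"
    using inner_XD_fexp[of "?YP yp"] YP_YP[OF b0g1 par(4)]
    by (simp add: inner_XD_cur_varu2 yp)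
  \<comment> \<open>In the derivative of the right factor, \<open>?XP ?g1\<close> stands behind
    \<open>?P0\<close>. Bringing it to the front costs \<open>?YP (b0 * ?g1)\<close>, which the
    derivative of \<open>?PY\<close> supplies by the equation for yp.\<close>
  have P0: "?XP ?g1 * ?P0 = ?P0 * (?XP ?g1 + ?YP (b0 * ?g1) + 0 + 0)"
  proof (rule fexp_conj3)
    show "?XP ?g1 * ?XP b0 = ?XP b0 * ?XP ?g1 + ?YP (b0 * ?g1)"
      using XP_01[OF par(1) g1] by (simp add: cur_minus)
  qed (use XP_YP[OF b0g1] in simp_all)
  have P1: "?YP (b0 * ?g1) * ?P1 = ?P1 * ?YP (b0 * ?g1)"
    using fexp_commute[of "?XP b1" "?YP (b0 * ?g1)"] XP_YP[OF b0g1] by simp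
  have P1': "?YP (b0 * ?g1) * (?P1 * ?PY) = ?P1 * (?YP (b0 * ?g1) * ?PY)"
    by (simp only: P1 flip: mult.assoc)
  have "?P0 * (?XP ?g1 * (?P1 * ?PY)) + ?P0 * (?P1 * (?YP (b0 * ?g1) * ?PY))
      = ?P0 * (?XP ?g1 + ?YP (b0 * ?g1)) * (?P1 * ?PY)"
    unfolding distrib_left[of ?P0] distrib_right[of "?P0 * ?XP ?g1"] mult.assoc[of ?P0] P1' ..
  also have "\<dots> = ?XP ?g1 * (?P0 * (?P1 * ?PY))"
    by (simp only: P0[unfolded add_0_right, symmetric] mult.assoc[symmetric])
  finally have "inner_XD (?P0 * ?P1 * ?PY) = ?XP ?g0 * (?P0 * ?P1 * ?PY) + ?XP ?g1 * (?P0 * ?P1 * ?PY)"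
    by (simp add: inner_XD_mult dP0 dP1 dPY distrib_left distrib_right mult.assoc add.assoc)
  then have dP: "inner_XD (?P0 * ?P1 * ?PY) = ?XP (?g0 + ?g1) * (?P0 * ?P1 * ?PY)"
    by (simp only: cur_add distrib_right)
  have dH: "inner_XD ?H = (?HH (fps_X * b0) + ?HH (fps_X * b1)) * ?H"
    using inner_XD_fexp[of "?HH (\<eta>0 + \<eta>1)"] H_H[of "fps_X * b0 + fps_X * b1" "\<eta>0 + \<eta>1"] z
    by (simp add: inner_XD_cur_1 XD_add \<eta> add.commute flip: cur_add)
  have H: "?XP 1 * ?H = ?H * ?XP (?g0 + ?g1)"
  proof -
    have "?XP f * ?HH (\<eta>0 + \<eta>1) = ?HH (\<eta>0 + \<eta>1) * ?XP f + ?XP ((- (2 * \<eta>0) - 6 * \<eta>1) * f)" for f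
    proof -
      have "(- (2 * \<eta>0) - 6 * \<eta>1) * f = - (2 * \<eta>0) * f + - (6 * \<eta>1) * f"
        by (simp only: distrib_right diff_conv_add_uminus)
      then show ?thesis
        by (simp only: cur_add distrib_left distrib_right XP_H0[OF \<eta>00 par(5)] XP_H1[OF par(6)] add_ac)
    qed
    then show ?thesis
      using fexp_conj_cur[of "?HH (\<eta>0 + \<eta>1)" "- (2 * \<eta>0) - 6 * \<eta>1" varu xp 1] z exp by simp
  qed
  let ?Q = "?P0 * ?P1 * ?PY"
  show "inner_XD (?N * ?H * ?Q) = ?XP 1 * (?N * ?H * ?Q)"
  proof -
    have "?XP 1 * (?N * ?H * ?Q) = ?XP 1 * ?N * ?H * ?Q"
      by (simp only: mult.assoc)
    also have "\<dots> = ?N * (?XP 1 * ?H) * ?Q + ?N * ((?HH (fps_X * b0) + ?HH (fps_X * b1)) * ?H) * ?Q + ?N * ?C * ?H * ?Q"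
      unfolding N by (simp only: distrib_left distrib_right mult.assoc)
    also have "\<dots> = ?N * ?H * inner_XD ?Q + ?N * inner_XD ?H * ?Q + inner_XD ?N * ?H * ?Q"
      unfolding H dN dH dP by (simp only: mult.assoc)
    also have "\<dots> = inner_XD (?N * ?H * ?Q)"
      unfolding inner_XD_mult[of "?N * ?H" ?Q] inner_XD_mult[of ?N ?H]
      by (simp only: distrib_right add_ac)
    finally show ?thesis ..
  qed
  show "inner_0 (fexp (?XP 1) * fexp (?XM 1)) = inner_0 (?M0 * ?M1 * ?MY * ?H * (?P0 * ?P1 * ?PY))"
    by (simp add: inner_0_mult inner_0_fexp inner_0_cur_1 z b00 inner_0_cur_varv inner_0_cur_varv2)
qed simp

end

subsection \<open>The scalar series\<close>

definition is_subring :: "'a::ring_1 set \<Rightarrow> bool"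
  where "is_subring R \<longleftrightarrow> 1 \<in> R \<and> (\<forall>a\<in>R. \<forall>b\<in>R. a - b \<in> R \<and> a * b \<in> R)"

lemma is_subringD:
  assumes "is_subring R"
  shows "1 \<in> R" "0 \<in> R" "a \<in> R \<Longrightarrow> b \<in> R \<Longrightarrow> a - b \<in> R" "a \<in> R \<Longrightarrow> - a \<in> R"
    "a \<in> R \<Longrightarrow> b \<in> R \<Longrightarrow> a + b \<in> R" "a \<in> R \<Longrightarrow> b \<in> R \<Longrightarrow> a * b \<in> R"
proof -
  show 1: "1 \<in> R" and diff: "a \<in> R \<Longrightarrow> b \<in> R \<Longrightarrow> a - b \<in> R" for a b
    using assms by (auto simp: is_subring_def)
  show "a \<in> R \<Longrightarrow> b \<in> R \<Longrightarrow> a * b \<in> R"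
    using assms by (auto simp: is_subring_def)
  show 0: "0 \<in> R" using diff[OF 1 1] by simp
  show minus: "a \<in> R \<Longrightarrow> - a \<in> R" for a using diff[OF 0, of a] by simp
  show "a \<in> R \<Longrightarrow> b \<in> R \<Longrightarrow> a + b \<in> R" using diff[of a "- b"] minus[of b] by simp
qed

lemma is_subring_sum:
  "is_subring R \<Longrightarrow> (\<And>x. x \<in> A \<Longrightarrow> f x \<in> R) \<Longrightarrow> sum f A \<in> R"
  by (induction A rule: infinite_finite_induct) (auto intro: is_subringD)

lemma is_subring_power: "is_subring R \<Longrightarrow> a \<in> R \<Longrightarrow> a ^ n \<in> R"
  by (induction n) (auto intro: is_subringD)

lemma is_subring_of_nat: "is_subring R \<Longrightarrow> of_nat n \<in> R"
  by (induction n) (auto intro: is_subringD)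

lemma is_subring_of_int: "is_subring R \<Longrightarrow> of_int n \<in> R"
  by (cases n rule: int_diff_cases) (auto intro: is_subringD is_subring_of_nat)

lemma is_subring_Ints: "is_subring (\<int> :: rat set)"
  by (simp add: is_subring_def)

definition coeffs_in :: "'a::zero set \<Rightarrow> 'a fps \<Rightarrow> bool"
  where "coeffs_in R f \<longleftrightarrow> (\<forall>n. f $ n \<in> R)"

lemma is_subring_coeffs_in:
  assumes R: "is_subring R" shows "is_subring {f. coeffs_in R f}"
  using is_subringD[OF R] unfolding is_subring_def
  by (auto simp: coeffs_in_def fps_mult_nth intro!: is_subring_sum[OF R])

lemmas coeffs_in_closed = is_subringD[OF is_subring_coeffs_in, simplified]

lemma coeffs_in_X: "is_subring R \<Longrightarrow> coeffs_in R fps_X"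
  by (auto simp: coeffs_in_def fps_X_def intro: is_subringD)

text \<open>The coefficients of the inverse are computed recursively, dividing by 1 only. Used for
  rational series and for series over \<open>uea\<close> alike.\<close>

lemma coeffs_in_inverse:
  fixes f g :: "'a::ring_1 fps"
  assumes R: "is_subring R" and f: "coeffs_in R f" "f $ 0 = 1" and fg: "f * g = 1"
  shows "coeffs_in R g"
  unfolding coeffs_in_def
proof
  fix n
  show "g $ n \<in> R"
  proof (induction n rule: less_induct)
    case (less n)
    have "(f * g) $ n = g $ n + (\<Sum>i=1..n. f $ i * g $ (n - i))"
      by (simp add: fps_mult_nth sum.atLeast_Suc_atMost f)
    then have "g $ n = (1 :: 'a fps) $ n - (\<Sum>i=1..n. f $ i * g $ (n - i))"
      by (simp add: fg)
    also have "\<dots> \<in> R"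
      using less f(1)
      by (intro is_subringD(3)[OF R] is_subring_sum[OF R] is_subringD(6)[OF R])
        (auto simp: coeffs_in_def is_subringD[OF R])
    finally show ?case .
  qed
qed

abbreviation int_series :: "rat fps \<Rightarrow> bool"
  where "int_series \<equiv> coeffs_in \<int>"

lemmas int_series_closed = coeffs_in_closed[OF is_subring_Ints] coeffs_in_X[OF is_subring_Ints]

lemma int_series_numeral: "int_series (numeral k)"
  using is_subring_of_nat[OF is_subring_coeffs_in[OF is_subring_Ints], of "numeral k"] by simp

lemma int_series_power: "int_series f \<Longrightarrow> int_series (f ^ n)"
  using is_subring_power[OF is_subring_coeffs_in[OF is_subring_Ints], of f n] by simp

lemma int_series_inverse:
  assumes "int_series f" "f $ 0 = 1"
  shows "int_series (inverse f)"
  by (rule coeffs_in_inverse[OF is_subring_Ints assms]) (simp add: assms inverse_mult_eq_1')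

lemma XD_X [simp]: "fps_XD fps_X = (fps_X :: rat fps)"
  by (simp add: fps_XD_def)

lemma XD_X_power [simp]: "fps_XD (fps_X ^ n) = of_nat n * (fps_X ^ n :: rat fps)"
proof (rule fps_ext)
  fix k
  show "fps_XD (fps_X ^ n) $ k = (of_nat n * (fps_X ^ n :: rat fps)) $ k"
    using qof_mult_nth[of "of_nat n" "fps_X ^ n :: rat fps" k] by simp
qed

lemma XD_numeral_mult [simp]: "fps_XD (numeral k * f) = numeral k * (fps_XD f :: rat fps)"
  using XD_qof_mult[of "numeral k" f] by simp

lemma XD_minus: "fps_XD (- f) = - (fps_XD f :: rat fps)"
  by (rule fps_ext) simp

lemma XD_diff: "fps_XD (f - g) = fps_XD f - (fps_XD g :: rat fps)"
  by (rule fps_ext) (simp add: algebra_simps)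

lemma XD_numeral [simp]: "fps_XD (numeral k) = (0 :: rat fps)"
  using XD_numeral_mult[of k 1] by simp

lemmas XD_poly = XD_add XD_diff XD_minus

definition XD_integral :: "rat fps \<Rightarrow> rat fps"
  where "XD_integral f = Abs_fps (\<lambda>n. f $ n / of_nat n)"

lemma XD_integral_nth [simp]: "XD_integral f $ n = f $ n / of_nat n"
  by (simp add: XD_integral_def)

lemma XD_XD_integral: "f $ 0 = 0 \<Longrightarrow> fps_XD (XD_integral f) = f"
  by (rule fps_ext) auto

lemma XD_fexp: "\<phi> $ 0 = 0 \<Longrightarrow> fps_XD (fexp \<phi>) = fps_XD \<phi> * (fexp \<phi> :: rat fps)"
  by (rule coeff_derivation_fexp[OF coeff_derivation_XD]) (simp_all add: mult.commute)

lemma fexp_eqI: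
  fixes \<phi> g :: "rat fps"
  assumes "\<phi> $ 0 = 0" "g $ 0 = 1" "fps_XD g = fps_XD \<phi> * g"
  shows "fexp \<phi> = g"
  by (rule XD_ode_unique[OF XD_fexp[OF assms(1)] assms(3)]) (simp_all add: assms)

definition b_even :: "rat fps" where "b_even = inverse (1 + fps_X)"

lemma b_even: "b_even * (1 + fps_X) = 1"
  by (simp add: b_even_def inverse_mult_eq_1)

lemma b_even_nth_0 [simp]: "b_even $ 0 = 1"
  by (simp add: b_even_def)

lemma int_series_b_even: "int_series b_even"
  unfolding b_even_def by (rule int_series_inverse) (simp_all add: int_series_closed)

lemma fps_cancel:
  fixes f g d :: "rat fps"
  assumes "d $ 0 = 1" "f * d = g * d"
  shows "f = g"
proof -
  have "d \<noteq> 0" using assms(1) by auto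
  then show ?thesis using assms(2) by simp
qed

lemma XD_b_even: "fps_XD b_even = - (fps_X * b_even\<^sup>2)"
proof (rule fps_cancel)
  show "((1 + fps_X)\<^sup>2 :: rat fps) $ 0 = 1" by (simp add: power2_eq_square)
  have "fps_XD b_even * (1 + fps_X) + b_even * fps_X = 0"
    using arg_cong[OF b_even, of fps_XD] by (simp add: XD_mult XD_add)
  then have 1: "fps_XD b_even * (1 + fps_X) = - (b_even * fps_X)"
    by (simp only: add_eq_0_iff2)
  have "fps_XD b_even * (1 + fps_X)\<^sup>2 = - (fps_X * (b_even * (1 + fps_X)))"
    by (simp only: power2_eq_square 1 flip: mult.assoc) (simp add: algebra_simps)
  also have "\<dots> = - (fps_X * b_even\<^sup>2) * (1 + fps_X)\<^sup>2"
    using b_even by (simp add: power2_eq_square) (metis (no_types, lifting) mult.assoc mult.commute mult_1_right)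
  finally show "fps_XD b_even * (1 + fps_X)\<^sup>2 = - (fps_X * b_even\<^sup>2) * (1 + fps_X)\<^sup>2" .
qed

text \<open>This is log (1 + u).\<close>

definition eta_even :: "rat fps" where "eta_even = XD_integral (fps_X * b_even)"

lemma XD_eta_even: "fps_XD eta_even = fps_X * b_even"
  by (simp add: eta_even_def XD_XD_integral)

lemma eta_even_nth_0 [simp]: "eta_even $ 0 = 0"
  by (simp add: eta_even_def)

lemma fexp_minus_2_eta_even: "fexp (- (2 * eta_even)) = b_even + fps_XD b_even"
proof -
  have 1: "b_even + fps_XD b_even = b_even\<^sup>2"
    using b_even unfolding XD_b_even by (simp add: power2_eq_square algebra_simps)
      (metis add_diff_cancel_right' distrib_left mult.assoc mult.commute mult_1_right)
  show ?thesis
    unfolding 1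
  proof (rule fexp_eqI)
    show "fps_XD (b_even\<^sup>2) = fps_XD (- (2 * eta_even)) * b_even\<^sup>2"
      by (simp add: power2_eq_square XD_mult XD_b_even XD_minus XD_eta_even algebra_simps)
  qed (simp_all add: power2_eq_square)
qed

text \<open>The sum \<open>b_odd0 + b_odd1\<close> is (1 - u)/(1 + 2u - u^2), and \<open>Dl\<close>
  = (1 + 2u - u^2)(1 - 2u - u^2) is the even denominator that separates its parts.
  \<open>y_minus\<close> is then forced by the equation for \<open>b_odd0\<close>, and
  \<open>y_plus\<close> by \<open>XD_y_plus\<close>.\<close>

definition Dl :: "rat fps" where "Dl = 1 - 6 * fps_X\<^sup>2 + fps_X ^ 4"
definition b_odd0 :: "rat fps" where "b_odd0 = (1 + fps_X\<^sup>2) * inverse Dl"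
definition b_odd1 :: "rat fps" where "b_odd1 = (fps_X ^ 3 - 3 * fps_X) * inverse Dl"
definition y_minus :: "rat fps" where "y_minus = (- fps_X - 4 * fps_X ^ 3 + fps_X ^ 5) * (inverse Dl)\<^sup>2"
definition y_plus :: "rat fps" where "y_plus = (- 2 * fps_X * (1 - fps_X\<^sup>2)) * (inverse Dl)\<^sup>2"

lemma Dl_nth_0 [simp]: "Dl $ 0 = 1"
  by (simp add: Dl_def)

lemma inverse_Dl: "inverse Dl * Dl = 1"
  by (simp add: inverse_mult_eq_1)

text \<open>Multiplied by a power of \<open>Dl\<close>, the differential equations below become
  identities between polynomials.\<close>

lemma odd_series_mult_Dl:
  "b_odd0 * Dl = 1 + fps_X\<^sup>2" "b_odd1 * Dl = fps_X ^ 3 - 3 * fps_X"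
  "y_minus * Dl\<^sup>2 = - fps_X - 4 * fps_X ^ 3 + fps_X ^ 5"
  "y_plus * Dl\<^sup>2 = - 2 * fps_X * (1 - fps_X\<^sup>2)"
  unfolding b_odd0_def b_odd1_def y_minus_def y_plus_def
  by (simp_all add: mult.assoc inverse_Dl flip: power_mult_distrib)

lemma XD_Dl: "fps_XD Dl = 4 * fps_X ^ 4 - 12 * fps_X\<^sup>2"
  by (simp add: Dl_def XD_poly)

lemma XD_quotient1: "f * Dl = p \<Longrightarrow> fps_XD f * Dl\<^sup>2 = fps_XD p * Dl - p * fps_XD Dl"
  by (auto simp: XD_mult power2_eq_square algebra_simps)

lemma XD_quotient2: "f * Dl\<^sup>2 = p \<Longrightarrow> fps_XD f * Dl ^ 3 = fps_XD p * Dl - 2 * p * fps_XD Dl"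
  by (auto simp: XD_mult power2_eq_square power3_eq_cube algebra_simps)

lemma XD_b_odd0_mult: "fps_XD b_odd0 * Dl\<^sup>2 = 14 * fps_X\<^sup>2 - 4 * fps_X ^ 4 - 2 * fps_X ^ 6"
  unfolding XD_quotient1[OF odd_series_mult_Dl(1)] XD_Dl
  by (simp add: Dl_def XD_poly XD_mult algebra_simps eval_nat_numeral)

lemma XD_b_odd1_mult: "fps_XD b_odd1 * Dl\<^sup>2 = - 3 * fps_X - 15 * fps_X ^ 3 + 3 * fps_X ^ 5 - fps_X ^ 7"
  unfolding XD_quotient1[OF odd_series_mult_Dl(2)] XD_Dl
  by (simp add: Dl_def XD_poly XD_mult algebra_simps eval_nat_numeral)

lemma XD_b_odd0: "fps_XD b_odd0 = 4 * (fps_X * y_minus) - 6 * (fps_X * b_odd0 * b_odd1)"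
proof (rule fps_cancel)
  show "Dl\<^sup>2 $ 0 = 1" by (simp add: power2_eq_square)
  have "(4 * (fps_X * y_minus) - 6 * (fps_X * b_odd0 * b_odd1)) * Dl\<^sup>2
      = 4 * (fps_X * (y_minus * Dl\<^sup>2)) - 6 * (fps_X * (b_odd0 * Dl) * (b_odd1 * Dl))"
    by (simp add: algebra_simps power2_eq_square)
  also have "\<dots> = fps_XD b_odd0 * Dl\<^sup>2"
    unfolding odd_series_mult_Dl XD_b_odd0_mult by (simp add: algebra_simps eval_nat_numeral)
  finally show "fps_XD b_odd0 * Dl\<^sup>2 = (4 * (fps_X * y_minus) - 6 * (fps_X * b_odd0 * b_odd1)) * Dl\<^sup>2" ..
qed

lemma XD_b_odd1: "fps_XD b_odd1 = - (3 * (fps_X * b_odd0\<^sup>2)) - fps_X * b_odd1\<^sup>2"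
proof (rule fps_cancel)
  show "Dl\<^sup>2 $ 0 = 1" by (simp add: power2_eq_square)
  have "(- (3 * (fps_X * b_odd0\<^sup>2)) - fps_X * b_odd1\<^sup>2) * Dl\<^sup>2
      = - (3 * (fps_X * (b_odd0 * Dl)\<^sup>2)) - fps_X * (b_odd1 * Dl)\<^sup>2"
    by (simp add: algebra_simps power2_eq_square)
  also have "\<dots> = fps_XD b_odd1 * Dl\<^sup>2"
    unfolding odd_series_mult_Dl XD_b_odd1_mult by (simp add: algebra_simps eval_nat_numeral)
  finally show "fps_XD b_odd1 * Dl\<^sup>2 = (- (3 * (fps_X * b_odd0\<^sup>2)) - fps_X * b_odd1\<^sup>2) * Dl\<^sup>2" ..
qed

lemma XD_y_minus: "fps_XD y_minus = fps_XD b_odd0 * b_odd1 - fps_X * b_odd0 ^ 3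
    + 3 * (fps_X * b_odd0 * b_odd1\<^sup>2) - 4 * (fps_X * b_odd1 * y_minus)"
  (is "_ = ?rhs")
proof (rule fps_cancel)
  show "(Dl ^ 3) $ 0 = 1" by (simp add: power3_eq_cube)
  have "?rhs * Dl ^ 3 = (fps_XD b_odd0 * Dl\<^sup>2) * (b_odd1 * Dl) - fps_X * (b_odd0 * Dl) ^ 3
      + 3 * (fps_X * (b_odd0 * Dl) * (b_odd1 * Dl)\<^sup>2) - 4 * (fps_X * (b_odd1 * Dl) * (y_minus * Dl\<^sup>2))"
    by (simp add: algebra_simps power2_eq_square power3_eq_cube)
  also have "\<dots> = fps_XD (- fps_X - 4 * fps_X ^ 3 + fps_X ^ 5) * Dl
      - 2 * (- fps_X - 4 * fps_X ^ 3 + fps_X ^ 5) * fps_XD Dl"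
    unfolding odd_series_mult_Dl XD_b_odd0_mult XD_Dl
    by (simp add: Dl_def XD_poly XD_mult algebra_simps eval_nat_numeral)
  also have "\<dots> = fps_XD y_minus * Dl ^ 3"
    by (rule XD_quotient2[OF odd_series_mult_Dl(3), symmetric])
  finally show "fps_XD y_minus * Dl ^ 3 = ?rhs * Dl ^ 3" ..
qed

lemma XD_y_plus: "2 * y_plus + fps_XD y_plus = b_odd0 * (b_odd1 + fps_XD b_odd1)"
proof (rule fps_cancel)
  show "(Dl ^ 3) $ 0 = 1" by (simp add: power3_eq_cube)
  have "(b_odd0 * (b_odd1 + fps_XD b_odd1)) * Dl ^ 3
      = (b_odd0 * Dl) * ((b_odd1 * Dl) * Dl + fps_XD b_odd1 * Dl\<^sup>2)"
    by (simp add: algebra_simps power2_eq_square power3_eq_cube)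
  also have "\<dots> = 2 * (- 2 * fps_X * (1 - fps_X\<^sup>2)) * Dl + (fps_XD (- 2 * fps_X * (1 - fps_X\<^sup>2)) * Dl
      - 2 * (- 2 * fps_X * (1 - fps_X\<^sup>2)) * fps_XD Dl)"
    unfolding odd_series_mult_Dl XD_b_odd1_mult XD_Dl
    by (simp add: Dl_def XD_poly XD_mult algebra_simps eval_nat_numeral)
  also have "\<dots> = 2 * (y_plus * Dl\<^sup>2) * Dl + fps_XD y_plus * Dl ^ 3"
    unfolding XD_quotient2[OF odd_series_mult_Dl(4)] odd_series_mult_Dl(4) ..
  also have "\<dots> = (2 * y_plus + fps_XD y_plus) * Dl ^ 3"
    by (simp add: algebra_simps power2_eq_square power3_eq_cube)
  finally show "(2 * y_plus + fps_XD y_plus) * Dl ^ 3 = (b_odd0 * (b_odd1 + fps_XD b_odd1)) * Dl ^ 3" ..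
qed

text \<open>The even and odd parts of 1/2 log (1 + 2u - u^2).\<close>

definition eta_odd0 :: "rat fps" where "eta_odd0 = XD_integral (fps_X * b_odd1)"
definition eta_odd1 :: "rat fps" where "eta_odd1 = XD_integral (fps_X * b_odd0)"

lemma XD_eta_odd: "fps_XD eta_odd0 = fps_X * b_odd1" "fps_XD eta_odd1 = fps_X * b_odd0"
  by (simp_all add: eta_odd0_def eta_odd1_def XD_XD_integral)

lemma eta_odd_nth_0 [simp]: "eta_odd0 $ 0 = 0" "eta_odd1 $ 0 = 0"
  by (simp_all add: eta_odd0_def eta_odd1_def)

lemma b_odd: "(b_odd0 + b_odd1) * (1 + 2 * fps_X - fps_X\<^sup>2) = 1 - fps_X"
proof (rule fps_cancel)
  show "Dl $ 0 = 1" by simp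
  have "(b_odd0 + b_odd1) * (1 + 2 * fps_X - fps_X\<^sup>2) * Dl
    = (b_odd0 * Dl + b_odd1 * Dl) * (1 + 2 * fps_X - fps_X\<^sup>2)"
    by (simp add: algebra_simps)
  also have "\<dots> = (1 - fps_X) * Dl"
    unfolding odd_series_mult_Dl by (simp add: Dl_def algebra_simps eval_nat_numeral)
  finally show "(b_odd0 + b_odd1) * (1 + 2 * fps_X - fps_X\<^sup>2) * Dl = (1 - fps_X) * Dl" .
qed

lemma b_odd_nth_0 [simp]: "b_odd0 $ 0 = 1" "b_odd1 $ 0 = 0"
  by (simp_all add: b_odd0_def b_odd1_def)

text \<open>With q1 = 1 + 2u - u^2 and q2 = q1(-u), \<open>eta_odd0\<close> is 1/4 log (q1 q2) and
  \<open>eta_odd1\<close> is 1/4 log (q1/q2), so the left side is q2/q1^2. The right side g is shown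
  to satisfy g q1^2 = q2 and from this the equation of the exponential.\<close>

lemma fexp_eta_odd: "fexp (- (2 * eta_odd0) - 6 * eta_odd1)
  = b_odd0 + fps_XD b_odd0 + (b_odd1 + fps_XD b_odd1)"
proof (rule fexp_eqI)
  define q1 q2 :: "rat fps" where "q1 = 1 + 2 * fps_X - fps_X\<^sup>2" and "q2 = 1 - 2 * fps_X - fps_X\<^sup>2"
  define b where "b = b_odd0 + b_odd1"
  define g where "g = b + fps_XD b"
  have bq: "b * q1 = 1 - fps_X" unfolding b_def q1_def by (rule b_odd)
  have XD_q: "fps_XD q1 = 2 * fps_X - 2 * fps_X\<^sup>2" "fps_XD q2 = - 2 * fps_X - 2 * fps_X\<^sup>2"
    by (simp_all add: q1_def q2_def XD_poly)
  have Xbq: "fps_XD b * q1 = - fps_X - b * fps_XD q1"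
    using arg_cong[OF bq, of fps_XD] by (simp add: XD_mult XD_poly algebra_simps)
  have "g * q1\<^sup>2 = (b * q1) * q1 + (fps_XD b * q1) * q1"
    by (simp add: g_def algebra_simps power2_eq_square)
  also have "\<dots> = (b * q1) * q1 - fps_X * q1 - (b * q1) * fps_XD q1"
    unfolding Xbq by (simp add: algebra_simps)
  also have "\<dots> = q2"
    unfolding bq XD_q by (simp add: q1_def q2_def algebra_simps eval_nat_numeral)
  finally have gq: "g * q1\<^sup>2 = q2" .
  have Dl_q: "Dl = q1 * q2"
    by (simp add: Dl_def q1_def q2_def algebra_simps eval_nat_numeral)
  have bD: "b_odd0 * (q1 * q2) = 1 + fps_X\<^sup>2" "b_odd1 * (q1 * q2) = fps_X ^ 3 - 3 * fps_X"
    using odd_series_mult_Dl(1,2) by (simp_all only: Dl_q)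
  have "fps_XD g * q1\<^sup>2 + g * (2 * q1 * fps_XD q1) = fps_XD q2"
    using arg_cong[OF gq, of fps_XD] by (simp add: XD_mult power2_eq_square algebra_simps)
  then have Xgq: "fps_XD g * q1\<^sup>2 = fps_XD q2 - g * (2 * q1 * fps_XD q1)"
    by (simp add: algebra_simps)
  have "fps_XD g = (- (2 * (fps_X * b_odd1)) - 6 * (fps_X * b_odd0)) * g"
  proof (rule fps_cancel)
    show "(q1 ^ 3) $ 0 = 1" by (simp add: q1_def power3_eq_cube)
    have "fps_XD g * q1 ^ 3 = (fps_XD g * q1\<^sup>2) * q1"
      by (simp add: power2_eq_square power3_eq_cube algebra_simps)
    also have "\<dots> = fps_XD q2 * q1 - 2 * (g * q1\<^sup>2) * fps_XD q1"
      unfolding Xgq by (simp add: power2_eq_square algebra_simps)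
    also have "\<dots> = - (2 * (fps_X * (b_odd1 * (q1 * q2)))) - 6 * (fps_X * (b_odd0 * (q1 * q2)))"
      unfolding gq XD_q bD by (simp add: q1_def q2_def algebra_simps eval_nat_numeral)
    also have "\<dots> = (- (2 * (fps_X * b_odd1)) - 6 * (fps_X * b_odd0)) * (g * q1\<^sup>2) * q1"
      unfolding gq by (simp add: algebra_simps)
    also have "\<dots> = (- (2 * (fps_X * b_odd1)) - 6 * (fps_X * b_odd0)) * g * q1 ^ 3"
      by (simp add: power2_eq_square power3_eq_cube algebra_simps)
    finally show "fps_XD g * q1 ^ 3 = (- (2 * (fps_X * b_odd1)) - 6 * (fps_X * b_odd0)) * g * q1 ^ 3" .
  qed
  then show "fps_XD (b_odd0 + fps_XD b_odd0 + (b_odd1 + fps_XD b_odd1))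
      = fps_XD (- (2 * eta_odd0) - 6 * eta_odd1) * (b_odd0 + fps_XD b_odd0 + (b_odd1 + fps_XD b_odd1))"
    by (simp add: g_def b_def XD_poly XD_eta_odd add_ac)
qed simp_all

lemma parity_inverse_Dl: "parity True (inverse Dl)"
proof -
  have "parity True Dl"
    unfolding parity_def Dl_def by (auto simp: fps_numeral_fps_const)
  have "inverse Dl $ n = 0" if "odd n" for n
    using that
  proof (induction n rule: less_induct)
    case (less n)
    have "(Dl * inverse Dl) $ n = 0"
      using less.prems by (cases n) (simp_all add: mult.commute[of Dl] inverse_Dl)
    moreover have "(Dl * inverse Dl) $ n = inverse Dl $ n + (\<Sum>i=1..n. Dl $ i * inverse Dl $ (n - i))"
      by (simp add: fps_mult_nth sum.atLeast_Suc_atMost)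
    moreover have "(\<Sum>i=1..n. Dl $ i * inverse Dl $ (n - i)) = 0"
    proof (rule sum.neutral, rule ballI)
      fix i assume i: "i \<in> {1..n}"
      show "Dl $ i * inverse Dl $ (n - i) = 0"
      proof (cases "even i")
        case True
        then have "odd (n - i)" "n - i < n" using i less.prems by auto
        then show ?thesis using less.IH by simp
      next
        case False
        then show ?thesis using \<open>parity True Dl\<close> by (auto simp: parity_def)
      qed
    qed
    ultimately show ?case by simp
  qed
  then show ?thesis by (auto simp: parity_def)
qed

lemma parity_odd_series:
  "parity True b_odd0" "parity False b_odd1" "parity False y_minus" "parity False y_plus"
proof -
  have i2: "parity True ((inverse Dl)\<^sup>2)"
    using parity_mult[OF parity_inverse_Dl parity_inverse_Dl] by (simp add: power2_eq_square)
  have "parity True (1 + fps_X\<^sup>2)" "parity False (fps_X ^ 3 - 3 * fps_X)"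
      "parity False (- fps_X - 4 * fps_X ^ 3 + fps_X ^ 5)" "parity False (- 2 * fps_X * (1 - fps_X\<^sup>2))"
  proof -
    have "- 2 * fps_X * (1 - fps_X\<^sup>2) = 2 * fps_X ^ 3 - 2 * (fps_X ^ 1 :: rat fps)"
      by (simp add: algebra_simps eval_nat_numeral)
    then show "parity False (- 2 * fps_X * (1 - fps_X\<^sup>2))"
      by (simp only:) (auto simp: parity_def fps_numeral_fps_const split: if_splits)
  qed (auto simp: parity_def fps_numeral_fps_const split: if_splits)
  then show "parity True b_odd0" "parity False b_odd1" "parity False y_minus" "parity False y_plus"
    unfolding b_odd0_def b_odd1_def y_minus_def y_plus_def
    using parity_mult[OF _ parity_inverse_Dl] parity_mult[OF _ i2] by fastforce+
qed

lemma parity_XD_integral: "parity d f \<Longrightarrow> parity d (XD_integral f)"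
  by (auto simp: parity_def)

lemma parity_eta_odd: "parity True eta_odd0" "parity False eta_odd1"
  using parity_mult[OF parity_X parity_odd_series(2)] parity_mult[OF parity_X parity_odd_series(1)]
  by (simp_all add: eta_odd0_def eta_odd1_def parity_XD_integral)

lemma int_series_Dl: "int_series (inverse Dl)"
  by (rule int_series_inverse) (simp_all add: Dl_def int_series_closed int_series_numeral int_series_power)

lemma int_series_odd: "int_series b_odd0" "int_series b_odd1" "int_series y_minus" "int_series y_plus"
  unfolding b_odd0_def b_odd1_def y_minus_def y_plus_def
  by (simp_all add: int_series_closed int_series_numeral int_series_power int_series_Dl)

subsection \<open>The algebra\<close>

lemma single_0_central: "Poly_Mapping.single 0 q * p = p * (Poly_Mapping.single 0 q :: free_alg)"
proof (induction p rule: update_induct)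
  case (update f a b)
  have "Poly_Mapping.update a b f = f + Poly_Mapping.single a b"
    by (rule poly_mapping_eqI)
      (use update in \<open>auto simp: lookup_add lookup_single lookup_update in_keys_iff when_def\<close>)
  with update show ?case
    by (simp add: distrib_left distrib_right mult_single mult.commute)
qed simp

instantiation uea :: rat_algebra
begin
definition qof_uea :: "rat \<Rightarrow> uea" where "qof_uea q = q *\<^sub>Q 1"
instance
proof
  fix p q :: rat and a :: uea
  show "qof 1 = (1 :: uea)"
    unfolding qof_uea_def by transfer (simp add: rel_ideal.zero)
  show "qof (p + q) = (qof p + qof q :: uea)"
    unfolding qof_uea_def by transfer (simp add: single_add rel_ideal.zero)
  show "qof (p * q) = (qof p * qof q :: uea)"
    unfolding qof_uea_def by transfer (simp add: mult_single rel_ideal.zero)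
  show "qof q * a = a * qof q"
    unfolding qof_uea_def by transfer (simp add: single_0_central rel_ideal.zero)
qed
end

lemma qscale_eq: "q *\<^sub>Q a = qof q * a"
  unfolding qof_uea_def by transfer (simp add: rel_ideal.zero)

lemma divpow_eq: "divpow a k = dpow a k"
  by (simp add: divpow_def dpow_def qscale_eq)

definition X_el :: "pmsign \<Rightarrow> int \<Rightarrow> uea"
  where "X_el \<sigma> r = ugen (GenBigX \<sigma> (r div 2))"

lemmas uabs_add = plus_uea.abs_eq[symmetric] and uabs_diff = minus_uea.abs_eq[symmetric]
  and uabs_mult = times_uea.abs_eq[symmetric]
  and uabs_0 = zero_uea.abs_eq[symmetric] and uabs_1 = one_uea.abs_eq[symmetric]
  and uabs_fgen = ugen.abs_eq[symmetric]

lemma uabs_of_nat: "abs_uea (of_nat n) = of_nat n"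
  by (induction n) (simp_all add: uabs_0 uabs_1 uabs_add)

lemma uabs_of_int: "abs_uea (of_int n) = of_int n"
  by (cases n rule: int_diff_cases) (simp add: uabs_diff uabs_of_nat)

lemma uabs_relator: "p \<in> relators \<Longrightarrow> abs_uea p = 0"
  unfolding zero_uea.abs_eq uea.abs_eq_iff by (simp add: rel_ideal.gen)

lemma uabs_numeral: "abs_uea (numeral k) = numeral k"
  using uabs_of_nat[of "numeral k"] by simp

lemmas uabs_simps = uabs_add uabs_diff uabs_mult uabs_of_int uabs_fgen uabs_numeral commutator_def

lemma commutator_eqD: "a - b = 0 \<Longrightarrow> a = b" "a - b - d = 0 \<Longrightarrow> a = b + (d :: uea)"
  by (simp_all add: diff_eq_eq)

lemma c_central: "c_el * ugen y = ugen y * c_el"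
  using uabs_relator[OF relators.c_central[of y]] unfolding uabs_simps c_el_def
  by (rule commutator_eqD)

lemma h_h: "h_el r * h_el s = h_el s * h_el r + of_int (kdelta (r + s) * (2 * r * (2 + alt (r - 1)))) * c_el"
  using uabs_relator[OF relators.h_h[of r s]] unfolding uabs_simps c_el_def h_el_def
  by (rule commutator_eqD)

lemma h_x: "h_el r * x_el \<sigma> s = x_el \<sigma> s * h_el r + of_int (sgn_of \<sigma> * (if even r then 2 else 6)) * x_el \<sigma> (r + s)"
proof -
  have "2 * (2 + alt (r - 1)) = (if even r then 2 else 6)" by (simp add: alt_def)
  then show ?thesis
    using uabs_relator[OF relators.h_x[of r \<sigma> s]] unfolding uabs_simps x_el_def h_el_def
    by (simp only:) (rule commutator_eqD)
qed

lemma h_X: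
  assumes "odd s"
  shows "h_el r * X_el \<sigma> s
    = X_el \<sigma> s * h_el r + of_int (sgn_of \<sigma> * (if even r then 4 else 0)) * X_el \<sigma> (r + s)"
proof (cases "even r")
  case True
  then show ?thesis
    using uabs_relator[OF relators.h_X_even[OF assms True, of \<sigma>]] unfolding uabs_simps X_el_def h_el_def
    by (simp only: if_True) (rule commutator_eqD)
next
  case False
  then show ?thesis
    using uabs_relator[OF relators.h_X_odd[OF assms False, of \<sigma>]] unfolding uabs_simps X_el_def h_el_def
    by (simp only: if_False mult_zero_left mult_zero_right of_int_0 add_0_right) (rule commutator_eqD)
qed

lemma x_x_even: "even (r + s) \<Longrightarrow> x_el \<sigma> r * x_el \<sigma> s = x_el \<sigma> s * x_el \<sigma> r"
  using uabs_relator[OF relators.x_x_even[of r s \<sigma>]] unfolding uabs_simps x_el_def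
  by (rule commutator_eqD)

lemma x_x_odd: "odd (r + s) \<Longrightarrow>
    x_el \<sigma> r * x_el \<sigma> s = x_el \<sigma> s * x_el \<sigma> r + of_int (sgn_of \<sigma> * alt s) * X_el \<sigma> (r + s)"
  using uabs_relator[OF relators.x_x_odd[of r s \<sigma>]] unfolding uabs_simps x_el_def X_el_def
  by (rule commutator_eqD)

lemma x_X: "odd s \<Longrightarrow> x_el \<sigma> r * X_el \<sigma> s = X_el \<sigma> s * x_el \<sigma> r"
  using uabs_relator[OF relators.x_X[of s \<sigma> r]] unfolding uabs_simps x_el_def X_el_def
  by (rule commutator_eqD)

lemma X_X: "odd r \<Longrightarrow> odd s \<Longrightarrow> X_el \<sigma> r * X_el \<sigma> s = X_el \<sigma> s * X_el \<sigma> r"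
  using uabs_relator[OF relators.X_X[of r s \<sigma>]] unfolding uabs_simps X_el_def
  by (rule commutator_eqD)

lemma xp_xm: "x_el PlusS r * x_el MinusS s
    = x_el MinusS s * x_el PlusS r + (h_el (r + s) + of_int (kdelta (r + s) * r) * c_el)"
  using uabs_relator[OF relators.xp_xm[of r s]] unfolding uabs_simps x_el_def h_el_def c_el_def
  by (rule commutator_eqD)

lemma xp_Xm:
  assumes "odd s"
  shows "x_el PlusS r * X_el MinusS s
    = X_el MinusS s * x_el PlusS r + of_int (alt r * 4) * x_el MinusS (r + s)"
  using uabs_relator[OF relators.x_X_opp[OF assms, of PlusS r]] unfolding uabs_simps x_el_def X_el_def
  by (simp only: flip.simps sgn_of.simps mult_1_left) (rule commutator_eqD)

lemma c_commute: "c_el * h_el r = h_el r * c_el" "c_el * x_el \<sigma> r = x_el \<sigma> r * c_el"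
    "c_el * X_el \<sigma> r = X_el \<sigma> r * c_el"
  unfolding h_el_def x_el_def X_el_def by (rule c_central)+

lemma of_int_c_commute: "a * c_el = c_el * a \<Longrightarrow> a * (of_int n * c_el) = of_int n * c_el * a"
  by (metis mult.assoc mult_of_int_commute)

text \<open>Progressions of step r + s, so that an x^+ index plus an x^- index is a multiple of r +
  s. The central term of \<open>hh\<close> survives only for r + s = 0, where all sequences are
  constant and \<open>hh\<close> is h_0 + r c.\<close>

definition xplus :: "int \<Rightarrow> int \<Rightarrow> nat \<Rightarrow> uea"
  where "xplus r s i = x_el PlusS (r + (r + s) * int i)"
definition xminus :: "int \<Rightarrow> int \<Rightarrow> nat \<Rightarrow> uea"
  where "xminus r s i = x_el MinusS (s + (r + s) * int i)"
definition hh :: "int \<Rightarrow> int \<Rightarrow> nat \<Rightarrow> uea"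
  where "hh r s i = h_el ((r + s) * int i) + of_int (kdelta (r + s) * r) * c_el"
text \<open>The sign \<open>alt r\<close> absorbs the signs in the brackets of the x, so that Xp and
  Xm obey the uniform relations of \<open>odd_currents\<close>.\<close>

definition Xplus :: "int \<Rightarrow> int \<Rightarrow> nat \<Rightarrow> uea"
  where "Xplus r s i = of_int (alt r) * X_el PlusS (2 * r + (r + s) * int i)"
definition Xminus :: "int \<Rightarrow> int \<Rightarrow> nat \<Rightarrow> uea"
  where "Xminus r s i = of_int (alt r) * X_el MinusS (2 * s + (r + s) * int i)"

lemma xplus_xminus: "xplus r s i * xminus r s j = xminus r s j * xplus r s i + hh r s (Suc (i + j))"
proof -
  have "(r + (r + s) * int i) + (s + (r + s) * int j) = (r + s) * int (Suc (i + j))"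
    by (simp add: algebra_simps)
  moreover have "kdelta ((r + s) * int (Suc (i + j))) * (r + (r + s) * int i) = kdelta (r + s) * r"
    by (auto simp: kdelta_def)
  ultimately show ?thesis
    unfolding xplus_def xminus_def hh_def by (simp only: xp_xm)
qed

lemma hh_x: "hh r s i * x_el \<sigma> k = x_el \<sigma> k * hh r s i
    + of_int (sgn_of \<sigma> * (if even ((r + s) * int i) then 2 else 6)) * x_el \<sigma> ((r + s) * int i + k)"
  unfolding hh_def distrib_left distrib_right
  by (simp only: h_x of_int_c_commute[OF c_commute(2)[symmetric]] add_ac)

lemma hh_X:
  assumes "odd k"
  shows "hh r s i * X_el \<sigma> k = X_el \<sigma> k * hh r s i
    + of_int (sgn_of \<sigma> * (if even ((r + s) * int i) then 4 else 0)) * X_el \<sigma> ((r + s) * int i + k)"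
  unfolding hh_def distrib_left distrib_right
  by (simp only: h_X[OF assms] of_int_c_commute[OF c_commute(3)[symmetric]] add_ac)

lemma hh_hh:
  assumes "0 < i" "0 < j"
  shows "hh r s i * hh r s j = hh r s j * hh r s i"
proof -
  have "kdelta ((r + s) * int i + (r + s) * int j) * (2 * ((r + s) * int i) * (2 + alt ((r + s) * int i - 1))) = 0"
  proof (cases "r + s = 0")
    case False
    then have "(r + s) * (int i + int j) \<noteq> 0" using assms by simp
    then show ?thesis by (simp add: kdelta_def distrib_left)
  qed simp
  then have 1: "h_el ((r + s) * int i) * h_el ((r + s) * int j) = h_el ((r + s) * int j) * h_el ((r + s) * int i)"
    using h_h[of "(r + s) * int i" "(r + s) * int j"] by (simp only: of_int_0 mult_zero_left add_0_right)
  have 2: "h_el k * (of_int n * c_el) = of_int n * c_el * h_el k" for k n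
    by (rule of_int_c_commute[OF c_commute(1)[symmetric]])
  have "(a + k) * (b + k) = (b + k) * (a + k)" if "a * b = b * a" "a * k = k * a" "b * k = k * b" for a b k :: uea
    using that by (simp add: algebra_simps)
  from this[OF 1 2 2] show ?thesis unfolding hh_def .
qed

lemma hh_xminus: "hh r s i * xminus r s j
    = xminus r s j * hh r s i - (if even ((r + s) * int i) then 2 else 6) * xminus r s (i + j)"
proof -
  have "(r + s) * int i + (s + (r + s) * int j) = s + (r + s) * int (i + j)"
    by (simp add: algebra_simps)
  then show ?thesis
    using hh_x[of r s i MinusS "s + (r + s) * int j"] unfolding xminus_def
    by (simp only:) (simp split: if_split)
qed

lemma xplus_hh: "xplus r s i * hh r s j
    = hh r s j * xplus r s i - (if even ((r + s) * int j) then 2 else 6) * xplus r s (i + j)"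
proof -
  have "(r + s) * int j + (r + (r + s) * int i) = r + (r + s) * int (i + j)"
    by (simp add: algebra_simps)
  then show ?thesis
    using hh_x[of r s j PlusS "r + (r + s) * int i"] unfolding xplus_def
    by (simp only:) (simp split: if_split)
qed

lemma even_currents:
  assumes "even (r + s)"
  shows "even_currents (xplus r s) (xminus r s) (hh r s)"
proof
  fix i j :: nat
  show "xplus r s i * xminus r s j = xminus r s j * xplus r s i + hh r s (Suc (i + j))"
    by (rule xplus_xminus)
  show "xplus r s i * xplus r s j = xplus r s j * xplus r s i"
      "xminus r s i * xminus r s j = xminus r s j * xminus r s i"
    unfolding xplus_def xminus_def by (rule x_x_even; use assms in simp)+
  show "xplus r s i * hh r s j = hh r s j * xplus r s i - 2 * xplus r s (i + j)" if "0 < j"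
    using assms xplus_hh[of r s i j] by simp
  show "hh r s i * xminus r s j = xminus r s j * hh r s i - 2 * xminus r s (i + j)" if "0 < i"
    using assms hh_xminus[of r s i j] by simp
qed (rule hh_hh)

lemma alt_add: "alt (a + b) = alt a * alt b"
  by (auto simp: alt_def)

lemma alt_mult_self [simp]: "alt a * alt a = 1"
  by (simp add: alt_def)

lemma of_int_mult_mult: "of_int a * x * (of_int b * y) = of_int (a * b) * (x * y :: 'a::ring_1)"
  by (metis mult.assoc mult_of_int_commute of_int_mult)

lemma of_int_left_commute: "x * (of_int b * y) = of_int b * (x * y :: 'a::ring_1)"
  by (metis mult.assoc mult_of_int_commute)

lemma odd_currents:
  assumes odd: "odd (r + s)"
  shows "odd_currents (xplus r s) (xminus r s) (hh r s) (Xplus r s) (Xminus r s)"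
proof
  fix i j :: nat
  have alt_m: "alt ((r + s) * int k) = (if even k then 1 else - 1)" for k
    using odd by (auto simp: alt_def)
  have alt_s: "alt s = - alt r" using odd by (auto simp: alt_def)
  show "xplus r s i * xminus r s j = xminus r s j * xplus r s i + hh r s (Suc (i + j))"
    by (rule xplus_xminus)
  show "xplus r s i * xplus r s j = xplus r s j * xplus r s i"
      "xminus r s i * xminus r s j = xminus r s j * xminus r s i" if "even (i + j)"
    unfolding xplus_def xminus_def by (rule x_x_even; use that odd in simp)+
  show "xplus r s i * hh r s j = hh r s j * xplus r s i - (if even j then 2 else 6) * xplus r s (i + j)" if "0 < j"
    using odd xplus_hh[of r s i j] by simp
  show "hh r s i * xminus r s j = xminus r s j * hh r s i - (if even i then 2 else 6) * xminus r s (i + j)" if "0 < i"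
    using odd hh_xminus[of r s i j] by simp
  show "xplus r s i * xplus r s j = xplus r s j * xplus r s i - Xplus r s (i + j)" if "even i" "odd j"
  proof -
    have "r + (r + s) * int i + (r + (r + s) * int j) = 2 * r + (r + s) * int (i + j)"
      by (simp add: algebra_simps)
    moreover have "odd (2 * r + (r + s) * int (i + j))" using odd that by simp
    ultimately show ?thesis
      using x_x_odd[of "r + (r + s) * int i" "r + (r + s) * int j" PlusS] that
      unfolding xplus_def Xplus_def by (simp add: alt_add alt_m)
  qed
  show "xminus r s i * xminus r s j = xminus r s j * xminus r s i - Xminus r s (i + j)" if "even i" "odd j"
  proof -
    have "s + (r + s) * int i + (s + (r + s) * int j) = 2 * s + (r + s) * int (i + j)"
      by (simp add: algebra_simps)
    moreover have "odd (2 * s + (r + s) * int (i + j))" using odd that by simp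
    ultimately show ?thesis
      using x_x_odd[of "s + (r + s) * int i" "s + (r + s) * int j" MinusS] that
      unfolding xminus_def Xminus_def by (simp add: alt_add alt_m alt_s)
  qed
  show "xplus r s i * Xplus r s j = Xplus r s j * xplus r s i" if "odd j"
    unfolding xplus_def Xplus_def using x_X odd that by (simp add: of_int_left_commute mult.assoc)
  show "xminus r s i * Xminus r s j = Xminus r s j * xminus r s i" if "odd j"
    unfolding xminus_def Xminus_def using x_X odd that by (simp add: of_int_left_commute mult.assoc)
  show "Xplus r s i * Xplus r s j = Xplus r s j * Xplus r s i" if "odd i" "odd j"
    unfolding Xplus_def using X_X odd that by (simp add: of_int_mult_mult mult.commute)
  show "Xminus r s i * Xminus r s j = Xminus r s j * Xminus r s i" if "odd i" "odd j"
    unfolding Xminus_def using X_X odd that by (simp add: of_int_mult_mult mult.commute)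
  show "xplus r s i * Xminus r s j = Xminus r s j * xplus r s i + (if even i then 4 else - 4) * xminus r s (Suc (i + j))"
    if "odd j"
  proof -
    have 1: "r + (r + s) * int i + (2 * s + (r + s) * int j) = s + (r + s) * int (Suc (i + j))"
      by (simp add: algebra_simps)
    have 2: "of_int (alt r) * (of_int (alt (r + (r + s) * int i) * 4) * x) = (if even i then 4 else - 4) * x" for x :: uea
    proof -
      have "alt r * (alt (r + (r + s) * int i) * 4) = (if even i then 4 else - 4)"
        by (simp add: alt_add alt_m flip: mult.assoc)
      then have "of_int (alt r * (alt (r + (r + s) * int i) * 4)) = (if even i then 4 else - 4 :: uea)"
        by simp
      then show ?thesis by (simp only: mult.assoc[symmetric, where 'a = uea] of_int_mult[symmetric])
    qed
    let ?x = "x_el PlusS (r + (r + s) * int i)" and ?X = "X_el MinusS (2 * s + (r + s) * int j)"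
    have "?x * (of_int (alt r) * ?X) = of_int (alt r) * (?x * ?X)"
      by (rule of_int_left_commute)
    also have "?x * ?X = ?X * ?x + of_int (alt (r + (r + s) * int i) * 4) * x_el MinusS (s + (r + s) * int (Suc (i + j)))"
      using xp_Xm[of "2 * s + (r + s) * int j" "r + (r + s) * int i"] odd that unfolding 1 by simp
    finally show ?thesis
      unfolding xplus_def Xminus_def xminus_def distrib_left[of "of_int (alt r) :: uea"] 2 mult.assoc .
  qed
  show "hh r s i * Xminus r s j = Xminus r s j * hh r s i - (if even i then 4 else 0) * Xminus r s (i + j)"
    if "0 < i" "odd j"
  proof -
    have 1: "odd (2 * s + (r + s) * int j)" using odd that by simp
    have "(r + s) * int i + (2 * s + (r + s) * int j) = 2 * s + (r + s) * int (i + j)"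
      by (simp add: algebra_simps)
    moreover have "even ((r + s) * int i) = even i" using odd by simp
    ultimately have
      "hh r s i * X_el MinusS (2 * s + (r + s) * int j) = X_el MinusS (2 * s + (r + s) * int j) * hh r s i
        - (if even i then 4 else 0) * X_el MinusS (2 * s + (r + s) * int (i + j))"
      using hh_X[OF 1, of r s i MinusS] by (simp only:) (simp split: if_split)
    then have "of_int (alt r) * (hh r s i * X_el MinusS (2 * s + (r + s) * int j))
        = of_int (alt r) * (X_el MinusS (2 * s + (r + s) * int j) * hh r s i)
        - of_int (alt r) * ((if even i then 4 else 0) * X_el MinusS (2 * s + (r + s) * int (i + j)))"
      by (simp only: right_diff_distrib)
    moreover have "of_int (alt r) * ((if even i then 4 else 0) * x) = (if even i then 4 else 0) * (of_int (alt r) * x)" for x :: uea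
      using of_int_left_commute[of 4 "alt r" x] by simp
    ultimately show ?thesis
      unfolding Xminus_def of_int_left_commute[of "hh r s i"] mult.assoc by simp
  qed
qed (rule hh_hh)

subsection \<open>Graded pieces of the integral forms of the nilpotent parts\<close>

text \<open>Abstracts the degree count: series with coefficient n in \<open>K n\<close> are closed
  under products. Applied to \<open>grP\<close>, to \<open>grM\<close> and to multiples of degrees
  of \<open>gr\<close>.\<close>

definition graded_family :: "(nat \<Rightarrow> 'a::ring_1 set) \<Rightarrow> bool"
  where "graded_family K \<longleftrightarrow> 1 \<in> K 0 \<and> (\<forall>n. 0 \<in> K n \<and> (\<forall>a\<in>K n. \<forall>b\<in>K n. a - b \<in> K n))
    \<and> (\<forall>m n. \<forall>a\<in>K m. \<forall>b\<in>K n. a * b \<in> K (m + n))"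

lemma graded_familyD:
  assumes "graded_family K"
  shows "1 \<in> K 0" "0 \<in> K n" "a \<in> K n \<Longrightarrow> b \<in> K n \<Longrightarrow> a - b \<in> K n"
    "a \<in> K n \<Longrightarrow> b \<in> K n \<Longrightarrow> a + b \<in> K n" "c \<in> K m \<Longrightarrow> b \<in> K n \<Longrightarrow> c * b \<in> K (m + n)"
proof -
  show 0: "0 \<in> K n" and diff: "a \<in> K n \<Longrightarrow> b \<in> K n \<Longrightarrow> a - b \<in> K n" for a b n
    using assms by (auto simp: graded_family_def)
  show "1 \<in> K 0" and "c \<in> K m \<Longrightarrow> b \<in> K n \<Longrightarrow> c * b \<in> K (m + n)"
    using assms by (auto simp: graded_family_def)
  assume "a \<in> K n" "b \<in> K n"
  then show "a + b \<in> K n" using diff[of a n "0 - b"] diff[of 0 n b] 0 by simp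
qed

lemma graded_family_sum:
  "graded_family K \<Longrightarrow> (\<And>x. x \<in> A \<Longrightarrow> f x \<in> K n) \<Longrightarrow> sum f A \<in> K n"
  by (induction A rule: infinite_finite_induct) (auto intro: graded_familyD)

lemma fps_commute_coeffs:
  fixes f g :: "'a::ring_1 fps"
  assumes "\<And>i j. f $ i * g $ j = g $ j * f $ i"
  shows "f * g = g * f"
proof (rule fps_ext)
  fix n
  show "(f * g) $ n = (g * f) $ n"
    unfolding fps_mult_nth
    by (rule sum.reindex_bij_witness[of _ "\<lambda>i. n - i" "\<lambda>i. n - i"]) (auto simp: assms)
qed

lemma dpow_const_X_power:
  "dpow (fps_const c * fps_X ^ m) k = fps_const (dpow (c :: 'a::rat_algebra) k) * fps_X ^ (m * k)"
proof -
  have "dpow (fps_const c) k = fps_const (dpow c k)"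
    by (simp add: dpow_def qof_fps_def)
  then show ?thesis
    using dpow_mult_commuting[of "fps_const c" "fps_X ^ m" k]
    by (simp add: fps_mult_fps_X_power_commute power_mult)
qed

lemma const_X_power_nth: "(fps_const c * fps_X ^ m) $ n = (if n = m then c else (0 :: 'a::ring_1))"
  by simp

text \<open>The coefficients commute, so the exponential of the truncation \<open>T\<close> factors
  into exponentials of monomials, whose coefficients are divided powers. What A has beyond degree n
  does not reach coefficient n.\<close>

lemma fexp_graded:
  fixes A :: "'a::rat_algebra fps"
  assumes K: "graded_family K" and A0: "A $ 0 = 0"
    and comm: "\<And>i j. A $ i * A $ j = A $ j * A $ i"
    and dpow: "\<And>n i. dpow (A $ n) i \<in> K (n * i)"
  shows "fexp A $ n \<in> K n"
proof -
  define T where "T N = (\<Sum>m<N. fps_const (A $ m) * fps_X ^ m)" for N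
  have T_nth: "T N $ i = (if i < N then A $ i else 0)" for N i
  proof -
    have "T N $ i = (\<Sum>m<N. if m = i then A $ i else 0)"
      unfolding T_def fps_sum_nth by (rule sum.cong) auto
    then show ?thesis by simp
  qed
  have T: "fexp (T N) $ n \<in> K n" for N n
  proof (induction N arbitrary: n)
    case 0
    show ?case using graded_familyD[OF K] by (cases n) (auto simp: T_def)
  next
    case (Suc N)
    let ?M = "fps_const (A $ N) * fps_X ^ N"
    have "T (Suc N) = T N + ?M" by (simp add: T_def)
    also have "fexp \<dots> = fexp (T N) * fexp ?M"
      by (rule fexp_add) (auto simp: T_nth A0 intro!: fps_commute_coeffs simp: comm)
    finally have "fexp (T (Suc N)) $ n = (\<Sum>i=0..n. fexp (T N) $ i * fexp ?M $ (n - i))"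
      by (simp add: fps_mult_nth)
    also have "\<dots> \<in> K n"
    proof (rule graded_family_sum[OF K])
      fix i assume i: "i \<in> {0..n}"
      have "fexp ?M $ k \<in> K k" for k
        unfolding fexp_def fsum_def fps_nth_Abs_fps
      proof (rule graded_family_sum[OF K])
        fix j
        show "dpow ?M j $ k \<in> K k"
          using dpow[of N j] graded_familyD(2)[OF K] by (simp add: dpow_const_X_power)
      qed
      from graded_familyD(5)[OF K Suc.IH[of i] this[of "n - i"]] i
      show "fexp (T N) $ i * fexp ?M $ (n - i) \<in> K n" by simp
    qed
    finally show ?case .
  qed
  define B where "B = A - T (Suc n)"
  have B_nth: "B $ i = (if i < Suc n then 0 else A $ i)" for i
    by (simp add: B_def T_nth)
  have "fexp B $ i = 0" if "0 < i" "i \<le> n" for i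
  proof -
    have "dpow B k $ i = 0" for k
    proof (cases k)
      case (Suc k')
      have "ord_ge (B * dpow B k') (Suc n + 0)"
        by (rule ord_ge_mult) (auto simp: ord_ge_def B_nth)
      then have "(B * dpow B k') $ i = 0" using that by (simp add: ord_ge_def)
      then have "of_nat (Suc k') * dpow B (Suc k') $ i = 0"
        using dpow_Suc[of k' B] qof_mult_nth[of "of_nat (Suc k')" "dpow B (Suc k')" i]
        by (simp only: qof_of_nat)
      then have "dpow B (Suc k') $ i = 0"
        using of_nat_mult_cancel[of "Suc k'" "dpow B (Suc k') $ i" 0] by simp
      then show ?thesis using Suc by simp
    qed (use that in simp)
    then show ?thesis by (simp add: fexp_def fsum_def)
  qed
  moreover have "fexp A = fexp B * fexp (T (Suc n))"
    using fexp_add[of B "T (Suc n)"] A0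
    by (simp add: B_nth T_nth fps_commute_coeffs comm) (simp add: B_def)
  ultimately have "fexp A $ n = fexp (T (Suc n)) $ n"
    by (simp add: fps_mult_nth sum.atLeast_Suc_atMost)
  then show ?thesis using T by simp
qed

text \<open>Integral combinations of products of divided powers, homogeneous of degree d. Each step
  multiplies by one divided power of positive degree, which later inductions peel off. Degrees are
  integers because differences such as 2k - n occur; in negative degree only 0 remains
  (\<open>gr_neg\<close>).\<close>

inductive gr :: "pmsign \<Rightarrow> int \<Rightarrow> uea \<Rightarrow> bool" for \<sigma> where
  gr_0: "gr \<sigma> d 0"
| gr_1: "gr \<sigma> 0 1"
| gr_diff: "gr \<sigma> d a \<Longrightarrow> gr \<sigma> d b \<Longrightarrow> gr \<sigma> d (a - b)"
| gr_gen_mult: "0 < k \<Longrightarrow> gr \<sigma> d a \<Longrightarrow> gr \<sigma> (d + int k) (dpow (x_el \<sigma> r) k * a)"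

lemma gr_neg: "gr \<sigma> d a \<Longrightarrow> a = 0 \<or> 0 \<le> d"
  by (induction rule: gr.induct) auto

lemma gr_mult: "gr \<sigma> d a \<Longrightarrow> gr \<sigma> e b \<Longrightarrow> gr \<sigma> (d + e) (a * b)"
proof (induction rule: gr.induct)
  case (gr_gen_mult k d a r)
  then have "gr \<sigma> ((d + e) + int k) (dpow (x_el \<sigma> r) k * (a * b))"
    by (intro gr.gr_gen_mult)
  then show ?case by (simp add: algebra_simps)
qed (auto simp: left_diff_distrib intro: gr.intros)

lemma gr_minus: "gr \<sigma> d a \<Longrightarrow> gr \<sigma> d (- a)"
  using gr_diff[OF gr_0, of \<sigma> d a] by simp

lemma gr_add: "gr \<sigma> d a \<Longrightarrow> gr \<sigma> d b \<Longrightarrow> gr \<sigma> d (a + b)"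
  using gr_diff[OF _ gr_minus, of \<sigma> d a b] by simp

lemma gr_sum: "(\<And>x. x \<in> A \<Longrightarrow> gr \<sigma> d (f x)) \<Longrightarrow> gr \<sigma> d (sum f A)"
  by (induction A rule: infinite_finite_induct) (auto intro: gr_0 gr_add)

lemma gr_of_int: "gr \<sigma> 0 (of_int n)"
proof -
  have "gr \<sigma> 0 (of_nat k)" for k
    by (induction k) (auto intro: gr.intros gr_add)
  then show ?thesis by (cases n rule: int_diff_cases) (auto intro: gr_diff)
qed

lemma gr_of_int_mult: "gr \<sigma> d a \<Longrightarrow> gr \<sigma> d (of_int n * a)"
  using gr_mult[OF gr_of_int] by fastforce

lemma gr_x: "gr \<sigma> (int k) (dpow (x_el \<sigma> r) k)"
  using gr_gen_mult[OF _ gr_1, of k \<sigma> r] by (cases "k = 0") (simp_all add: gr_1)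

text \<open>Conjugating y by exp (e x) gives y + e w. The coefficient of e^k in the k-th divided
  power of y + e w is that of w, while the conjugate expands into divided powers of x and y. Thus w,
  and with it X, inherits integral divided powers.\<close>

lemma dpow_commutator:
  fixes x y w :: "'a::rat_algebra"
  assumes xy: "x * y = y * x + w" and xw: "x * w = w * x" and yw: "y * w = w * y"
  shows "dpow w k = (\<Sum>i\<le>k. dpow x i * dpow y k * ((- 1) ^ (k - i) * dpow x (k - i)))"
proof -
  have dpow_const_X: "dpow (fps_const c * fps_X) k = fps_const (dpow c k) * fps_X ^ k" for c :: 'a and k
    using dpow_const_X_power[of c 1 k] by simp
  define e where "e = fps_const x * (fps_X :: 'a fps)"
  define Y where "Y = fps_const y"
  define V where "V = fps_const w * (fps_X :: 'a fps)"
  have e_nth: "fexp e $ i = dpow x i" for i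
  proof -
    have "fexp e $ i = (\<Sum>k\<le>i. if i = k then dpow x k else 0)"
      unfolding fexp_def fsum_def fps_nth_Abs_fps e_def by (rule sum.cong) (auto simp: dpow_const_X)
    then show ?thesis by simp
  qed
  have me_nth: "fexp (- e) $ i = (- 1) ^ i * dpow x i" for i
  proof -
    have "- e = fps_const (- x) * fps_X" by (rule fps_ext) (simp add: e_def)
    then have "fexp (- e) $ i = (\<Sum>k\<le>i. if i = k then dpow (- x) k else 0)"
      unfolding fexp_def fsum_def fps_nth_Abs_fps by (intro sum.cong) (auto simp: dpow_const_X)
    then show ?thesis using dpow_of_int_mult[of "- 1" x i] by simp
  qed
  have e0: "e $ 0 = 0" by (simp add: e_def)
  have eY: "fexp e * Y = (Y + V) * fexp e"
  proof -
    define Z where "Z i = (if i = 0 then Y else if i = 1 then V else 0)" for i :: nat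
    have eY: "e * Y = Y * e + V"
      by (rule fps_ext) (simp add: e_def Y_def V_def xy)
    have eV: "e * V = V * e"
      by (rule fps_commute_coeffs) (simp add: e_def V_def xw)
    have Z: "e * Z i = Z i * e + of_nat (Suc i) * Z (Suc i)" for i
      by (auto simp: Z_def eY eV)
    have Z': "Z i * (- e) = (- e) * Z i + of_nat (Suc i) * Z (Suc i)" for i
      using Z[of i] by simp
    have "fsum Z = (\<Sum>i<2. Z i)"
      by (rule fsum_finite[OF ord_ge_ad_sequence[OF _ Z']]) (auto simp: e0 Z_def)
    also have "\<dots> = Y + V" by (simp add: Z_def eval_nat_numeral)
    finally have "fsum Z = Y + V" .
    moreover have "Z 0 = Y" by (simp add: Z_def)
    ultimately show ?thesis using fexp_conj'[OF e0 Z] by simp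
  qed
  have pow: "fexp e * Y ^ k = (Y + V) ^ k * fexp e" for k
  proof (induction k)
    case (Suc k)
    have "fexp e * Y ^ Suc k = (fexp e * Y) * Y ^ k" by (simp add: mult.assoc)
    also have "\<dots> = (Y + V) * (fexp e * Y ^ k)" by (simp only: eY mult.assoc)
    finally show ?case by (simp only: Suc mult.assoc power_Suc)
  qed simp
  have "fexp e * dpow Y k = dpow (Y + V) k * fexp e"
    by (simp only: dpow_def qof_left_commute pow mult.assoc)
  then have "fexp e * dpow Y k * fexp (- e) = dpow (Y + V) k"
    using fexp_uminus(1)[OF e0] by (simp add: mult.assoc)
  moreover have "dpow (Y + V) k $ k = dpow w k"
  proof -
    have "Y * V = V * Y" by (rule fps_commute_coeffs) (simp add: Y_def V_def yw)
    from dpow_add[OF this, of k] have "dpow (Y + V) k $ k = (\<Sum>i\<le>k. (dpow Y (k - i) * dpow V i) $ k)"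
      by (simp add: fps_sum_nth)
    also have "\<dots> = (\<Sum>i\<le>k. if i = k then dpow w k else 0)"
    proof (rule sum.cong[OF refl])
      fix i
      have "dpow Y j = fps_const (dpow y j)" for j
        using dpow_const_X_power[of y 0 j] by (simp add: Y_def)
      then show "(dpow Y (k - i) * dpow V i) $ k = (if i = k then dpow w k else 0)"
        by (simp add: V_def dpow_const_X flip: mult.assoc)
    qed
    finally show ?thesis by simp
  qed
  moreover have "dpow Y k = fps_const (dpow y k)"
    using dpow_const_X_power[of y 0 k] by (simp add: Y_def)
  ultimately have "dpow w k = (fexp e * fps_const (dpow y k) * fexp (- e)) $ k"
    by simp
  also have "\<dots> = (\<Sum>i\<le>k. dpow x i * dpow y k * ((- 1) ^ (k - i) * dpow x (k - i)))"
    by (subst fps_mult_nth) (simp add: e_nth me_nth atLeast0AtMost)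
  finally show ?thesis .
qed

lemma gr_X:
  assumes "odd m"
  shows "gr \<sigma> (2 * int k) (dpow (X_el \<sigma> m) k)"
proof -
  define w where "w = of_int (sgn_of \<sigma> * alt m) * X_el \<sigma> m"
  have "dpow w k = (\<Sum>i\<le>k. dpow (x_el \<sigma> 0) i * dpow (x_el \<sigma> m) k * ((- 1) ^ (k - i) * dpow (x_el \<sigma> 0) (k - i)))"
  proof (rule dpow_commutator)
    show "x_el \<sigma> 0 * x_el \<sigma> m = x_el \<sigma> m * x_el \<sigma> 0 + w"
      using x_x_odd[of 0 m \<sigma>] assms by (simp add: w_def)
  qed (simp_all only: w_def of_int_left_commute[of "x_el _ _"] x_X[OF assms] mult.assoc)
  also have "gr \<sigma> (2 * int k) \<dots>"
  proof (rule gr_sum)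
    fix i assume "i \<in> {..k}"
    have "gr \<sigma> (int (k - i)) (of_int ((- 1) ^ (k - i)) * dpow (x_el \<sigma> 0) (k - i))"
      by (rule gr_of_int_mult[OF gr_x])
    from gr_mult[OF gr_mult[OF gr_x[of \<sigma> i 0] gr_x[of \<sigma> k m]] this] \<open>i \<in> {..k}\<close>
    show "gr \<sigma> (2 * int k) (dpow (x_el \<sigma> 0) i * dpow (x_el \<sigma> m) k * ((- 1) ^ (k - i) * dpow (x_el \<sigma> 0) (k - i)))"
      by (simp add: of_nat_diff)
  qed
  finally have "gr \<sigma> (2 * int k) (dpow w k)" .
  then have "gr \<sigma> (2 * int k) (of_int ((sgn_of \<sigma> * alt m) ^ k) * dpow w k)"
    by (rule gr_of_int_mult)
  moreover have "dpow w k = of_int ((sgn_of \<sigma> * alt m) ^ k) * dpow (X_el \<sigma> m) k"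
    unfolding w_def by (rule dpow_of_int_mult)
  moreover have "(sgn_of \<sigma> * alt m) ^ k * (sgn_of \<sigma> * alt m) ^ k = 1"
    by (cases \<sigma>) (auto simp: alt_def simp flip: power_mult_distrib)
  ultimately show ?thesis
    by (simp only: mult.assoc[symmetric] of_int_mult[symmetric] of_int_1 mult_1_left)
qed

subsection \<open>Integrality of the factors\<close>

text \<open>In the variables u and v, s^n w^k is u^k v^(n-k), and the degree in x^+ is the excess 2k
  - n of u over v; for \<open>grM\<close> it is the opposite excess. The clause for n < k says that
  v has no negative exponent.\<close>

definition grP :: "nat \<Rightarrow> uea fps set"
  where "grP n = {g. \<forall>k. gr PlusS (2 * int k - int n) (g $ k) \<and> (n < k \<longrightarrow> g $ k = 0)}"

definition grM :: "nat \<Rightarrow> uea fps set"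
  where "grM n = {g. \<forall>k. gr MinusS (int n - 2 * int k) (g $ k)}"

lemma graded_family_grP: "graded_family grP"
  unfolding graded_family_def grP_def mem_Collect_eq
proof (intro conjI allI ballI impI, unfold mem_Collect_eq)
  fix k :: nat
  show "gr PlusS (2 * int k - int 0) ((1 :: uea fps) $ k)"
    by (cases k) (auto intro: gr.intros)
next
  fix m n k :: nat and a b :: "uea fps"
  assume a: "\<forall>k. gr PlusS (2 * int k - int m) (a $ k) \<and> (m < k \<longrightarrow> a $ k = 0)"
    and b: "\<forall>k. gr PlusS (2 * int k - int n) (b $ k) \<and> (n < k \<longrightarrow> b $ k = 0)"
  show "gr PlusS (2 * int k - int (m + n)) ((a * b) $ k)"
    unfolding fps_mult_nth
  proof (rule gr_sum)
    fix i assume "i \<in> {0..k}"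
    then have "2 * int k - int (m + n) = (2 * int i - int m) + (2 * int (k - i) - int n)" by auto
    then show "gr PlusS (2 * int k - int (m + n)) (a $ i * b $ (k - i))"
      using a b by (simp only: gr_mult)
  qed
  show "(a * b) $ k = 0" if "m + n < k"
    unfolding fps_mult_nth
  proof (rule sum.neutral, rule ballI)
    fix i assume "i \<in> {0..k}"
    then have "m < i \<or> n < k - i" using that by auto
    then show "a $ i * b $ (k - i) = 0" using a b by auto
  qed
qed (auto intro: gr.intros)

lemma graded_family_grM: "graded_family grM"
  unfolding graded_family_def grM_def mem_Collect_eq
proof (intro conjI allI ballI impI, unfold mem_Collect_eq)
  fix k :: nat
  show "gr MinusS (int 0 - 2 * int k) ((1 :: uea fps) $ k)"
    by (cases k) (auto intro: gr.intros)
next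
  fix m n k :: nat and a b :: "uea fps"
  assume a: "\<forall>k. gr MinusS (int m - 2 * int k) (a $ k)" and b: "\<forall>k. gr MinusS (int n - 2 * int k) (b $ k)"
  show "gr MinusS (int (m + n) - 2 * int k) ((a * b) $ k)"
    unfolding fps_mult_nth
  proof (rule gr_sum)
    fix i assume "i \<in> {0..k}"
    then have "int (m + n) - 2 * int k = (int m - 2 * int i) + (int n - 2 * int (k - i))" by auto
    then show "gr MinusS (int (m + n) - 2 * int k) (a $ i * b $ (k - i))"
      using a b by (simp only: gr_mult)
  qed
qed (auto intro: gr.intros)

lemma gr_dpow_int_mult:
  assumes "q \<in> \<int>" "gr \<sigma> d (dpow x i)"
  shows "gr \<sigma> d (dpow (qof q * x) i)"
proof -
  obtain n where "q = of_int n" using assms(1) by (auto elim: Ints_cases)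
  then have "dpow (qof q * x) i = of_int (n ^ i) * dpow x i"
    by (simp add: dpow_of_int_mult)
  then show ?thesis using gr_of_int_mult[OF assms(2), of "n ^ i"] by simp
qed

lemma dpow_grP:
  assumes "q \<in> \<int>" "gr PlusS (d * int i) (dpow x i)" "2 * int e = int n + d" "e \<le> n"
  shows "dpow (fps_const (qof q * x) * fps_X ^ e) i \<in> grP (n * i)"
proof -
  have "2 * int (e * i) - int (n * i) = (2 * int e - int n) * int i"
    by (simp add: algebra_simps)
  then have "2 * int (e * i) - int (n * i) = d * int i"
    by (simp add: assms(3))
  then show ?thesis
    using gr_dpow_int_mult[OF assms(1,2)] assms(4)
    unfolding dpow_const_X_power grP_def mem_Collect_eq const_X_power_nth
    by (auto intro: gr_0)
qed

lemma dpow_grM: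
  assumes "q \<in> \<int>" "gr MinusS (d * int i) (dpow x i)" "2 * int e = int n - d"
  shows "dpow (fps_const (qof q * x) * fps_X ^ e) i \<in> grM (n * i)"
proof -
  have "int (n * i) - 2 * int (e * i) = (int n - 2 * int e) * int i"
    by (simp add: algebra_simps)
  then have "int (n * i) - 2 * int (e * i) = d * int i"
    by (simp add: assms(3))
  then show ?thesis
    using gr_dpow_int_mult[OF assms(1,2)]
    unfolding dpow_const_X_power grM_def mem_Collect_eq const_X_power_nth
    by (auto intro: gr_0)
qed

lemma cur_varu_nth: "cur varu p f $ n
    = (if odd n then fps_const (qof (f $ (n div 2)) * p (n div 2)) * fps_X ^ Suc (n div 2) else 0)"
  unfolding cur_def by (rule fps_ext) (auto simp: varu_nth diag_nth ser_nth simp del: power_Suc elim!: oddE)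

lemma cur_varv_nth: "cur varv p f $ n
    = (if odd n then fps_const (qof (f $ (n div 2)) * p (n div 2)) * fps_X ^ (n div 2) else 0)"
  unfolding cur_def by (rule fps_ext) (auto simp: varv_nth diag_nth ser_nth elim!: oddE)

lemma cur_varu2_nth: "cur (varu * varu) p f $ n
    = (if even n \<and> 0 < n then fps_const (qof (f $ (n div 2 - 1)) * p (n div 2 - 1)) * fps_X ^ Suc (n div 2) else 0)"
proof (cases "even n")
  case True
  then show ?thesis
    unfolding cur_def mult.assoc
    by (intro fps_ext) (auto simp: varu_nth diag_nth ser_nth simp del: power_Suc elim!: evenE)
next
  case False
  then obtain m where "n = 2 * m + 1" by (rule oddE)
  then show ?thesis
    unfolding cur_def mult.assoc by (intro fps_ext) (auto simp: varu_nth diag_nth; presburger)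
qed

lemma cur_varv2_nth: "cur (varv * varv) p f $ n
    = (if even n \<and> 0 < n then fps_const (qof (f $ (n div 2 - 1)) * p (n div 2 - 1)) * fps_X ^ (n div 2 - 1) else 0)"
proof (cases "even n")
  case True
  then show ?thesis
    unfolding cur_def mult.assoc
    by (intro fps_ext) (auto simp: varv_nth diag_nth ser_nth elim!: evenE)
next
  case False
  then obtain m where "n = 2 * m + 1" by (rule oddE)
  then show ?thesis
    unfolding cur_def mult.assoc by (intro fps_ext) (auto simp: varv_nth diag_nth; presburger)
qed

lemma const_X_power_commute:
  "c * d = d * c \<Longrightarrow> fps_const c * fps_X ^ i * (fps_const d * fps_X ^ j)
    = fps_const d * fps_X ^ j * (fps_const c * (fps_X ^ i :: 'a::ring_1 fps))"
  by (rule fps_commute_coeffs) simp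

lemma qof_mult_commute:
  assumes "a \<noteq> 0 \<Longrightarrow> b \<noteq> 0 \<Longrightarrow> x * y = y * (x :: 'a::rat_algebra)"
  shows "qof a * x * (qof b * y) = qof b * y * (qof a * x)"
  using assms by (cases "a = 0 \<or> b = 0") (auto simp: qof_mult_qof_mult intro: qof_left_commute)

lemma zero_dpow_mem: "graded_family K \<Longrightarrow> dpow 0 i \<in> K (n * i)"
  using graded_familyD[of K] by (auto simp: dpow_0_left)

lemma fexp_cur_grP:
  assumes f: "int_series f" and comm: "\<And>i j. f $ i \<noteq> 0 \<Longrightarrow> f $ j \<noteq> 0 \<Longrightarrow> xplus r s i * xplus r s j = xplus r s j * xplus r s i"
  shows "fexp (cur varu (xplus r s) f) $ n \<in> grP n"
proof (rule fexp_graded[OF graded_family_grP])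
  fix i j
  show "cur varu (xplus r s) f $ i * cur varu (xplus r s) f $ j = cur varu (xplus r s) f $ j * cur varu (xplus r s) f $ i"
    unfolding cur_varu_nth using comm by (auto intro!: const_X_power_commute qof_mult_commute simp del: power_Suc)
  show "dpow (cur varu (xplus r s) f $ i) j \<in> grP (i * j)"
  proof (cases "odd i")
    case True
    have "dpow (fps_const (qof (f $ (i div 2)) * xplus r s (i div 2)) * fps_X ^ Suc (i div 2)) j \<in> grP (i * j)"
      by (rule dpow_grP[where d = 1]) (use f True in \<open>auto simp: coeffs_in_def xplus_def gr_x elim!: oddE\<close>)
    then show ?thesis unfolding cur_varu_nth using True by simp
  qed (simp add: cur_varu_nth zero_dpow_mem[OF graded_family_grP])
qed simp

lemma fexp_cur_grM:
  assumes f: "int_series f" and comm: "\<And>i j. f $ i \<noteq> 0 \<Longrightarrow> f $ j \<noteq> 0 \<Longrightarrow> xminus r s i * xminus r s j = xminus r s j * xminus r s i"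
  shows "fexp (cur varv (xminus r s) f) $ n \<in> grM n"
proof (rule fexp_graded[OF graded_family_grM])
  fix i j
  show "cur varv (xminus r s) f $ i * cur varv (xminus r s) f $ j = cur varv (xminus r s) f $ j * cur varv (xminus r s) f $ i"
    unfolding cur_varv_nth using comm by (auto intro!: const_X_power_commute qof_mult_commute)
  show "dpow (cur varv (xminus r s) f $ i) j \<in> grM (i * j)"
  proof (cases "odd i")
    case True
    have "dpow (fps_const (qof (f $ (i div 2)) * xminus r s (i div 2)) * fps_X ^ (i div 2)) j \<in> grM (i * j)"
      by (rule dpow_grM[where d = 1]) (use f True in \<open>auto simp: coeffs_in_def xminus_def gr_x elim!: oddE\<close>)
    then show ?thesis unfolding cur_varv_nth using True by simp
  qed (simp add: cur_varv_nth zero_dpow_mem[OF graded_family_grM])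
qed simp

lemma gr_dpow_of_int_X: "odd m \<Longrightarrow> gr \<sigma> (2 * int k) (dpow (of_int n * X_el \<sigma> m) k)"
  unfolding dpow_of_int_mult by (rule gr_of_int_mult[OF gr_X])

lemma fexp_cur_grP2:
  assumes f: "int_series f" "parity False f" and odd: "odd (r + s)"
  shows "fexp (cur (varu * varu) (Xplus r s) f) $ n \<in> grP n"
proof (rule fexp_graded[OF graded_family_grP])
  interpret odd_currents "xplus r s" "xminus r s" "hh r s" "Xplus r s" "Xminus r s"
    by (rule odd_currents[OF odd])
  fix i j
  have "Xplus r s a * Xplus r s b = Xplus r s b * Xplus r s a" if "f $ a \<noteq> 0" "f $ b \<noteq> 0" for a b
    using that f(2) Xp_Xp by (auto simp: parity_def)
  then show "cur (varu * varu) (Xplus r s) f $ i * cur (varu * varu) (Xplus r s) f $ j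
      = cur (varu * varu) (Xplus r s) f $ j * cur (varu * varu) (Xplus r s) f $ i"
    unfolding cur_varu2_nth by (auto intro!: const_X_power_commute qof_mult_commute simp del: power_Suc)
  show "dpow (cur (varu * varu) (Xplus r s) f $ i) j \<in> grP (i * j)"
  proof (cases "even i \<and> 0 < i \<and> f $ (i div 2 - 1) \<noteq> 0")
    case True
    then have "odd (2 * r + (r + s) * int (i div 2 - 1))" using f(2) odd by (auto simp: parity_def)
    then have "gr PlusS (2 * int j) (dpow (Xplus r s (i div 2 - 1)) j)"
      unfolding Xplus_def by (rule gr_dpow_of_int_X)
    then have "dpow (fps_const (qof (f $ (i div 2 - 1)) * Xplus r s (i div 2 - 1)) * fps_X ^ Suc (i div 2)) j \<in> grP (i * j)"
      by (intro dpow_grP[where d = 2]) (use f(1) True in \<open>auto simp: coeffs_in_def elim!: evenE\<close>)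
    then show ?thesis unfolding cur_varu2_nth using True by simp
  next
    case False
    then have "cur (varu * varu) (Xplus r s) f $ i = 0" by (auto simp: cur_varu2_nth)
    then show ?thesis by (simp add: zero_dpow_mem[OF graded_family_grP])
  qed
qed simp

lemma fexp_cur_grM2:
  assumes f: "int_series f" "parity False f" and odd: "odd (r + s)"
  shows "fexp (cur (varv * varv) (Xminus r s) f) $ n \<in> grM n"
proof (rule fexp_graded[OF graded_family_grM])
  interpret odd_currents "xplus r s" "xminus r s" "hh r s" "Xplus r s" "Xminus r s"
    by (rule odd_currents[OF odd])
  fix i j
  have "Xminus r s a * Xminus r s b = Xminus r s b * Xminus r s a" if "f $ a \<noteq> 0" "f $ b \<noteq> 0" for a b
    using that f(2) Xm_Xm by (auto simp: parity_def)
  then show "cur (varv * varv) (Xminus r s) f $ i * cur (varv * varv) (Xminus r s) f $ j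
      = cur (varv * varv) (Xminus r s) f $ j * cur (varv * varv) (Xminus r s) f $ i"
    unfolding cur_varv2_nth by (auto intro!: const_X_power_commute qof_mult_commute)
  show "dpow (cur (varv * varv) (Xminus r s) f $ i) j \<in> grM (i * j)"
  proof (cases "even i \<and> 0 < i \<and> f $ (i div 2 - 1) \<noteq> 0")
    case True
    then have "odd (2 * s + (r + s) * int (i div 2 - 1))" using f(2) odd by (auto simp: parity_def)
    then have "gr MinusS (2 * int j) (dpow (Xminus r s (i div 2 - 1)) j)"
      unfolding Xminus_def by (rule gr_dpow_of_int_X)
    then have "dpow (fps_const (qof (f $ (i div 2 - 1)) * Xminus r s (i div 2 - 1)) * fps_X ^ (i div 2 - 1)) j \<in> grM (i * j)"
      by (intro dpow_grM[where d = 2]) (use f(1) True in \<open>auto simp: coeffs_in_def elim!: evenE\<close>)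
    then show ?thesis unfolding cur_varv2_nth using True by simp
  next
    case False
    then have "cur (varv * varv) (Xminus r s) f $ i = 0" by (auto simp: cur_varv2_nth)
    then show ?thesis by (simp add: zero_dpow_mem[OF graded_family_grM])
  qed
qed simp

subsection \<open>Straightening of two divided powers\<close>

definition eta :: "int \<Rightarrow> int \<Rightarrow> rat fps"
  where "eta r s = (if even (r + s) then eta_even else eta_odd0 + eta_odd1)"

text \<open>The Cartan factor of the straightening formula as a series in the single variable
  uv.\<close>

definition Hser :: "int \<Rightarrow> int \<Rightarrow> uea fps"
  where "Hser r s = fexp (ser (eta r s) (hh r s))"

lemma graded_family_fps_mult:
  assumes K: "graded_family K" and f: "\<And>n. f $ n \<in> K n" and g: "\<And>n. g $ n \<in> K n"
  shows "(f * g) $ n \<in> K n"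
  unfolding fps_mult_nth
proof (rule graded_family_sum[OF K])
  fix i assume "i \<in> {0..n}"
  then show "f $ i * g $ (n - i) \<in> K n"
    using graded_familyD(5)[OF K f[of i] g[of "n - i"]] by simp
qed

lemma int_series_minus: "int_series f \<Longrightarrow> int_series (- f)"
  by (simp add: int_series_closed)

text \<open>Joins the two parities. The inverses are as integral as the factors, being products of
  exponentials of the negated currents; they serve to solve the formula for the Cartan
  factor.\<close>

lemma straightening_factors:
  obtains M M' P P' :: "uea fps fps"
  where "\<And>n. M $ n \<in> grM n" "\<And>n. M' $ n \<in> grM n" "\<And>n. P $ n \<in> grP n" "\<And>n. P' $ n \<in> grP n"
    "M' * M = 1" "P * P' = 1"
    "fexp (cur varu (xplus r s) 1) * fexp (cur varv (xminus r s) 1) = M * diag (Hser r s) * P"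
proof (cases "even (r + s)")
  case True
  interpret even_currents "xplus r s" "xminus r s" "hh r s" by (rule even_currents[OF True])
  have H: "diag (Hser r s) = fexp (cur 1 (hh r s) eta_even)"
    using True by (simp add: Hser_def eta_def diag_fexp ser_nth cur_def)
  show ?thesis
  proof (rule that[of "fexp (cur varv (xminus r s) b_even)" "fexp (- cur varv (xminus r s) b_even)"
        "fexp (cur varu (xplus r s) b_even)" "fexp (- cur varu (xplus r s) b_even)"])
    show "fexp (cur varu (xplus r s) 1) * fexp (cur varv (xminus r s) 1)
      = fexp (cur varv (xminus r s) b_even) * diag (Hser r s) * fexp (cur varu (xplus r s) b_even)"
      unfolding H by (rule straightening)
        (simp_all add: XD_b_even XD_eta_even fexp_minus_2_eta_even)
    note int = int_series_b_even int_series_minus[OF int_series_b_even]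
    show "fexp (cur varv (xminus r s) b_even) $ n \<in> grM n" "fexp (cur varu (xplus r s) b_even) $ n \<in> grP n" for n
      by (rule fexp_cur_grM fexp_cur_grP; simp add: int xm_xm xp_xp)+
    show "fexp (- cur varv (xminus r s) b_even) $ n \<in> grM n" "fexp (- cur varu (xplus r s) b_even) $ n \<in> grP n" for n
      unfolding cur_minus[symmetric] by (rule fexp_cur_grM fexp_cur_grP; simp add: int xm_xm xp_xp)+
  qed (simp_all add: fexp_uminus)
next
  case False
  interpret odd_currents "xplus r s" "xminus r s" "hh r s" "Xplus r s" "Xminus r s"
    by (rule odd_currents[OF False])
  let ?M0 = "cur varv (xminus r s) b_odd0" and ?M1 = "cur varv (xminus r s) b_odd1"
    and ?M2 = "cur (varv * varv) (Xminus r s) y_minus"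
  let ?P0 = "cur varu (xplus r s) b_odd0" and ?P1 = "cur varu (xplus r s) b_odd1"
    and ?P2 = "cur (varu * varu) (Xplus r s) y_plus"
  have H: "diag (Hser r s) = fexp (cur 1 (hh r s) (eta_odd0 + eta_odd1))"
    using False by (simp add: Hser_def eta_def diag_fexp ser_nth cur_def)
  note int = int_series_odd int_series_odd[THEN int_series_minus]
  note par = parity_odd_series parity_odd_series[THEN parity_minus]
  have xm: "xminus r s i * xminus r s j = xminus r s j * xminus r s i"
      and xp: "xplus r s i * xplus r s j = xplus r s j * xplus r s i"
    if "parity d f" "f $ i \<noteq> 0" "f $ j \<noteq> 0" for d f i j
    using that xm_xm_even[of i j] xp_xp_even[of i j] by (auto simp: parity_def)
  have M: "fexp (cur varv (xminus r s) f) $ n \<in> grM n" if "int_series f" "parity d f" for d f n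
    using that xm by (intro fexp_cur_grM) blast+
  have P: "fexp (cur varu (xplus r s) f) $ n \<in> grP n" if "int_series f" "parity d f" for d f n
    using that xp by (intro fexp_cur_grP) blast+
  note M2 = fexp_cur_grM2[OF _ _ False] and P2 = fexp_cur_grP2[OF _ _ False]
  note gM = graded_family_fps_mult[OF graded_family_grM] and gP = graded_family_fps_mult[OF graded_family_grP]
  have z: "?M0 $ 0 = 0" "?M1 $ 0 = 0" "?M2 $ 0 = 0" "?P0 $ 0 = 0" "?P1 $ 0 = 0" "?P2 $ 0 = 0"
    by simp_all
  have inv: "fexp (- c) * fexp (- b) * fexp (- a) * (fexp a * fexp b * fexp c) = 1"
      "fexp a * fexp b * fexp c * (fexp (- c) * fexp (- b) * fexp (- a)) = 1"
    if "a $ 0 = 0" "b $ 0 = 0" "c $ 0 = 0" for a b c :: "uea fps fps"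
  proof -
    have "fexp (- c) * fexp (- b) * fexp (- a) * (fexp a * fexp b * fexp c)
        = fexp (- c) * (fexp (- b) * (fexp (- a) * fexp a) * fexp b) * fexp c"
      by (simp only: mult.assoc)
    then show "fexp (- c) * fexp (- b) * fexp (- a) * (fexp a * fexp b * fexp c) = 1"
      by (simp add: fexp_uminus(2) that)
    have "fexp a * fexp b * fexp c * (fexp (- c) * fexp (- b) * fexp (- a))
        = fexp a * (fexp b * (fexp c * fexp (- c)) * fexp (- b)) * fexp (- a)"
      by (simp only: mult.assoc)
    then show "fexp a * fexp b * fexp c * (fexp (- c) * fexp (- b) * fexp (- a)) = 1"
      by (simp add: fexp_uminus(1) that)
  qed
  show ?thesis
  proof (rule that[of "fexp ?M0 * fexp ?M1 * fexp ?M2" "fexp (- ?M2) * fexp (- ?M1) * fexp (- ?M0)"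
        "fexp ?P0 * fexp ?P1 * fexp ?P2" "fexp (- ?P2) * fexp (- ?P1) * fexp (- ?P0)"])
    show "fexp (cur varu (xplus r s) 1) * fexp (cur varv (xminus r s) 1)
      = fexp ?M0 * fexp ?M1 * fexp ?M2 * diag (Hser r s) * (fexp ?P0 * fexp ?P1 * fexp ?P2)"
      unfolding H by (rule straightening)
        (simp_all only: parity_odd_series parity_eta_odd b_odd_nth_0 eta_odd_nth_0 XD_b_odd0 XD_b_odd1
          XD_y_minus XD_y_plus XD_eta_odd fexp_eta_odd)
    show "(fexp ?M0 * fexp ?M1 * fexp ?M2) $ n \<in> grM n" for n
      by (intro gM M[OF int(1) par(1)] M[OF int(2) par(2)] M2[OF int(3) par(3)])
    show "(fexp ?P0 * fexp ?P1 * fexp ?P2) $ n \<in> grP n" for n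
      by (intro gP P[OF int(1) par(1)] P[OF int(2) par(2)] P2[OF int(4) par(4)])
    show "(fexp (- ?M2) * fexp (- ?M1) * fexp (- ?M0)) $ n \<in> grM n" for n
      unfolding cur_minus[symmetric] by (intro gM M[OF int(5) par(5)] M[OF int(6) par(6)] M2[OF int(7) par(7)])
    show "(fexp (- ?P2) * fexp (- ?P1) * fexp (- ?P0)) $ n \<in> grP n" for n
      unfolding cur_minus[symmetric] by (intro gP P[OF int(5) par(5)] P[OF int(6) par(6)] P2[OF int(8) par(8)])
  qed (rule inv; simp)+
qed

lemma fexp_X_const_nth: "fexp (fps_X * fps_const a) $ n = dpow a n"
proof -
  have "fps_X * fps_const a = fps_const a * (fps_X ^ 1 :: 'a fps)"
    by (simp add: fps_mult_fps_X_commute)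
  then have "fexp (fps_X * fps_const a) $ n = (\<Sum>k\<le>n. if n = k then dpow a k else 0)"
    unfolding fexp_def fsum_def fps_nth_Abs_fps
    by (intro sum.cong) (auto simp only: dpow_const_X_power const_X_power_nth mult_1)
  then show ?thesis by simp
qed

text \<open>With u = s w and v = s, the coefficient of s^n w^k belongs to u^k v^(n-k).\<close>

lemma straightening_lhs_nth:
  "(fexp (cur varu (xplus r s) 1) * fexp (cur varv (xminus r s) 1)) $ n $ k
    = (if k \<le> n then dpow (x_el PlusS r) k * dpow (x_el MinusS s) (n - k) else 0)"
proof -
  have "cur varu (xplus r s) 1 = fps_X * fps_const (fps_const (x_el PlusS r) * fps_X)"
    by (rule fps_ext) (auto simp: cur_varu_nth xplus_def fps_X_def elim!: oddE)
  then have u: "fexp (cur varu (xplus r s) 1) $ i = fps_const (dpow (x_el PlusS r) i) * fps_X ^ i" for i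
    using dpow_const_X_power[of "x_el PlusS r" 1 i] by (simp add: fexp_X_const_nth)
  have "cur varv (xminus r s) 1 = fps_X * fps_const (fps_const (x_el MinusS s))"
    by (rule fps_ext) (auto simp: cur_varv_nth xminus_def fps_X_def elim!: oddE)
  then have v: "fexp (cur varv (xminus r s) 1) $ i = fps_const (dpow (x_el MinusS s) i)" for i
    using dpow_const_X_power[of "x_el MinusS s" 0 i] by (simp add: fexp_X_const_nth)
  have "(fps_const a * fps_X ^ i * fps_const b) $ k = (if k = i then a * b else 0)" for a b :: uea and i
    by simp
  then show ?thesis
    by (simp add: fps_mult_nth[of "fexp _"] fps_sum_nth u v cong: if_cong)
qed

lemma int_span_sum: "(\<And>x. x \<in> A \<Longrightarrow> f x \<in> int_span S) \<Longrightarrow> sum f A \<in> int_span S"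
  by (rule int_module.span_sum)

text \<open>Degree bounds instead of degrees: crossing lowers the two degrees by a common amount,
  and the induction for termination needs only that they do not grow.\<close>

definition tri :: "uea set \<Rightarrow> int \<Rightarrow> int \<Rightarrow> uea set"
  where "tri H l k = int_span {a * h * d | a h d. h \<in> H \<and>
    (\<exists>l' k'. l' \<le> l \<and> k' \<le> k \<and> gr MinusS l' a \<and> gr PlusS k' d)}"

lemma triI: "h \<in> H \<Longrightarrow> gr MinusS l' a \<Longrightarrow> gr PlusS k' d \<Longrightarrow> l' \<le> l \<Longrightarrow> k' \<le> k \<Longrightarrow> a * h * d \<in> tri H l k"
  unfolding tri_def by (rule int_module.span_base) blast

text \<open>The coefficient of u^k v^l in the straightening formula.\<close>

theorem dpow_swap:
  assumes H: "\<And>j. Hser r s $ j \<in> H"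
  shows "dpow (x_el PlusS r) k * dpow (x_el MinusS s) l \<in> tri H (int l) (int k)"
proof -
  obtain M M' P P' :: "uea fps fps" where M: "\<And>n. M $ n \<in> grM n" and "\<And>n. M' $ n \<in> grM n"
    and P: "\<And>n. P $ n \<in> grP n" and "\<And>n. P' $ n \<in> grP n" "M' * M = 1" "P * P' = 1"
    and eq: "fexp (cur varu (xplus r s) 1) * fexp (cur varv (xminus r s) 1) = M * diag (Hser r s) * P"
    by (rule straightening_factors[where r = r and s = s]) (rule that; blast)
  have zero: "0 \<in> tri H l' k'" for l' k'
    unfolding tri_def by (rule int_module.span_zero)
  have "dpow (x_el PlusS r) k * dpow (x_el MinusS s) l
      = (fexp (cur varu (xplus r s) 1) * fexp (cur varv (xminus r s) 1)) $ (k + l) $ k"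
    by (simp add: straightening_lhs_nth)
  also have "\<dots> = (\<Sum>i=0..k + l. \<Sum>p=0..k. \<Sum>j=0..i. \<Sum>q=0..p.
      M $ j $ q * diag (Hser r s) $ (i - j) $ (p - q) * P $ (k + l - i) $ (k - p))"
    unfolding eq by (simp add: fps_mult_nth fps_sum_nth sum_distrib_right) (subst sum.swap, simp)
  also have "\<dots> \<in> tri H (int l) (int k)"
    unfolding tri_def
  proof (intro int_span_sum, fold tri_def)
    fix i p j q assume i: "i \<in> {0..k + l}" and p: "p \<in> {0..k}" and j: "j \<in> {0..i}" and q: "q \<in> {0..p}"
    show "M $ j $ q * diag (Hser r s) $ (i - j) $ (p - q) * P $ (k + l - i) $ (k - p) \<in> tri H (int l) (int k)"
    \<comment> \<open>The Cartan factor lives on powers of uv, and P has no negative power of v; all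
      other terms vanish.\<close>
    proof (cases "i - j = 2 * (p - q) \<and> k - p \<le> k + l - i")
      case True
      have "M $ j $ q * Hser r s $ (p - q) * P $ (k + l - i) $ (k - p) \<in> tri H (int l) (int k)"
      proof (rule triI[OF H])
        show "gr MinusS (int j - 2 * int q) (M $ j $ q)" using M[of j] by (simp add: grM_def)
        show "gr PlusS (2 * int (k - p) - int (k + l - i)) (P $ (k + l - i) $ (k - p))"
          using P[of "k + l - i"] by (simp add: grP_def)
      qed (use True i p j q in auto)
      then show ?thesis using True by (simp add: diag_nth)
    next
      case False
      then have "diag (Hser r s) $ (i - j) $ (p - q) = 0 \<or> P $ (k + l - i) $ (k - p) = 0"
        using P[of "k + l - i"] by (auto simp: diag_nth grP_def)
      then show ?thesis using zero by auto
    qed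
  qed
  finally show ?thesis .
qed

lemma gr_in_subring:
  assumes R: "is_subring R" and x: "\<And>r k. dpow (x_el \<sigma> r) k \<in> R"
  shows "gr \<sigma> d a \<Longrightarrow> a \<in> R"
  by (induction rule: gr.induct) (auto intro: is_subringD[OF R] x)

text \<open>The nilpotent factors have integral inverses, so the Cartan factor is M' F P', where the
  coefficients of F are products of two divided powers.\<close>

theorem Hser_in_subring:
  assumes R: "is_subring R" and x: "\<And>\<sigma> r k. dpow (x_el \<sigma> r) k \<in> R"
  shows "Hser r s $ j \<in> R"
proof -
  obtain M M' P P' :: "uea fps fps" where "\<And>n. M $ n \<in> grM n" and M': "\<And>n. M' $ n \<in> grM n"
    and "\<And>n. P $ n \<in> grP n" and P': "\<And>n. P' $ n \<in> grP n"
    and inv: "M' * M = 1" "P * P' = 1"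
    and eq: "fexp (cur varu (xplus r s) 1) * fexp (cur varv (xminus r s) 1) = M * diag (Hser r s) * P"
    by (rule straightening_factors[where r = r and s = s]) (rule that; blast)
  let ?F = "fexp (cur varu (xplus r s) 1) * fexp (cur varv (xminus r s) 1)"
  let ?R = "{g. coeffs_in R g}"
  have R': "is_subring ?R" by (rule is_subring_coeffs_in[OF R])
  have "M' * ?F * P' = (M' * M) * diag (Hser r s) * (P * P')"
    unfolding eq by (simp only: mult.assoc)
  also have "\<dots> = diag (Hser r s)" by (simp add: inv)
  finally have D: "diag (Hser r s) = M' * ?F * P'" ..
  have "coeffs_in ?R M'" "coeffs_in ?R P'"
    using M' P' gr_in_subring[OF R x] unfolding coeffs_in_def grM_def grP_def by blast+
  moreover have "coeffs_in ?R ?F"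
    using is_subringD[OF R] x by (simp add: coeffs_in_def straightening_lhs_nth)
  ultimately have "coeffs_in ?R (diag (Hser r s))"
    unfolding D by (intro coeffs_in_closed(6)[OF R', of "M' * ?F" P'] coeffs_in_closed(6)[OF R', of M' ?F])
  then have "diag (Hser r s) $ (2 * j) $ j \<in> R" by (simp add: coeffs_in_def)
  then show ?thesis by (simp add: diag_nth)
qed

subsection \<open>Ghost sequences\<close>

text \<open>A sequence of power sums \<open>p r = \<Sum> x\<^sup>r\<close> has \<open>W p = \<Prod> (1 - x u)\<close>.\<close>

definition Wlog :: "(nat \<Rightarrow> 'a::rat_algebra) \<Rightarrow> 'a fps"
  where "Wlog p = Abs_fps (\<lambda>n. if n = 0 then 0 else qof (- 1 / of_nat n) * p n)"

definition W :: "(nat \<Rightarrow> 'a::rat_algebra) \<Rightarrow> 'a fps"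
  where "W p = fexp (Wlog p)"

lemma of_nat_mult_qof_inverse:
  assumes "0 < n"
  shows "of_nat n * (qof (1 / of_nat n) * x) = (x :: 'a::rat_algebra)"
proof -
  have "of_nat n * (qof (1 / of_nat n) * x) = qof (of_nat n * (1 / of_nat n)) * x"
    by (simp only: qof_mult qof_of_nat mult.assoc)
  then show ?thesis using assms by simp
qed

lemma Wlog_nth: "Wlog p $ n = (if n = 0 then 0 else qof (- 1 / of_nat n) * p n)"
  by (simp add: Wlog_def)

lemma W_nth_0 [simp]: "W p $ 0 = 1"
  by (simp add: W_def)

text \<open>Up to degree m only the linear term of the exponential contributes, since the square of
  B already has order greater than m.\<close>

lemma fexp_leading:
  fixes B :: "'a::rat_algebra fps"
  assumes "ord_ge B m" "0 < i" "i \<le> m"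
  shows "fexp B $ i = B $ i"
proof -
  have m: "0 < m" using assms by simp
  have B0: "B $ 0 = 0" using assms(1) m by (auto simp: ord_ge_def)
  have "dpow B k $ i = 0" if "k \<noteq> 1" for k
  proof (cases "k = 0")
    case False
    then have "k = Suc (Suc (k - 2))" using that by simp
    then obtain k' where k: "k = Suc (Suc k')" by blast
    have "ord_ge (dpow B (Suc k')) 1"
      using ord_ge_dpow[OF B0, of "Suc k'"] by (auto simp: ord_ge_def)
    then have "ord_ge (B * dpow B (Suc k')) (m + 1)" by (rule ord_ge_mult[OF assms(1)])
    then have "(B * dpow B (Suc k')) $ i = 0" using assms(3) by (auto simp: ord_ge_def)
    then have "of_nat k * dpow B k $ i = 0"
      using dpow_Suc[of "Suc k'" B] qof_mult_nth[of "of_nat k" "dpow B k" i]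
      by (simp only: qof_of_nat k)
    then show ?thesis using of_nat_mult_cancel[of k "dpow B k $ i" 0] k by simp
  qed (use assms in simp)
  then have "fexp B $ i = (\<Sum>k\<le>i. if k = 1 then B $ i else 0)"
    unfolding fexp_def fsum_def fps_nth_Abs_fps by (intro sum.cong) auto
  then show ?thesis using assms(2) by simp
qed

text \<open>The power sums of the k-th roots of a, with series 1 - a u^k (\<open>W_Teich\<close>);
  in the language of Witt vectors, the ghost components of a shifted Teichmueller
  representative.\<close>

definition Teich :: "nat \<Rightarrow> 'a::rat_algebra \<Rightarrow> nat \<Rightarrow> 'a"
  where "Teich k a r = (if k dvd r then of_nat k * a ^ (r div k) else 0)"

lemma Teich_eq_0: "0 < r \<Longrightarrow> r < k \<Longrightarrow> Teich k a r = 0"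
  by (auto simp: Teich_def dest: dvd_imp_le)

text \<open>\<open>W\<close> turns sums into products only for commuting sequences, whereas
  \<open>uea\<close> is noncommutative. C is an ambient commutative subalgebra over the rationals,
  in which the integral subrings R live.\<close>

locale commuting_subalgebra =
  fixes C :: "'a::rat_algebra set"
  assumes C: "is_subring C" and C_comm: "a \<in> C \<Longrightarrow> b \<in> C \<Longrightarrow> a * b = b * a"
    and C_qof: "a \<in> C \<Longrightarrow> qof q * a \<in> C"
begin

lemmas C_closed = is_subringD[OF C]

lemma Wlog_comm: "(\<And>r. p r \<in> C) \<Longrightarrow> (\<And>r. q r \<in> C) \<Longrightarrow> Wlog p * Wlog q = Wlog q * Wlog p"
  by (rule fps_commute_coeffs) (auto simp: Wlog_nth intro!: C_comm C_qof)

lemma W_add: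
  assumes "\<And>r. p r \<in> C" "\<And>r. q r \<in> C"
  shows "W (\<lambda>r. p r + q r) = W p * W q"
proof -
  have "Wlog (\<lambda>r. p r + q r) = Wlog p + Wlog q"
    by (rule fps_ext) (simp add: Wlog_nth distrib_left)
  then show ?thesis
    using fexp_add[of "Wlog p" "Wlog q"] Wlog_comm[OF assms] by (simp add: W_def Wlog_nth)
qed

text \<open>\<open>W p\<close> is \<open>W q\<close> times the series of p - q, which begins with 1
  - (p k - q k)/k u^k.\<close>

lemma W_diff:
  assumes p: "\<And>r. p r \<in> C" and q: "\<And>r. q r \<in> C" and eq: "\<And>r. 0 < r \<Longrightarrow> r < k \<Longrightarrow> p r = q r" and k: "0 < k"
  shows "W p $ k - W q $ k = qof (- 1 / of_nat k) * (p k - q k)" "\<And>i. i < k \<Longrightarrow> W p $ i = W q $ i"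
proof -
  define d where "d r = p r - q r" for r
  have d: "d r \<in> C" for r using p q by (auto simp: d_def intro: C_closed)
  have "W p = W (\<lambda>r. d r + q r)" by (simp add: d_def)
  also have "\<dots> = W d * W q" by (rule W_add[OF d q])
  finally have "W p $ i = W q $ i + (\<Sum>j=1..i. W d $ j * W q $ (i - j))" for i
    by (simp add: fps_mult_nth sum.atLeast_Suc_atMost)
  moreover have "ord_ge (Wlog d) k" using eq by (auto simp: ord_ge_def Wlog_nth d_def)
  then have Wd: "W d $ j = Wlog d $ j" if "0 < j" "j \<le> k" for j
    unfolding W_def using that by (rule fexp_leading)
  have "W d $ j = 0" if "0 < j" "j < k" for j
    using Wd[of j] that eq[of j] by (simp add: Wlog_nth d_def)
  ultimately show "W p $ i = W q $ i" if "i < k" for i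
    using that by simp
  have "(\<Sum>j=1..k. W d $ j * W q $ (k - j)) = (\<Sum>j=1..k. if j = k then W d $ k else 0)"
    using \<open>\<And>j. 0 < j \<Longrightarrow> j < k \<Longrightarrow> W d $ j = 0\<close> by (intro sum.cong) auto
  also have "\<dots> = qof (- 1 / of_nat k) * (p k - q k)"
    using k Wd[of k] by (simp add: Wlog_nth d_def)
  finally show "W p $ k - W q $ k = qof (- 1 / of_nat k) * (p k - q k)"
    using \<open>\<And>i. W p $ i = W q $ i + (\<Sum>j=1..i. W d $ j * W q $ (i - j))\<close>[of k] by simp
qed

lemma Teich_in_C: "a \<in> C \<Longrightarrow> Teich k a r \<in> C"
  by (auto simp: Teich_def intro!: C_closed is_subring_of_nat[OF C] is_subring_power[OF C])

lemma W_Teich: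
  assumes a: "a \<in> C" and k: "0 < k"
  shows "W (Teich k a) = 1 - fps_const a * fps_X ^ k"
proof (rule XD_ode_unique)
  define Q where "Q = fps_XD (Wlog (Teich k a))"
  have Q_nth: "Q $ n = (if n = 0 then 0 else - Teich k a n)" for n
  proof (cases "n = 0")
    case False
    then have "of_nat n * (qof (- 1 / of_nat n) * x) = - (x :: 'a)" for x
      using of_nat_mult_qof_inverse[of n x] False by (simp add: qof_minus)
    then show ?thesis using False by (simp add: Q_def Wlog_nth)
  qed (simp add: Q_def)
  show "fps_XD (W (Teich k a)) = Q * W (Teich k a)"
    unfolding W_def Q_def
  proof (rule coeff_derivation_fexp[OF coeff_derivation_XD])
    show "fps_XD (Wlog (Teich k a)) * Wlog (Teich k a) = Wlog (Teich k a) * fps_XD (Wlog (Teich k a))"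
      by (rule fps_commute_coeffs)
        (auto simp: Wlog_nth intro!: C_comm C_qof Teich_in_C a C_closed(6) is_subring_of_nat[OF C])
  qed (simp add: Wlog_nth)
  show "fps_XD (1 - fps_const a * fps_X ^ k) = Q * (1 - fps_const a * fps_X ^ k)"
  proof (rule fps_ext)
    fix n
    have "(Q * (1 - fps_const a * fps_X ^ k)) $ n = Q $ n - (Q * fps_const a * fps_X ^ k) $ n"
      by (simp add: right_diff_distrib mult.assoc)
    also have "(Q * fps_const a * fps_X ^ k) $ n = (if n < k then 0 else Q $ (n - k) * a)"
      by (simp only: fps_X_power_mult_right_nth fps_mult_right_const_nth)
    \<comment> \<open>Along the multiples of k the coefficients of Q form a geometric progression,
      so all differences but the first cancel.\<close>
    also have "Q $ n - \<dots> = of_nat n * (- (if n = k then a else 0))"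
    proof (cases "k dvd n")
      case True
      then obtain j where n: "n = k * j" by blast
      show ?thesis
      proof (cases j)
        case (Suc j')
        then have "n - k = k * j'" "\<not> n < k" using n by auto
        then show ?thesis using k n Suc
          by (cases j') (auto simp: Q_nth Teich_def mult.assoc power_commutes)
      qed (use n k in \<open>simp add: Q_nth\<close>)
    next
      case False
      moreover have "\<not> k dvd n - k" if "\<not> n < k"
        using that False by (simp add: dvd_minus_self)
      ultimately show ?thesis by (auto simp: Q_nth Teich_def)
    qed
    also have "\<dots> = fps_XD (1 - fps_const a * fps_X ^ k) $ n"
      by auto
    finally show "fps_XD (1 - fps_const a * fps_X ^ k) $ n = (Q * (1 - fps_const a * fps_X ^ k)) $ n" ..
  qed
  show "Q $ 0 = 0" by (simp add: Q_nth)
qed (use k in simp)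

text \<open>The ghost sequences of big Witt vectors over R. They are closed under sums because
  \<open>W\<close> is multiplicative, and under multiplication by integral ones by
  \<open>ghosts_mult\<close>.\<close>

definition ghosts :: "'a set \<Rightarrow> (nat \<Rightarrow> 'a) set"
  where "ghosts R = {p. (\<forall>r. p r \<in> C) \<and> coeffs_in R (W p)}"

context
  fixes R :: "'a set"
  assumes R: "is_subring R" and RC: "R \<subseteq> C"
begin

lemma ghosts_add: "p \<in> ghosts R \<Longrightarrow> q \<in> ghosts R \<Longrightarrow> (\<lambda>r. p r + q r) \<in> ghosts R"
  unfolding ghosts_def by (auto simp: W_add C_closed coeffs_in_closed[OF R])

lemma W_zero: "W (\<lambda>r. 0) = (1 :: 'a fps)"
proof -
  have "Wlog (\<lambda>r. 0) = (0 :: 'a fps)" by (rule fps_ext) (simp add: Wlog_nth)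
  then show ?thesis by (simp add: W_def)
qed

lemma ghosts_zero: "(\<lambda>r. 0) \<in> ghosts R"
  unfolding ghosts_def by (auto simp: W_zero C_closed coeffs_in_closed[OF R])

lemma ghosts_minus:
  assumes "p \<in> ghosts R" shows "(\<lambda>r. - p r) \<in> ghosts R"
proof -
  have p: "p r \<in> C" and Wp: "coeffs_in R (W p)" for r using assms by (auto simp: ghosts_def)
  have "W p * W (\<lambda>r. - p r) = W (\<lambda>r. p r + - p r)"
    by (rule W_add[symmetric]) (auto intro: p C_closed)
  then have "W p * W (\<lambda>r. - p r) = 1" by (simp add: W_zero)
  from coeffs_in_inverse[OF R Wp W_nth_0 this] have "coeffs_in R (W (\<lambda>r. - p r))" .
  then show ?thesis by (auto simp: ghosts_def intro: p C_closed)
qed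

lemma ghosts_sum:
  "finite A \<Longrightarrow> (\<And>x. x \<in> A \<Longrightarrow> f x \<in> ghosts R) \<Longrightarrow> (\<lambda>r. \<Sum>x\<in>A. f x r) \<in> ghosts R"
  by (induction A rule: finite_induct) (auto intro: ghosts_zero ghosts_add)

lemma ghosts_of_nat_mult: "p \<in> ghosts R \<Longrightarrow> (\<lambda>r. of_nat n * p r) \<in> ghosts R"
  using ghosts_sum[of "{..<n}" "\<lambda>_. p"] by simp

lemma ghosts_Teich: "a \<in> R \<Longrightarrow> 0 < k \<Longrightarrow> Teich k a \<in> ghosts R"
  using RC is_subringD[OF R] unfolding ghosts_def
  by (auto simp: W_Teich subset_iff intro!: Teich_in_C)
    (auto simp: coeffs_in_def)

text \<open>Existence of Witt components. Once p is matched up to N, the defect of coefficient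
  \<open>Suc N\<close> of the series lies in R and is the next component: it changes the ghost at
  \<open>Suc N\<close> by \<open>Suc N\<close> times itself and no earlier one.\<close>

lemma Dwork:
  assumes p: "\<And>r. p r \<in> C" and Wp: "\<And>n. n \<le> N \<Longrightarrow> W p $ n \<in> R"
  shows "\<exists>a. (\<forall>k. a k \<in> R) \<and> (\<forall>r. 0 < r \<longrightarrow> r \<le> N \<longrightarrow> p r = (\<Sum>k=1..N. Teich k (a k) r))"
proof -
  show ?thesis
    using Wp
  proof (induction N)
    case 0
    show ?case using is_subringD[OF R] by auto
  next
    case (Suc N)
    then obtain a where a: "\<And>k. a k \<in> R" and eq: "\<And>r. 0 < r \<Longrightarrow> r \<le> N \<Longrightarrow> p r = (\<Sum>k=1..N. Teich k (a k) r)"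
      by (auto simp: le_Suc_eq)
    define q where "q r = (\<Sum>k=1..N. Teich k (a k) r)" for r
    have q: "q \<in> ghosts R"
      unfolding q_def by (rule ghosts_sum) (auto intro: ghosts_Teich a)
    define b where "b = W q $ Suc N - W p $ Suc N"
    have b: "b \<in> R"
      using q Suc.prems[of "Suc N"] by (auto simp: b_def ghosts_def coeffs_in_def intro: is_subringD[OF R])
    have "W p $ Suc N - W q $ Suc N = qof (- 1 / of_nat (Suc N)) * (p (Suc N) - q (Suc N))"
      by (rule W_diff) (use p q eq in \<open>auto simp: ghosts_def q_def\<close>)
    moreover have "qof (- 1 / of_nat (Suc N)) = - (qof (1 / of_nat (Suc N)) :: 'a)"
      using qof_minus[of "1 / of_nat (Suc N)", where 'a = 'a] by (simp del: of_nat_Suc)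
    ultimately have "b = qof (1 / of_nat (Suc N)) * (p (Suc N) - q (Suc N))"
      unfolding b_def by (metis minus_diff_eq mult_minus_left minus_minus)
    then have "of_nat (Suc N) * b = of_nat (Suc N) * (qof (1 / of_nat (Suc N)) * (p (Suc N) - q (Suc N)))"
      by simp
    also have "\<dots> = p (Suc N) - q (Suc N)"
      by (rule of_nat_mult_qof_inverse) simp
    finally have pN: "p (Suc N) = q (Suc N) + of_nat (Suc N) * b" by (simp add: algebra_simps)
    define a' where "a' = a(Suc N := b)"
    have sum: "(\<Sum>k=1..Suc N. Teich k (a' k) r) = q r + Teich (Suc N) b r" for r
      by (simp add: q_def a'_def)
    have "p r = (\<Sum>k=1..Suc N. Teich k (a' k) r)" if "0 < r" "r \<le> Suc N" for r
    proof (cases "r = Suc N")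
      case True
      then show ?thesis unfolding sum using pN by (simp add: Teich_def del: of_nat_Suc)
    next
      case False
      then show ?thesis unfolding sum using that eq[of r] by (simp add: Teich_eq_0 q_def)
    qed
    then show ?case using a b by (intro exI[of _ a']) (auto simp: a'_def)
  qed
qed

end

end

interpretation rat_comm: commuting_subalgebra "UNIV :: rat set"
  by unfold_locales (simp_all add: is_subring_def)

abbreviation int_ghosts :: "(nat \<Rightarrow> rat) set"
  where "int_ghosts \<equiv> rat_comm.ghosts \<int>"

context commuting_subalgebra
begin

text \<open>Multiplication of Witt vectors on representatives: k l is gcd times lcm, and k and l
  both divide r exactly when the lcm does.\<close>

lemma Teich_mult:
  assumes a: "a \<in> C" and k: "0 < k" "0 < l"
  shows "qof (Teich l \<beta> r) * Teich k a r
    = of_nat (gcd k l) * Teich (lcm k l) (qof (\<beta> ^ (lcm k l div l)) * a ^ (lcm k l div k)) r"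
proof (cases "lcm k l dvd r")
  case True
  then have kl: "k dvd r" "l dvd r" by (meson dvd_lcm1 dvd_lcm2 dvd_trans)+
  let ?L = "lcm k l" and ?j = "r div lcm k l"
  have L: "0 < ?L" using k by (simp add: lcm_pos_nat)
  have r: "r = ?L * ?j" using True by simp
  have "r div i = ?L div i * ?j" if "i dvd ?L" for i
    using dvd_div_mult[OF that, of ?j] unfolding r[symmetric] by (rule sym)
  then have "r div l = ?L div l * ?j" "r div k = ?L div k * ?j"
    by (blast intro: dvd_lcm1 dvd_lcm2)+
  moreover have "of_nat l * qof b * (of_nat k * x) = of_nat (l * k) * (qof b * x)" for b and x :: 'a
    using qof_left_commute[of "qof b" "of_nat k" x] by (simp only: qof_of_nat of_nat_mult mult.assoc)
  ultimately have "qof (Teich l \<beta> r) * Teich k a r = of_nat (l * k) * (qof ((\<beta> ^ (?L div l)) ^ ?j) * (a ^ (?L div k)) ^ ?j)"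
    using kl by (simp only: Teich_def if_True qof_mult qof_of_nat power_mult)
  also have "l * k = gcd k l * ?L" using prod_gcd_lcm_nat[of k l] by (simp only: mult.commute[of l k])
  also have "of_nat (gcd k l * ?L) * (qof ((\<beta> ^ (?L div l)) ^ ?j) * (a ^ (?L div k)) ^ ?j)
      = of_nat (gcd k l) * Teich ?L (qof (\<beta> ^ (?L div l)) * a ^ (?L div k)) r"
    using True power_mult_commuting[OF qof_central, of "\<beta> ^ (?L div l)" "a ^ (?L div k)" ?j]
    by (simp only: Teich_def if_True of_nat_mult mult.assoc qof_power)
  finally show ?thesis .
next
  case False
  then have "\<not> (k dvd r \<and> l dvd r)" by (simp add: lcm_least)
  then show ?thesis using False by (auto simp: Teich_def)
qed

text \<open>Integrality of Witt multiplication. Up to N both sequences are finite sums of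
  \<open>Teich\<close>, and their products stay integral by \<open>Teich_mult\<close>.\<close>

theorem ghosts_mult:
  assumes R: "is_subring R" and RC: "R \<subseteq> C" and p: "p \<in> ghosts R" and b: "b \<in> int_ghosts"
  shows "(\<lambda>r. qof (b r) * p r) \<in> ghosts R"
proof -
  have pC: "p r \<in> C" for r using p by (simp add: ghosts_def)
  have "W (\<lambda>r. qof (b r) * p r) $ N \<in> R" for N
  proof -
    have "\<exists>a. (\<forall>k. a k \<in> R) \<and> (\<forall>r. 0 < r \<longrightarrow> r \<le> N \<longrightarrow> p r = (\<Sum>k=1..N. Teich k (a k) r))"
      by (rule Dwork[OF R RC]) (use p in \<open>auto simp: ghosts_def coeffs_in_def\<close>)
    then obtain a where a: "\<And>k. a k \<in> R"
      and p_eq: "\<And>r. 0 < r \<Longrightarrow> r \<le> N \<Longrightarrow> p r = (\<Sum>k=1..N. Teich k (a k) r)"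
      by blast
    have "\<exists>\<beta>. (\<forall>k. \<beta> k \<in> \<int>) \<and> (\<forall>r. 0 < r \<longrightarrow> r \<le> N \<longrightarrow> b r = (\<Sum>k=1..N. Teich k (\<beta> k) r))"
      by (rule rat_comm.Dwork[OF is_subring_Ints subset_UNIV])
        (use b in \<open>auto simp: rat_comm.ghosts_def coeffs_in_def\<close>)
    then obtain \<beta> where \<beta>: "\<And>k. \<beta> k \<in> \<int>"
      and b_eq: "\<And>r. 0 < r \<Longrightarrow> r \<le> N \<Longrightarrow> b r = (\<Sum>k=1..N. Teich k (\<beta> k) r)"
      by blast
    define q where "q r = (\<Sum>l=1..N. \<Sum>k=1..N. qof (Teich l (\<beta> l) r) * Teich k (a k) r)" for r
    have q: "q \<in> ghosts R"
      unfolding q_def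
    proof (intro ghosts_sum[OF R RC] finite_atLeastAtMost)
      fix l k assume l: "l \<in> {1..N}" and k: "k \<in> {1..N}"
      obtain z where z: "\<beta> l = of_int z" using \<beta>[of l] by (auto elim: Ints_cases)
      have "qof (\<beta> l ^ (lcm k l div l)) = (of_int (z ^ (lcm k l div l)) :: 'a)"
        by (simp add: z qof_power)
      then have "qof (\<beta> l ^ (lcm k l div l)) * a k ^ (lcm k l div k) \<in> R"
        by (simp only:) (rule is_subringD(6)[OF R is_subring_of_int[OF R] is_subring_power[OF R a]])
      moreover have "a k \<in> C" using a RC by auto
      ultimately show "(\<lambda>r. qof (Teich l (\<beta> l) r) * Teich k (a k) r) \<in> ghosts R"
        using l k by (simp add: Teich_mult)
          (intro ghosts_of_nat_mult[OF R RC] ghosts_Teich[OF R RC], simp_all add: lcm_pos_nat)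
    qed
    have "W (\<lambda>r. qof (b r) * p r) $ N = W q $ N"
    proof (rule W_diff(2)[where k = "Suc N"])
      fix r assume "0 < r" "r < Suc N"
      then show "qof (b r) * p r = q r"
        by (simp add: p_eq b_eq q_def qof_sum sum_distrib_left sum_distrib_right) (rule sum.swap)
    qed (use pC q in \<open>auto simp: ghosts_def intro: C_qof\<close>)
    then show ?thesis using q by (simp add: ghosts_def coeffs_in_def)
  qed
  then show ?thesis by (auto simp: ghosts_def coeffs_in_def intro: C_qof pC)
qed

end

text \<open>The series \<open>f (u\<^sup>m)\<close>.\<close>
definition spread :: "nat \<Rightarrow> 'a::zero fps \<Rightarrow> 'a fps"
  where "spread m f = Abs_fps (\<lambda>n. if m dvd n then f $ (n div m) else 0)"

lemma spread_nth: "spread m f $ n = (if m dvd n then f $ (n div m) else 0)"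
  by (simp add: spread_def)

lemma spread_mult:
  assumes m: "0 < m" shows "spread m (f * g) = spread m f * spread m (g :: 'a::ring_1 fps)"
proof (rule fps_ext)
  fix n
  show "spread m (f * g) $ n = (spread m f * spread m g) $ n"
  proof (cases "m dvd n")
    case True
    then obtain j where n: "n = m * j" by blast
    have "(spread m f * spread m g) $ n = (\<Sum>i\<in>(*) m ` {0..j}. spread m f $ i * spread m g $ (n - i))"
      unfolding fps_mult_nth
    proof (rule sum.mono_neutral_right)
      show "\<forall>i\<in>{0..n} - (*) m ` {0..j}. spread m f $ i * spread m g $ (n - i) = 0"
      proof
        fix i assume i: "i \<in> {0..n} - (*) m ` {0..j}"
        have "\<not> m dvd i"
        proof
          assume "m dvd i"
          then obtain t where "i = m * t" by blast
          then show False using i n m by auto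
        qed
        then show "spread m f $ i * spread m g $ (n - i) = 0" by (simp add: spread_nth)
      qed
    qed (use n in auto)
    also have "\<dots> = (\<Sum>i=0..j. f $ i * g $ (j - i))"
      using m by (subst sum.reindex) (auto simp: inj_on_def n spread_nth simp flip: diff_mult_distrib2)
    finally show ?thesis using m n by (simp add: spread_nth fps_mult_nth)
  next
    case False
    have "spread m f $ i * spread m g $ (n - i) = 0" if "i \<in> {0..n}" for i
    proof -
      have "\<not> (m dvd i \<and> m dvd n - i)"
        using False that by (metis atLeastAtMost_iff dvd_add le_add_diff_inverse)
      then show ?thesis by (auto simp: spread_nth)
    qed
    then have "(spread m f * spread m g) $ n = 0"
      unfolding fps_mult_nth by (rule sum.neutral[rule_format])
    then show ?thesis using False by (simp add: spread_nth)
  qed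
qed

lemma W_spread:
  assumes m: "0 < m"
  shows "W (\<lambda>r. if m dvd r then of_nat m * p (r div m) else 0) = spread m (W p)"
proof -
  have "spread m (Wlog p) = Wlog (\<lambda>r. if m dvd r then of_nat m * p (r div m) else 0)"
  proof (rule fps_ext)
    fix n
    show "spread m (Wlog p) $ n = Wlog (\<lambda>r. if m dvd r then of_nat m * p (r div m) else 0) $ n"
    proof (cases "m dvd n \<and> n \<noteq> 0")
      case True
      then obtain j where n: "n = m * j" "0 < j" by auto
      have "qof (- 1 / of_nat n) * (of_nat m * p j) = qof (- 1 / of_nat n * of_nat m) * p j"
        by (simp only: qof_mult qof_of_nat mult.assoc)
      also have "- 1 / of_nat n * of_nat m = (- 1 / of_nat j :: rat)"
        using n m by simp
      finally show ?thesis using n m by (simp add: spread_nth Wlog_nth)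
    qed (auto simp: spread_nth Wlog_nth)
  qed
  moreover have "spread m (fexp (Wlog p)) = fexp (spread m (Wlog p))"
    by (rule fexp_hom[where L = "\<lambda>n c. if m dvd n then c else 0" and e = "\<lambda>n. n div m"])
      (auto simp: spread_mult[OF m] Wlog_nth, auto simp: spread_nth qof_nth fps_eq_iff elim!: dvdE)
  ultimately show ?thesis by (simp add: W_def)
qed

text \<open>The substitution of -u for u, translating the alternating signs of \<open>htilde\<close>
  into the convention of \<open>W\<close>.\<close>

definition altz :: "'a::ring_1 fps \<Rightarrow> 'a fps"
  where "altz f = Abs_fps (\<lambda>n. (- 1) ^ n * f $ n)"

lemma altz_nth: "altz f $ n = (- 1) ^ n * f $ n"
  by (simp add: altz_def)

lemma altz_mult: "altz (f * g) = altz f * altz g"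
proof (rule fps_ext)
  fix n
  have "(- 1) ^ n * (f $ i * g $ (n - i)) = (- 1) ^ i * f $ i * ((- 1) ^ (n - i) * g $ (n - i))"
    if "i \<in> {0..n}" for i
  proof -
    have "(- 1 :: 'a) ^ n = (- 1) ^ i * (- 1) ^ (n - i)" using that by (simp flip: power_add)
    moreover have "(- 1) ^ (n - i) * (f $ i * x) = f $ i * ((- 1) ^ (n - i) * x)" for x
      by (cases "even (n - i)") auto
    ultimately show ?thesis by (simp only: mult.assoc)
  qed
  then show "altz (f * g) $ n = (altz f * altz g) $ n"
    by (simp add: altz_nth fps_mult_nth sum_distrib_left)
qed

lemma altz_fexp: "a $ 0 = 0 \<Longrightarrow> altz (fexp a) = fexp (altz a)"
  by (rule fexp_hom[where L = "\<lambda>n c. (- 1) ^ n * c" and e = "\<lambda>n. n"])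
    (auto simp: altz_mult, auto simp: altz_nth qof_nth fps_eq_iff distrib_left)

lemma fexp_alternating:
  assumes "\<And>n. 0 < n \<Longrightarrow> f $ n = qof ((- 1) ^ (n - 1) / of_nat n) * p n" "f $ 0 = 0"
  shows "fexp f $ n = (- 1) ^ n * W p $ n"
proof -
  have "f = altz (Wlog p)"
  proof (rule fps_ext)
    fix n
    show "f $ n = altz (Wlog p) $ n"
    proof (cases n)
      case (Suc k)
      have "(- 1) ^ Suc k * (qof (- 1 / of_nat (Suc k)) * p n)
          = qof ((- 1) ^ Suc k * (- 1 / of_nat (Suc k))) * p n"
        by (cases "even k") (simp_all add: qof_mult qof_minus)
      also have "(- 1) ^ Suc k * (- 1 / of_nat (Suc k)) = ((- 1) ^ k / of_nat (Suc k) :: rat)"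
        by simp
      finally show ?thesis using assms(1)[of n] Suc by (simp add: altz_nth Wlog_nth del: of_nat_Suc)
    qed (simp add: assms(2) altz_nth Wlog_nth)
  qed
  then have "fexp f = altz (W p)" by (simp add: W_def altz_fexp Wlog_nth)
  then show ?thesis by (simp add: altz_nth)
qed

subsection \<open>Integrality of the scalar ghost sequences\<close>

lemma XD_Wlog: "fps_XD (Wlog p) $ n = (if n = 0 then 0 else - p n)"
proof (cases "n = 0")
  case False
  then show ?thesis using of_nat_mult_qof_inverse[of n "p n"] by (simp add: Wlog_nth qof_minus)
qed simp

lemma W_eqI:
  fixes g P :: "rat fps"
  assumes "g $ 0 = 1" "fps_XD g = - P * g" "P $ 0 = 0" "\<And>n. 0 < n \<Longrightarrow> P $ n = p n"
  shows "W p = g"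
  unfolding W_def
proof (rule fexp_eqI)
  have "fps_XD (Wlog p) $ n = (- P) $ n" for n
    unfolding XD_Wlog using assms(3) assms(4)[of n] by simp
  then have "fps_XD (Wlog p) = - P" by (rule fps_ext)
  then show "fps_XD g = fps_XD (Wlog p) * g" using assms(2) by simp
qed (simp_all add: Wlog_nth assms)

text \<open>((1 + sqrt 2)^n + (1 - sqrt 2)^n)/2, half the power sums of the roots of t^2 - 2t - 1;
  up to alternating sign, the coefficients of u d/du applied to 1/2 log (1 + 2u - u^2).\<close>

fun dseq :: "nat \<Rightarrow> int" where
  "dseq 0 = 1"
| "dseq (Suc 0) = 1"
| "dseq (Suc (Suc n)) = 2 * dseq (Suc n) + dseq n"

lemma odd_dseq: "odd (dseq n)"
  by (induction n rule: dseq.induct) auto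

lemma dseq_8: "dseq (n + 8) = 34 * dseq (n + 4) - dseq n"
  by (simp add: eval_nat_numeral)

lemma W_dseq: "W (\<lambda>n. of_int (2 * dseq n)) = (1 - 2 * fps_X - fps_X\<^sup>2 :: rat fps)"
proof (rule W_eqI)
  define P :: "rat fps" where "P = Abs_fps (\<lambda>n. if n = 0 then 0 else of_int (2 * dseq n))"
  have "P * (1 - 2 * fps_X - fps_X\<^sup>2) = 2 * fps_X + 2 * fps_X\<^sup>2"
  proof (rule fps_ext)
    fix n
    have "(P * (1 - 2 * fps_X - fps_X\<^sup>2)) $ n = P $ n - 2 * (P * fps_X) $ n - (P * fps_X\<^sup>2) $ n"
      by (simp add: right_diff_distrib mult.left_commute[of P] fps_numeral_fps_const)
    also have "\<dots> = P $ n - 2 * (if n = 0 then 0 else P $ (n - 1)) - (if n < 2 then 0 else P $ (n - 2))"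
      by (simp add: fps_X_power_mult_right_nth)
    also have "\<dots> = (2 * fps_X + 2 * fps_X\<^sup>2) $ n"
    proof -
      consider "n = 0" | "n = Suc 0" | "n = Suc (Suc 0)" | k where "n = Suc (Suc (Suc k))"
        by (metis not0_implies_Suc)
      then show ?thesis
        by cases (simp_all add: P_def fps_numeral_fps_const)
    qed
    finally show "(P * (1 - 2 * fps_X - fps_X\<^sup>2)) $ n = (2 * fps_X + 2 * fps_X\<^sup>2) $ n" .
  qed
  then show "fps_XD (1 - 2 * fps_X - fps_X\<^sup>2) = - P * (1 - 2 * fps_X - fps_X\<^sup>2)"
    by (simp add: XD_poly)
  show "P $ 0 = 0" "\<And>n. 0 < n \<Longrightarrow> P $ n = of_int (2 * dseq n)" by (simp_all add: P_def)
qed simp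

text \<open>The part of \<open>dseq\<close> where \<open>eps\<close> is -1, so that
  \<open>bseq\<close> is \<open>dseq\<close> minus twice \<open>dseq4\<close> at positive
  indices.\<close>

definition dseq4 :: "nat \<Rightarrow> rat"
  where "dseq4 n = (if 4 dvd n then of_int (dseq n) else 0)"

text \<open>(1 + sqrt 2)^4 has trace 34 and norm 1. The fourth roots of it and of its conjugate are
  eight numbers with power sums \<open>8 * dseq4 n\<close>.\<close>

lemma W_dseq4: "W (\<lambda>n. 8 * dseq4 n) = 1 - 34 * fps_X ^ 4 + fps_X ^ 8"
proof (rule W_eqI)
  define P :: "rat fps" where "P = Abs_fps (\<lambda>n. if n = 0 then 0 else 8 * dseq4 n)"
  have "P * (1 - 34 * fps_X ^ 4 + fps_X ^ 8) = 136 * fps_X ^ 4 - 8 * fps_X ^ 8"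
  proof (rule fps_ext)
    fix n
    have "(P * (1 - 34 * fps_X ^ 4 + fps_X ^ 8)) $ n = P $ n - 34 * (P * fps_X ^ 4) $ n + (P * fps_X ^ 8) $ n"
      by (simp add: distrib_left right_diff_distrib mult.left_commute[of P] fps_numeral_fps_const)
    also have "\<dots> = P $ n - 34 * (if n < 4 then 0 else P $ (n - 4)) + (if n < 8 then 0 else P $ (n - 8))"
      by (simp only: fps_X_power_mult_right_nth)
    also have "\<dots> = (136 * fps_X ^ 4 - 8 * fps_X ^ 8) $ n"
    proof (cases "n < 9")
      case True
      have "dseq 4 = 17" "dseq 8 = 577" by (simp_all add: eval_nat_numeral)
      moreover have "n \<in> {0, 1, 2, 3, 4, 5, 6, 7, 8}" using True by auto
      ultimately show ?thesis
        by (elim insertE) (simp_all add: P_def dseq4_def fps_numeral_fps_const)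
    next
      case False
      then have "n = (n - 8) + 8" "0 < n - 8" by auto
      then obtain m where n: "n = m + 8" "0 < m" by blast
      have "dseq4 (m + 8) = 34 * dseq4 (m + 4) - dseq4 m"
      proof -
        have "4 dvd m + 8 \<longleftrightarrow> 4 dvd m" "4 dvd m + 4 \<longleftrightarrow> 4 dvd m" by presburger+
        then show ?thesis by (simp add: dseq4_def dseq_8)
      qed
      then show ?thesis
        using n by (simp add: P_def fps_numeral_fps_const add.commute[of 4 m])
    qed
    finally show "(P * (1 - 34 * fps_X ^ 4 + fps_X ^ 8)) $ n = (136 * fps_X ^ 4 - 8 * fps_X ^ 8) $ n" .
  qed
  then show "fps_XD (1 - 34 * fps_X ^ 4 + fps_X ^ 8) = - P * (1 - 34 * fps_X ^ 4 + fps_X ^ 8)"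
    by (simp add: XD_poly)
  show "P $ 0 = 0" "\<And>n. 0 < n \<Longrightarrow> P $ n = 8 * dseq4 n" by (simp_all add: P_def)
qed simp

text \<open>The quadratic equation p + c p^2 = w determines p recursively without any
  division.\<close>

lemma int_series_sqrt:
  fixes T w :: "rat fps"
  assumes T: "T\<^sup>2 = 1 + 4 * of_nat c * w" "T $ 0 = 1" and w: "int_series w" and c: "0 < c"
  obtains p where "int_series p" "T = 1 + 2 * of_nat c * p"
proof -
  define p where "p = qof (1 / (2 * of_nat c)) * (T - 1)"
  have "2 * of_nat c * p = qof (2 * of_nat c * (1 / (2 * of_nat c))) * (T - 1)"
    by (simp only: p_def qof_mult qof_of_nat qof_numeral mult.assoc)
  then have Tp: "2 * of_nat c * p = T - 1" using c by simp
  then have T_eq: "T = 1 + 2 * of_nat c * p" by simp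
  have "4 * of_nat c * (p + of_nat c * p\<^sup>2) = 4 * of_nat c * w"
    using T(1) unfolding T_eq by (simp add: power2_eq_square algebra_simps)
  moreover have "(4 * of_nat c :: rat fps) \<noteq> 0" using c by simp
  ultimately have pw: "p + of_nat c * p\<^sup>2 = w" by (simp only: mult_cancel_left simp_thms)
  have p0: "p $ 0 = 0" by (simp add: p_def T(2))
  have "p $ n \<in> \<int>" for n
  proof (induction n rule: less_induct)
    case (less n)
    show ?case
    proof (cases "n = 0")
      case False
      have "(of_nat c * p\<^sup>2) $ n = of_nat c * (p\<^sup>2 $ n)"
        using qof_mult_nth[of "of_nat c" "p\<^sup>2" n] by (simp only: qof_of_nat)
      also have "p\<^sup>2 $ n = (\<Sum>i=0..n. p $ i * p $ (n - i))"
        by (simp add: power2_eq_square fps_mult_nth)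
      finally have "(of_nat c * p\<^sup>2) $ n = of_nat c * (\<Sum>i=0..n. p $ i * p $ (n - i))" .
      moreover have "p $ n = (p + of_nat c * p\<^sup>2) $ n - (of_nat c * p\<^sup>2) $ n" by simp
      ultimately have "p $ n = w $ n - of_nat c * (\<Sum>i=0..n. p $ i * p $ (n - i))"
        by (simp only: pw)
      also have "\<dots> \<in> \<int>"
      proof (intro Ints_diff Ints_mult[of "of_nat c"] Ints_sum)
        fix i assume i: "i \<in> {0..n}"
        show "p $ i * p $ (n - i) \<in> \<int>"
        \<comment> \<open>The extreme terms vanish because p has no constant term, so only earlier
          coefficients enter.\<close>
        proof (cases "i = 0 \<or> i = n")
          case False
          then show ?thesis using less[of i] less[of "n - i"] i by auto
        qed (use p0 in auto)
      qed (use w in \<open>auto simp: coeffs_in_def\<close>)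
      finally show ?thesis .
    qed (simp add: p0)
  qed
  then have "int_series p" by (simp add: coeffs_in_def)
  then show ?thesis using T_eq by (rule that)
qed

definition bseq :: "nat \<Rightarrow> rat"
  where "bseq n = of_int (eps n * dseq n)"

text \<open>Since \<open>bseq\<close> is \<open>dseq\<close> minus twice \<open>dseq4\<close>, B
  satisfies B^2 S = 1 - 2u - u^2 with S^2 = 1 - 34u^4 + u^8. Two congruences make the roots
  integral: S^2 is (1 - u^4)^2 modulo 32, and (1 - 2u - u^2)(1 + u)^2 is 1 - u^4 modulo 4. So V =
  S/(1 - u^4) is 1 modulo 16, and the square of T = B (1 + u) is 1 modulo 4.\<close>

lemma int_ghosts_bseq: "bseq \<in> int_ghosts"
proof -
  define S where "S = W (\<lambda>n. 4 * dseq4 n)"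
  define Q :: "rat fps" where "Q = inverse (1 - fps_X ^ 4)"
  have Q: "Q * (1 - fps_X ^ 4) = 1" "Q $ 0 = 1" "int_series Q"
    unfolding Q_def
    by (rule inverse_mult_eq_1, simp) (simp, rule int_series_inverse, simp_all add: int_series_closed int_series_power)
  have "S * S = W (\<lambda>n. 4 * dseq4 n + 4 * dseq4 n)"
    unfolding S_def by (rule rat_comm.W_add[symmetric]) simp_all
  then have S2: "S * S = 1 - 34 * fps_X ^ 4 + fps_X ^ 8"
    by (simp add: W_dseq4)
  define V where "V = S * Q"
  have V0: "V $ 0 = 1" by (simp add: V_def S_def Q)
  have "V\<^sup>2 * (1 - fps_X ^ 4)\<^sup>2 = S * S * (Q * (1 - fps_X ^ 4))\<^sup>2"
    by (simp only: V_def power2_eq_square mult_ac)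
  then have V2: "V\<^sup>2 * (1 - fps_X ^ 4)\<^sup>2 = 1 - 34 * fps_X ^ 4 + fps_X ^ 8"
    by (simp add: S2 Q)
  have "V\<^sup>2 = 1 + 4 * of_nat 8 * (- (fps_X ^ 4 * Q\<^sup>2))"
  proof (rule fps_cancel)
    show "((1 - fps_X ^ 4)\<^sup>2 :: rat fps) $ 0 = 1" by (simp add: power2_eq_square)
    have "(1 + 4 * of_nat 8 * (- (x * Q\<^sup>2))) * d\<^sup>2 = d\<^sup>2 - 32 * (x * (Q * d)\<^sup>2)" for x d :: "rat fps"
      by (simp add: power2_eq_square algebra_simps)
    then have "(1 + 4 * of_nat 8 * (- (fps_X ^ 4 * Q\<^sup>2))) * (1 - fps_X ^ 4)\<^sup>2
        = (1 - fps_X ^ 4)\<^sup>2 - 32 * (fps_X ^ 4 * (Q * (1 - fps_X ^ 4))\<^sup>2)" .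
    also have "\<dots> = V\<^sup>2 * (1 - fps_X ^ 4)\<^sup>2"
      unfolding V2 Q by (simp add: algebra_simps eval_nat_numeral)
    finally show "V\<^sup>2 * (1 - fps_X ^ 4)\<^sup>2 = (1 + 4 * of_nat 8 * (- (fps_X ^ 4 * Q\<^sup>2))) * (1 - fps_X ^ 4)\<^sup>2" ..
  qed
  then obtain q where q: "int_series q" and Vq: "V = 1 + 2 * of_nat 8 * q"
    by (rule int_series_sqrt)
      (simp_all add: V0 int_series_closed int_series_power int_series_minus Q coeffs_in_X[OF is_subring_Ints])
  have intV: "int_series V" unfolding Vq using q by (simp add: int_series_closed int_series_numeral)
  define V' where "V' = inverse V"
  have V': "V' * V = 1" "int_series V'"
    unfolding V'_def by (rule inverse_mult_eq_1, simp add: V0) (rule int_series_inverse[OF intV V0])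
  define B where "B = W bseq"
  have "bseq n + bseq n + 4 * dseq4 n = of_int (2 * dseq n)" for n
    by (simp add: bseq_def dseq4_def eps_def)
  then have "W (\<lambda>n. bseq n + bseq n + 4 * dseq4 n) = W (\<lambda>n. of_int (2 * dseq n))" by presburger
  also have "W (\<lambda>n. bseq n + bseq n + 4 * dseq4 n) = B * B * S"
  proof -
    have "W (\<lambda>n. bseq n + bseq n + 4 * dseq4 n) = W (\<lambda>n. bseq n + bseq n) * S"
      unfolding S_def by (rule rat_comm.W_add) simp_all
    moreover have "W (\<lambda>n. bseq n + bseq n) = B * B"
      unfolding B_def by (rule rat_comm.W_add) simp_all
    ultimately show ?thesis by (simp only:)
  qed
  finally have BBS: "B * B * S = 1 - 2 * fps_X - fps_X\<^sup>2" by (simp only: W_dseq)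
  define A :: "rat fps" where "A = inverse ((1 - fps_X) * (1 + fps_X\<^sup>2))"
  have A: "A * ((1 - fps_X) * (1 + fps_X\<^sup>2)) = 1" "int_series A"
    unfolding A_def
    by (rule inverse_mult_eq_1, simp) (rule int_series_inverse, simp_all add: int_series_closed int_series_power)
  define T where "T = B * (1 + fps_X)"
  have T0: "T $ 0 = 1" by (simp add: T_def B_def)
  have T2V: "T\<^sup>2 * V = 1 - 4 * (fps_X\<^sup>2 * A)"
  proof (rule fps_cancel)
    let ?D = "(1 - fps_X ^ 4) :: rat fps"
    show "?D $ 0 = 1" by simp
    have D: "?D = (1 + fps_X) * ((1 - fps_X) * (1 + fps_X\<^sup>2))"
      by (simp add: algebra_simps eval_nat_numeral)
    have "T\<^sup>2 * V * ?D = (B * B * S) * (1 + fps_X)\<^sup>2 * (Q * ?D)"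
      by (simp only: T_def V_def power2_eq_square mult_ac)
    also have "\<dots> = (1 - 2 * fps_X - fps_X\<^sup>2) * (1 + fps_X)\<^sup>2"
      by (simp only: BBS Q mult_1_right)
    also have "\<dots> = ?D - 4 * (fps_X\<^sup>2 * (1 + fps_X))"
      by (simp add: algebra_simps eval_nat_numeral)
    also have "\<dots> = ?D - 4 * (fps_X\<^sup>2 * (1 + fps_X) * (A * ((1 - fps_X) * (1 + fps_X\<^sup>2))))"
      by (simp only: A mult_1_right)
    also have "\<dots> = (1 - 4 * (fps_X\<^sup>2 * A)) * ?D"
    proof -
      have "u * e - 4 * (x * u * (A * e)) = (1 - 4 * (x * A)) * (u * e)" for u e x :: "rat fps"
        by (simp add: algebra_simps)
      then show ?thesis unfolding D .
    qed
    finally show "T\<^sup>2 * V * ?D = (1 - 4 * (fps_X\<^sup>2 * A)) * ?D" .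
  qed
  have "T\<^sup>2 = T\<^sup>2 * V * V'" using V' by (simp add: mult.assoc mult.commute)
  also have "\<dots> = 1 + 4 * of_nat 1 * (- (fps_X\<^sup>2 * A + 4 * q) * V')"
  proof -
    have "(1 - 4 * (fps_X\<^sup>2 * A)) * V' = V' * V - 4 * of_nat 1 * ((fps_X\<^sup>2 * A + 4 * q) * V')"
      unfolding Vq by (simp add: algebra_simps)
    then show ?thesis unfolding T2V by (simp add: V' algebra_simps)
  qed
  finally obtain p where p: "int_series p" and Tp: "T = 1 + 2 * of_nat 1 * p"
    by (rule int_series_sqrt)
      (simp_all add: T0 int_series_closed int_series_power int_series_minus int_series_numeral A V' q coeffs_in_X[OF is_subring_Ints])
  have "B = T * inverse (1 + fps_X)"
    by (simp add: T_def mult.assoc inverse_mult_eq_1')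
  moreover have "int_series (inverse (1 + fps_X))"
    by (rule int_series_inverse) (simp_all add: int_series_closed)
  ultimately have "int_series B"
    using p Tp by (simp add: int_series_closed int_series_numeral)
  then show ?thesis by (simp add: rat_comm.ghosts_def B_def)
qed

lemma int_ghosts_diff: "p \<in> int_ghosts \<Longrightarrow> q \<in> int_ghosts \<Longrightarrow> (\<lambda>r. p r - q r) \<in> int_ghosts"
  using rat_comm.ghosts_add[OF is_subring_Ints subset_UNIV _ rat_comm.ghosts_minus[OF is_subring_Ints subset_UNIV], of p q]
  by simp

text \<open>The weights of the Cartan factor for r + s = \<plusminus> m: 1 or \<open>dseq n\<close>
  by the parity of m, times the sign that turns h into \<open>pgh\<close>.\<close>

definition gseq :: "nat \<Rightarrow> nat \<Rightarrow> rat"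
  where "gseq m n = of_int (eps (m * n)) * (if even m then 1 else of_int (dseq n))"

text \<open>For odd m, 4 divides m n exactly if it divides n, which gives \<open>bseq\<close>. For
  even m the sequence consists of signs of period 1 or 2 and is an explicit combination of
  \<open>Teich\<close>.\<close>

lemma int_ghosts_gseq: "gseq m \<in> int_ghosts"
proof -
  have T: "Teich k 1 \<in> int_ghosts" if "0 < k" for k
    by (rule rat_comm.ghosts_Teich[OF is_subring_Ints subset_UNIV]) (use that in simp_all)
  consider "odd m" | "4 dvd m" | "even m" "\<not> 4 dvd m" by blast
  then show ?thesis
  proof cases
    case 1
    then have "coprime 4 m" by (simp add: coprime_right_2_iff_odd flip: coprime_power_left_iff[of 2 2 m, simplified])
    then have "gseq m = bseq"
      using 1 by (auto simp: gseq_def bseq_def eps_def coprime_dvd_mult_right_iff)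
    then show ?thesis by (simp add: int_ghosts_bseq)
  next
    case 2
    then have "even m" using dvd_trans[of 2 4 m] by simp
    then have "gseq m = (\<lambda>n. - Teich 1 1 n)"
      using 2 by (auto simp: gseq_def eps_def Teich_def)
    then show ?thesis
      using rat_comm.ghosts_minus[OF is_subring_Ints subset_UNIV T[of 1]] by simp
  next
    case 3
    have "4 dvd m * n \<longleftrightarrow> even n" for n
    proof -
      obtain j where m: "m = 2 * j" using 3(1) by blast
      then have "odd j" using 3(2) by (auto elim!: evenE)
      have "4 dvd m * n \<longleftrightarrow> 2 * 2 dvd 2 * (j * n)" by (simp add: m mult.assoc)
      also have "\<dots> \<longleftrightarrow> even (j * n)" by (simp only: dvd_times_left_cancel_iff)
      finally show ?thesis using \<open>odd j\<close> by simp
    qed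
    then have "gseq m = (\<lambda>n. Teich 1 1 n - Teich 2 1 n)"
      using 3 by (auto simp: gseq_def eps_def Teich_def)
    then show ?thesis using int_ghosts_diff[OF T T, of 1 2] by simp
  qed
qed

text \<open>Rewrites a series in u^m as one in u over all of \<open>pgh\<close>, so that the factors
  for different divisors m of k can be compared at the same coefficient k. The factor m turns 1/(m
  n) back into 1/n.\<close>

definition Bseq :: "nat \<Rightarrow> nat \<Rightarrow> rat"
  where "Bseq m n = (if m dvd n then of_nat m * gseq m (n div m) else 0)"

lemma int_ghosts_Bseq:
  assumes "0 < m" shows "Bseq m \<in> int_ghosts"
proof -
  have "W (Bseq m) = spread m (W (gseq m))"
    unfolding Bseq_def using W_spread[OF assms, of "gseq m"] by simp
  then show ?thesis
    using int_ghosts_gseq[of m] by (auto simp: rat_comm.ghosts_def coeffs_in_def spread_nth)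
qed

text \<open>In the Dwork expansion of an integral ghost sequence at a prime power all terms but the first
  are divisible by the prime.\<close>
lemma int_ghosts_prime_power:
  assumes b: "b \<in> int_ghosts" "b 1 = 1" and q: "prime q"
  shows "\<exists>z. b (q ^ a) = 1 + of_nat q * of_int z"
proof -
  let ?N = "q ^ a"
  have N: "1 \<le> ?N" using prime_gt_0_nat[OF q] by (simp add: Suc_leI)
  have "\<exists>\<beta>. (\<forall>k. \<beta> k \<in> \<int>) \<and> (\<forall>r. 0 < r \<longrightarrow> r \<le> ?N \<longrightarrow> b r = (\<Sum>k=1..?N. Teich k (\<beta> k) r))"
    by (rule rat_comm.Dwork[OF is_subring_Ints subset_UNIV])
      (use b in \<open>auto simp: rat_comm.ghosts_def coeffs_in_def\<close>)
  then obtain \<beta> where \<beta>: "\<And>k. \<beta> k \<in> \<int>"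
    and b_eq: "\<And>r. 0 < r \<Longrightarrow> r \<le> ?N \<Longrightarrow> b r = (\<Sum>k=1..?N. Teich k (\<beta> k) r)"
    by blast
  have split: "b r = Teich 1 (\<beta> 1) r + (\<Sum>k=2..?N. Teich k (\<beta> k) r)" if "0 < r" "r \<le> ?N" for r
    using b_eq[OF that] N by (simp add: sum.atLeast_Suc_atMost numeral_2_eq_2)
  have "(\<Sum>k=2..?N. Teich k (\<beta> k) 1) = 0"
    by (rule sum.neutral) (auto simp: Teich_def)
  then have \<beta>1: "\<beta> 1 = 1" using split[of 1] N b(2) by (simp add: Teich_def)
  have "\<exists>z. (\<Sum>k=2..?N. Teich k (\<beta> k) ?N) = of_nat q * of_int z"
  proof -
    have "\<exists>z. Teich k (\<beta> k) ?N = of_nat q * of_int z" if k: "k \<in> {2..?N}" for k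
    proof (cases "k dvd ?N")
      case True
      then obtain i where i: "k = q ^ i" using divides_primepow_nat[OF q] by blast
      then have "0 < i" using k by (cases i) auto
      then have "q dvd k" using i by (simp add: dvd_power)
      then obtain j where j: "k = q * j" by blast
      obtain z where "\<beta> k = of_int z" using \<beta>[of k] by (auto elim: Ints_cases)
      then have "Teich k (\<beta> k) ?N = of_nat q * of_int (int j * z ^ (?N div k))"
        using True by (simp add: Teich_def j)
      then show ?thesis by blast
    next
      case False
      then have "Teich k (\<beta> k) ?N = of_nat q * of_int 0" by (simp add: Teich_def)
      then show ?thesis by blast
    qed
    then obtain z where "\<And>k. k \<in> {2..?N} \<Longrightarrow> Teich k (\<beta> k) ?N = of_nat q * of_int (z k)"
      by metis
    then have "(\<Sum>k=2..?N. Teich k (\<beta> k) ?N) = of_nat q * of_int (\<Sum>k=2..?N. z k)"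
      by (simp add: sum_distrib_left)
    then show ?thesis by blast
  qed
  then obtain z where z: "(\<Sum>k=2..?N. Teich k (\<beta> k) ?N) = of_nat q * of_int z" by blast
  have "Teich 1 (\<beta> 1) ?N = 1" unfolding \<beta>1 by (simp add: Teich_def)
  moreover have "b ?N = Teich 1 (\<beta> 1) ?N + (\<Sum>k=2..?N. Teich k (\<beta> k) ?N)"
    by (rule split) (use N in linarith, simp)
  ultimately have "b ?N = 1 + of_nat q * of_int z" by (simp only: z)
  then show ?thesis ..
qed

subsection \<open>The series conjugating the root vectors\<close>

text \<open>The scalar part of \<open>log_series\<close>, split by index parity because even and odd
  h scale x by 2 and by 6.\<close>

definition lam :: "bool \<Rightarrow> rat fps"
  where "lam e = Abs_fps (\<lambda>n. if n \<noteq> 0 \<and> even n = e then (- 1) ^ (n - 1) * of_int (eps n) / of_nat n else 0)"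

text \<open>The quotient (1 - u)/(1 + u) is written as 1 - 2u/(1 + u) to expose the reduction modulo
  2.\<close>

definition phi :: "rat fps"
  where "phi = (1 + fps_X\<^sup>2) * (1 - 2 * (fps_X * inverse (1 + fps_X))) ^ 3"

lemma parity_lam: "parity e (lam e)"
  by (auto simp: parity_def lam_def)

lemma lam_nth_0 [simp]: "lam e $ 0 = 0"
  by (simp add: lam_def)

lemma fexp_lam: "fexp (- (2 * lam True) - 6 * lam False) = phi"
proof (rule fexp_eqI)
  let ?q = "(1 + fps_X) ^ 3 :: rat fps" and ?p = "(1 + fps_X\<^sup>2) * (1 - fps_X) ^ 3 :: rat fps"
  let ?r = "- 6 * fps_X + 2 * fps_X\<^sup>2 - 6 * fps_X ^ 3 - 2 * fps_X ^ 4 :: rat fps"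
  define \<psi> where "\<psi> = fps_XD (- (2 * lam True) - 6 * lam False)"
  have \<psi>_nth: "\<psi> $ n = (if n = 0 then 0 else if odd n then - 6 else 2 * of_int (eps n))" for n
  proof -
    have "\<psi> = - (2 * fps_XD (lam True)) - 6 * fps_XD (lam False)"
      by (simp add: \<psi>_def XD_poly)
    moreover have "\<not> 4 dvd n" if "odd n"
      using that dvd_trans[of 2 4 n] by auto
    ultimately show ?thesis
      by (auto simp: fps_numeral_fps_const lam_def eps_def)
  qed
  \<comment> \<open>The coefficients -6, 2, -6, -2 repeat with period 4, so this product is a
    polynomial.\<close>
  have \<psi>: "\<psi> * (1 - fps_X ^ 4) = ?r"
  proof (rule fps_ext)
    fix n
    have "(\<psi> * (1 - fps_X ^ 4)) $ n = \<psi> $ n - (\<psi> * fps_X ^ 4) $ n"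
      by (simp add: right_diff_distrib)
    also have "\<dots> = ?r $ n"
    proof (cases "n < 5")
      case True
      then have "n \<in> {0, 1, 2, 3, 4}" by auto
      then show ?thesis
        by (elim insertE) (simp_all add: \<psi>_nth eps_def fps_X_power_mult_right_nth fps_numeral_fps_const)
    next
      case False
      then have "n = (n - 4) + 4" "0 < n - 4" by auto
      then obtain m where m: "n = m + 4" "0 < m" by blast
      then have "\<psi> $ n = \<psi> $ m" by (simp add: \<psi>_nth eps_def)
      then show ?thesis using m by (simp add: fps_X_power_mult_right_nth fps_numeral_fps_const)
    qed
    finally show "(\<psi> * (1 - fps_X ^ 4)) $ n = ?r $ n" .
  qed
  have "(1 - 2 * (fps_X * inverse (1 + fps_X))) * (1 + fps_X) = (1 + fps_X) - 2 * (fps_X * (inverse (1 + fps_X) * (1 + fps_X :: rat fps)))"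
    by (simp only: left_diff_distrib mult_1_left mult.assoc)
  then have "(1 - 2 * (fps_X * inverse (1 + fps_X))) * (1 + fps_X) = (1 - fps_X :: rat fps)"
    by (simp add: inverse_mult_eq_1)
  then have pq: "phi * ?q = ?p"
    unfolding phi_def by (simp only: mult.assoc flip: power_mult_distrib)
  have "fps_XD phi * ?q + phi * fps_XD ?q = fps_XD ?p"
    using arg_cong[OF pq, of fps_XD] by (simp only: XD_mult)
  then have Xpq: "fps_XD phi * ?q = fps_XD ?p - phi * fps_XD ?q" by (simp add: algebra_simps)
  show "fps_XD phi = fps_XD (- (2 * lam True) - 6 * lam False) * phi"
    unfolding \<psi>_def[symmetric]
  proof (rule fps_cancel)
    show "(?q * ?q * (1 - fps_X ^ 4)) $ 0 = 1" by (simp add: power3_eq_cube)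
    have "fps_XD phi * (?q * ?q * (1 - fps_X ^ 4)) = (fps_XD phi * ?q) * ?q * (1 - fps_X ^ 4)"
      by (simp only: mult_ac)
    also have "\<dots> = (fps_XD ?p * ?q - (phi * ?q) * fps_XD ?q) * (1 - fps_X ^ 4)"
    proof -
      have "(A - f * b) * q * D = (A * q - (f * q) * b) * D" for A f b q D :: "rat fps"
        by (simp add: algebra_simps)
      then show ?thesis unfolding Xpq .
    qed
    also have "\<dots> = ?r * ?p * ?q"
      unfolding pq by (simp add: XD_mult XD_poly algebra_simps eval_nat_numeral)
    also have "\<dots> = (\<psi> * (1 - fps_X ^ 4)) * (phi * ?q) * ?q"
      by (simp only: \<psi> pq)
    also have "\<dots> = \<psi> * phi * (?q * ?q * (1 - fps_X ^ 4))"
      by (simp only: mult_ac)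
    finally show "fps_XD phi * (?q * ?q * (1 - fps_X ^ 4)) = \<psi> * phi * (?q * ?q * (1 - fps_X ^ 4))" .
  qed
qed (simp_all add: phi_def power3_eq_cube)

lemma phi_mod_2: obtains \<kappa> where "int_series \<kappa>" "phi = 1 + fps_X\<^sup>2 + 2 * \<kappa>"
proof -
  let ?t = "fps_X * inverse (1 + fps_X) :: rat fps"
  let ?\<kappa> = "(1 + fps_X\<^sup>2) * (- 3 * ?t + 6 * ?t\<^sup>2 - 4 * ?t ^ 3)"
  have "phi = 1 + fps_X\<^sup>2 + 2 * ?\<kappa>"
    unfolding phi_def by (simp add: algebra_simps eval_nat_numeral)
  have "int_series (inverse (1 + fps_X))"
    by (rule int_series_inverse) (simp_all add: int_series_closed)
  then have "int_series ?\<kappa>"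
    by (simp add: int_series_closed int_series_power int_series_numeral int_series_minus)
  then show ?thesis using \<open>phi = 1 + fps_X\<^sup>2 + 2 * ?\<kappa>\<close> by (rule that)
qed

subsection \<open>The Cartan part\<close>

lemma is_subring_subring_gen: "is_subring (subring_gen S)"
  unfolding is_subring_def by (auto intro: subring_gen.intros)

lemma subring_gen_subset:
  assumes "is_subring R" "S \<subseteq> R" shows "subring_gen S \<subseteq> R"
proof
  fix a assume "a \<in> subring_gen S"
  then show "a \<in> R"
    by induction (use assms in \<open>auto intro: is_subringD\<close>)
qed

lemma subring_gen_commute:
  assumes "\<And>a b. a \<in> S \<Longrightarrow> b \<in> S \<Longrightarrow> a * b = b * a"
  shows "a \<in> subring_gen S \<Longrightarrow> b \<in> subring_gen S \<Longrightarrow> a * b = b * (a :: 'a::ring_1)"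
proof -
  have 1: "a * b = b * a" if "a \<in> subring_gen S" "b \<in> S" for a b
    using that
  proof (induction rule: subring_gen.induct)
    case (mult a a')
    then show ?case by (metis mult.assoc)
  qed (simp_all add: assms algebra_simps)
  show "a * b = b * a" if "a \<in> subring_gen S" "b \<in> subring_gen S" for a b
    using that(2,1)
  proof (induction rule: subring_gen.induct)
    case (mult b b')
    then show ?case by (metis mult.assoc)
  qed (simp_all add: 1 algebra_simps)
qed

lemma subring_UZ: "is_subring UZ" and subring_UZ_0: "is_subring UZ_0" and subring_UZ_pm: "is_subring (UZ_pm \<sigma>)"
  unfolding UZ_def UZ_0_def UZ_pm_def by (rule is_subring_subring_gen)+

lemma dpow_x_in_UZ: "dpow (x_el \<sigma> r) k \<in> UZ"
  unfolding UZ_def divpow_eq[symmetric] by (rule subring_gen.base) blast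

lemma dpow_x_in_UZ_pm: "dpow (x_el \<sigma> r) k \<in> UZ_pm \<sigma>"
  unfolding UZ_pm_def divpow_eq[symmetric] by (rule subring_gen.base) blast

lemma Hser_in_UZ: "Hser r s $ j \<in> UZ"
  by (rule Hser_in_subring[OF subring_UZ dpow_x_in_UZ])

definition pgh :: "pmsign \<Rightarrow> nat \<Rightarrow> uea"
  where "pgh \<sigma> r = of_int (eps r) * h_el (sgn_of \<sigma> * int r)"

lemma log_series_nth: "0 < n \<Longrightarrow> log_series \<sigma> $ n = qof ((- 1) ^ (n - 1) / of_nat n) * pgh \<sigma> n"
proof -
  assume "0 < n"
  then have "log_series \<sigma> $ n = qof ((- 1) ^ (n - 1) / of_nat n * of_int (eps n)) * h_el (sgn_of \<sigma> * int n)"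
    by (simp add: log_series_def qscale_eq)
  then show ?thesis by (simp only: qof_mult qof_of_int pgh_def mult.assoc)
qed

lemma log_series_nth_0 [simp]: "log_series \<sigma> $ 0 = 0"
  by (simp add: log_series_def)

lemma htilde_fexp: "htilde \<sigma> k = fexp (log_series \<sigma>) $ k"
  unfolding htilde_def fps_compose_nth fexp_def fsum_def fps_nth_Abs_fps atLeast0AtMost
  by (rule sum.cong) (simp_all add: uexp_def qscale_eq dpow_def)

lemma htilde_W: "htilde \<sigma> k = (- 1) ^ k * W (pgh \<sigma>) $ k"
  unfolding htilde_fexp by (rule fexp_alternating) (simp_all add: log_series_nth)

lemma minus_1_power_mem: "is_subring R \<Longrightarrow> (- 1) ^ k * a \<in> R \<longleftrightarrow> a \<in> R"
  using is_subringD(4)[of R a] is_subringD(4)[of R "- a"] by (cases "even k") auto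

text \<open>One commutative subalgebra for each sign, since the bracket of h_r and h_(-r) is a
  multiple of c. The scalars are adjoined because logarithms need denominators.\<close>

definition Csub :: "pmsign \<Rightarrow> uea set"
  where "Csub \<sigma> = subring_gen ({h_el (sgn_of \<sigma> * int r) | r. True} \<union> range qof)"

lemma commuting_subalgebra_Csub: "commuting_subalgebra (Csub \<sigma>)"
proof
  show C: "is_subring (Csub \<sigma>)" unfolding Csub_def by (rule is_subring_subring_gen)
  show "a * b = b * a" if "a \<in> Csub \<sigma>" "b \<in> Csub \<sigma>" for a b
  proof (rule subring_gen_commute[OF _ that[unfolded Csub_def]])
    fix a b :: uea
    have "h_el (sgn_of \<sigma> * int i) * h_el (sgn_of \<sigma> * int j) = h_el (sgn_of \<sigma> * int j) * h_el (sgn_of \<sigma> * int i)" for i j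
    proof -
      have "kdelta (sgn_of \<sigma> * int i + sgn_of \<sigma> * int j) * (2 * (sgn_of \<sigma> * int i) * (2 + alt (sgn_of \<sigma> * int i - 1))) = 0"
        by (cases \<sigma>) (auto simp: kdelta_def)
      then show ?thesis
        using h_h[of "sgn_of \<sigma> * int i" "sgn_of \<sigma> * int j"] by (simp only: of_int_0 mult_zero_left add_0_right)
    qed
    moreover assume "a \<in> {h_el (sgn_of \<sigma> * int r) |r. True} \<union> range qof"
      "b \<in> {h_el (sgn_of \<sigma> * int r) |r. True} \<union> range qof"
    ultimately show "a * b = b * a"
      using qof_central[where 'a = uea] by auto
  qed
  show "qof q * a \<in> Csub \<sigma>" if "a \<in> Csub \<sigma>" for q a
  proof -
    have "qof q \<in> Csub \<sigma>"
      unfolding Csub_def by (rule subring_gen.base) blast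
    then show ?thesis by (rule is_subringD(6)[OF C _ that])
  qed
qed

lemma pgh_in_Csub: "pgh \<sigma> r \<in> Csub \<sigma>"
  unfolding pgh_def Csub_def
  by (intro is_subringD(6)[OF is_subring_subring_gen] is_subring_of_int[OF is_subring_subring_gen] subring_gen.base) blast

context commuting_subalgebra
begin

lemma W_in_C: "(\<And>r. p r \<in> C) \<Longrightarrow> W p $ n \<in> C"
proof -
  assume p: "\<And>r. p r \<in> C"
  have "coeffs_in C (Wlog p)" using p C_closed by (auto simp: coeffs_in_def Wlog_nth C_qof)
  then have "coeffs_in C (Wlog p ^ k)" for k
    using is_subring_power[OF is_subring_coeffs_in[OF C], of "Wlog p" k] by simp
  then show "W p $ n \<in> C"
    unfolding W_def fexp_def fsum_def fps_nth_Abs_fps dpow_def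
    by (intro is_subring_sum[OF C]) (auto simp: coeffs_in_def C_qof)
qed

end

text \<open>With all indices this is the ring in which the Cartan factors are expressed; with
  \<open>{..<k}\<close> it serves the induction for \<open>htilde_in_UZ\<close>.\<close>

definition Rht :: "pmsign \<Rightarrow> nat set \<Rightarrow> uea set"
  where "Rht \<sigma> A = subring_gen {htilde \<sigma> k | k. k \<in> A}"

lemma subring_Rht: "is_subring (Rht \<sigma> A)"
  unfolding Rht_def by (rule is_subring_subring_gen)

lemma htilde_in_Csub: "htilde \<sigma> k \<in> Csub \<sigma>"
proof -
  interpret commuting_subalgebra "Csub \<sigma>" by (rule commuting_subalgebra_Csub)
  show ?thesis
    unfolding htilde_W minus_1_power_mem[OF C] by (rule W_in_C) (rule pgh_in_Csub)
qed

lemma Rht_subset_Csub: "Rht \<sigma> A \<subseteq> Csub \<sigma>"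
proof -
  interpret commuting_subalgebra "Csub \<sigma>" by (rule commuting_subalgebra_Csub)
  show ?thesis
    unfolding Rht_def by (rule subring_gen_subset[OF C]) (auto intro: htilde_in_Csub)
qed

lemma W_pgh_in_Rht: "n \<in> A \<Longrightarrow> W (pgh \<sigma>) $ n \<in> Rht \<sigma> A"
  using minus_1_power_mem[OF subring_Rht, of n "W (pgh \<sigma>) $ n"]
  by (auto simp: htilde_W[symmetric] Rht_def intro: subring_gen.base)

lemma b_even_nth: "b_even $ n = (- 1) ^ n"
proof (induction n)
  case (Suc n)
  have "(b_even * (1 + fps_X)) $ Suc n = b_even $ Suc n + b_even $ n"
    by (simp add: distrib_left)
  then show ?case using Suc by (simp add: b_even)
qed simp

lemma eta_even_nth: "0 < n \<Longrightarrow> eta_even $ n = (- 1) ^ (n - 1) / of_nat n"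
  by (simp add: eta_even_def b_even_nth)

lemma eta_odd_nth: "0 < n \<Longrightarrow> (eta_odd0 + eta_odd1) $ n = (- 1) ^ (n - 1) / of_nat n * of_int (dseq n)"
proof -
  define D :: "rat fps" where "D = Abs_fps (\<lambda>n. if n = 0 then 0 else (- 1) ^ (n - 1) * of_int (dseq n))"
  \<comment> \<open>With signs, the recursion of \<open>dseq\<close> says that D times 1 + 2u - u^2
    is u (1 - u).\<close>
  have D: "D = fps_X * (b_odd0 + b_odd1)"
  proof (rule fps_cancel)
    show "(1 + 2 * fps_X - fps_X\<^sup>2) $ 0 = (1 :: rat)" by simp
    have "D * (1 + 2 * fps_X - fps_X\<^sup>2) = fps_X * (1 - fps_X)"
    proof (rule fps_ext)
      fix n
      have "(D * (1 + 2 * fps_X - fps_X\<^sup>2)) $ n = D $ n + 2 * (D * fps_X) $ n - (D * fps_X\<^sup>2) $ n"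
        by (simp add: right_diff_distrib distrib_left mult.left_commute[of D] fps_numeral_fps_const)
      also have "\<dots> = D $ n + 2 * (if n = 0 then 0 else D $ (n - 1)) - (if n < 2 then 0 else D $ (n - 2))"
        by (simp add: fps_X_power_mult_right_nth)
      also have "\<dots> = (fps_X * (1 - fps_X)) $ n"
      proof -
        consider "n = 0" | "n = Suc 0" | "n = Suc (Suc 0)" | k where "n = Suc (Suc (Suc k))"
          by (metis not0_implies_Suc)
        then show ?thesis
          by cases (simp_all add: D_def algebra_simps)
      qed
      finally show "(D * (1 + 2 * fps_X - fps_X\<^sup>2)) $ n = (fps_X * (1 - fps_X)) $ n" .
    qed
    also have "\<dots> = fps_X * (b_odd0 + b_odd1) * (1 + 2 * fps_X - fps_X\<^sup>2)"
      by (simp only: mult.assoc b_odd)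
    finally show "D * (1 + 2 * fps_X - fps_X\<^sup>2) = fps_X * (b_odd0 + b_odd1) * (1 + 2 * fps_X - fps_X\<^sup>2)" .
  qed
  assume "0 < n"
  then have "(fps_X * (b_odd0 + b_odd1)) $ n = (- 1) ^ (n - 1) * of_int (dseq n)"
    unfolding D[symmetric] by (simp add: D_def)
  then show ?thesis
    by (simp add: eta_odd0_def eta_odd1_def distrib_left add_divide_distrib[symmetric] add.commute)
qed

lemma Hser_W:
  assumes rs: "r + s = sgn_of \<sigma> * int m" and m: "0 < m"
  shows "Hser r s $ j = (- 1) ^ j * W (\<lambda>j. qof (gseq m j) * pgh \<sigma> (m * j)) $ j"
  unfolding Hser_def
proof (rule fexp_alternating)
  fix n :: nat assume n: "0 < n"
  have hh: "hh r s n = h_el (sgn_of \<sigma> * int (m * n))"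
    using m by (cases \<sigma>) (auto simp: hh_def rs kdelta_def mult.assoc)
  have "even (r + s) \<longleftrightarrow> even m" unfolding rs by (cases \<sigma>) auto
  then have eta: "eta r s $ n = (- 1) ^ (n - 1) / of_nat n * (if even m then 1 else of_int (dseq n))"
    using eta_even_nth[OF n] eta_odd_nth[OF n] by (simp add: eta_def)
  have "(of_int (eps (m * n)) * (if even m then 1 else of_int (dseq n))) * of_int (eps (m * n))
      = (if even m then 1 else of_int (dseq n) :: rat)"
    by (simp add: eps_def)
  then have "qof (gseq m n) * pgh \<sigma> (m * n) = qof (if even m then 1 else of_int (dseq n)) * h_el (sgn_of \<sigma> * int (m * n))"
  proof -
    have "qof g * (of_int z * y) = qof (g * of_int z) * y" for g z and y :: uea
      by (simp only: qof_mult qof_of_int mult.assoc)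
    with \<open>_ = (if even m then 1 else of_int (dseq n) :: rat)\<close> show ?thesis
      unfolding pgh_def gseq_def by (simp only: )
  qed
  then show "ser (eta r s) (hh r s) $ n = qof ((- 1) ^ (n - 1) / of_nat n) * (qof (gseq m n) * pgh \<sigma> (m * n))"
    by (simp only: ser_nth eta hh qof_mult mult.assoc)
qed (simp add: ser_nth eta_def)

lemma W_Bseq:
  assumes m: "0 < m"
  shows "W (\<lambda>r. qof (Bseq m r) * pgh \<sigma> r) $ (m * j) = W (\<lambda>j. qof (gseq m j) * pgh \<sigma> (m * j)) $ j"
proof -
  have "(\<lambda>r. qof (Bseq m r) * pgh \<sigma> r)
      = (\<lambda>r. if m dvd r then of_nat m * (qof (gseq m (r div m)) * pgh \<sigma> (m * (r div m))) else 0)"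
    by (rule ext) (simp add: Bseq_def qof_mult mult.assoc)
  then have "W (\<lambda>r. qof (Bseq m r) * pgh \<sigma> r) = spread m (W (\<lambda>j. qof (gseq m j) * pgh \<sigma> (m * j)))"
    using W_spread[OF m, of "\<lambda>j. qof (gseq m j) * pgh \<sigma> (m * j)"] by simp
  then show ?thesis using m by (simp add: spread_nth)
qed

text \<open>\<open>pgh\<close> is a ghost sequence over this ring by the very definition of
  \<open>htilde\<close>, and \<open>Bseq\<close> is integral, so \<open>ghosts_mult\<close>
  applies.\<close>

lemma Hser_in_Rht:
  assumes rs: "r + s = sgn_of \<sigma> * int m" and m: "0 < m"
  shows "Hser r s $ j \<in> Rht \<sigma> UNIV"
proof -
  interpret commuting_subalgebra "Csub \<sigma>" by (rule commuting_subalgebra_Csub)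
  have "pgh \<sigma> \<in> ghosts (Rht \<sigma> UNIV)"
    by (simp add: ghosts_def coeffs_in_def pgh_in_Csub W_pgh_in_Rht)
  from ghosts_mult[OF subring_Rht Rht_subset_Csub this int_ghosts_Bseq[OF m]]
  have "W (\<lambda>r. qof (Bseq m r) * pgh \<sigma> r) $ (m * j) \<in> Rht \<sigma> UNIV"
    by (simp add: ghosts_def coeffs_in_def)
  then show ?thesis
    unfolding Hser_W[OF rs m] minus_1_power_mem[OF subring_Rht] W_Bseq[OF m] .
qed

section \<open>Divisibility of the weights, and the \<open>htilde\<close> in
  \<open>UZ\<close>\<close>

lemma one_in_int_subgroup:
  fixes I :: "int set"
  assumes diff: "\<And>a b. a \<in> I \<Longrightarrow> b \<in> I \<Longrightarrow> a - b \<in> I"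
    and prime: "\<And>q :: nat. prime q \<Longrightarrow> \<exists>z\<in>I. \<not> int q dvd z"
  shows "1 \<in> I"
proof -
  obtain z where z: "z \<in> I" "\<not> int 2 dvd z" using prime[of 2] two_is_prime_nat by blast
  have 0: "0 \<in> I" using diff[OF z(1) z(1)] by simp
  have minus: "- a \<in> I" if "a \<in> I" for a using diff[OF 0 that] by simp
  have add: "a + b \<in> I" if "a \<in> I" "b \<in> I" for a b using diff[OF that(1) minus[OF that(2)]] by simp
  have nat_mult: "int n * a \<in> I" if "a \<in> I" for n a
    by (induction n) (auto simp: 0 distrib_right intro: add that)
  have mult: "k * a \<in> I" if "a \<in> I" for k a
    using nat_mult[OF that, of "nat k"] minus[OF nat_mult[OF that, of "nat (- k)"]] by (cases "0 \<le> k") auto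
  have "\<exists>n. 0 < n \<and> int n \<in> I"
  proof (rule exI[of _ "nat \<bar>z\<bar>"])
    have "z \<noteq> 0" using z(2) by auto
    then show "0 < nat \<bar>z\<bar> \<and> int (nat \<bar>z\<bar>) \<in> I" using z(1) minus[OF z(1)] by (auto simp: abs_if)
  qed
  then obtain n where n: "0 < n" "int n \<in> I" and least: "\<And>k. k < n \<Longrightarrow> \<not> (0 < k \<and> int k \<in> I)"
    using exists_least_iff[of "\<lambda>n. 0 < n \<and> int n \<in> I"] by blast
  have dvd: "int n dvd a" if "a \<in> I" for a
  proof -
    have "a mod int n = a - a div int n * int n" by (simp add: minus_div_mult_eq_mod)
    then have "a mod int n \<in> I" using diff[OF that mult[OF n(2)]] by simp
    moreover have "0 \<le> a mod int n" "a mod int n < int n" using n by simp_all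
    ultimately have "a mod int n = 0"
      using least[of "nat (a mod int n)"] by (cases "a mod int n = 0") (auto simp: nat_less_iff)
    then show ?thesis by auto
  qed
  have "n = 1"
  proof (rule ccontr)
    assume "n \<noteq> 1"
    then obtain q where q: "prime q" "q dvd n" using prime_factor_nat by blast
    then obtain a where "a \<in> I" "\<not> int q dvd a" using prime by blast
    moreover have "int q dvd int n" using q(2) by simp
    ultimately show False using dvd dvd_trans by blast
  qed
  then show ?thesis using n by simp
qed

text \<open>For even k, m = 1 gives an odd number, which settles q = 2, and m = 2 gives \<plusminus>
  2, which settles odd q. For odd k, m is the part of k prime to q, and the weight at the remaining
  power of q is 1 modulo q.\<close>

lemma Bseq_gcd:
  assumes k: "0 < k" and q: "prime q"
  shows "\<exists>m z. 0 < m \<and> m dvd k \<and> Bseq m k = of_int z \<and> \<not> int q dvd z"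
proof (cases "even k")
  case True
  show ?thesis
  proof (cases "q = 2")
    case True
    have "Bseq 1 k = of_int (eps k * dseq k)" by (simp add: Bseq_def gseq_def)
    moreover have "\<not> int q dvd eps k * dseq k" using odd_dseq[of k] True by (auto simp: eps_def)
    ultimately show ?thesis by (intro exI[of _ 1] exI conjI) auto
  next
    case False
    have "Bseq 2 k = of_int (2 * eps k)" using True by (simp add: Bseq_def gseq_def)
    moreover have "\<not> int q dvd 2 * eps k"
    proof
      assume "int q dvd 2 * eps k"
      then have "int q dvd int 2" by (auto simp: eps_def split: if_splits)
      then have "q dvd 2" by (simp only: int_dvd_int_iff)
      then show False using False q by (metis primes_dvd_imp_eq two_is_prime_nat)
    qed
    ultimately show ?thesis using True by (intro exI[of _ 2] exI conjI) auto
  qed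
next
  case False
  obtain m where m: "k = q ^ multiplicity q k * m" "\<not> q dvd m"
    using multiplicity_decompose'[of k q] k q by (metis not_gr_zero not_prime_unit)
  let ?a = "multiplicity q k"
  have m0: "0 < m" using m(1) k by (cases m) auto
  have mk: "m dvd k" using m(1) by (metis dvd_triv_right)
  have "odd m" using False mk by (metis dvd_trans)
  then have "\<not> 4 dvd m" using dvd_trans[of 2 4 m] by auto
  then have "gseq m 1 = 1" using \<open>odd m\<close> by (simp add: gseq_def eps_def)
  from int_ghosts_prime_power[OF int_ghosts_gseq this q, of ?a]
  obtain z where z: "gseq m (q ^ ?a) = 1 + of_nat q * of_int z" by blast
  have "k div m = q ^ ?a" using m m0 by (metis nonzero_mult_div_cancel_right not_gr_zero)
  then have "Bseq m k = of_int (int m * (1 + int q * z))"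
    using mk z by (simp add: Bseq_def)
  moreover have "\<not> int q dvd int m * (1 + int q * z)"
  proof
    assume "int q dvd int m * (1 + int q * z)"
    then have "int q dvd int m \<or> int q dvd 1 + int q * z"
      using q by (simp add: prime_dvd_mult_iff)
    moreover have "\<not> int q dvd int m" using m(2) by simp
    ultimately have "int q dvd 1" by (metis dvd_add_left_iff dvd_triv_left)
    then show False using q by (simp add: prime_gt_1_nat not_prime_unit)
  qed
  ultimately show ?thesis using m0 mk by blast
qed

text \<open>Modulo smaller indices only one element e is in question. The integers z with z e in
  \<open>UZ\<close> form a subgroup, and by \<open>Bseq_gcd\<close> no prime divides all of
  them.\<close>

theorem htilde_in_UZ: "htilde \<sigma> k \<in> UZ"
proof (induction k rule: less_induct)
  case (less k)
  interpret commuting_subalgebra "Csub \<sigma>" by (rule commuting_subalgebra_Csub)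
  show ?case
  proof (cases "k = 0")
    case True
    then show ?thesis by (simp add: htilde_W is_subringD[OF subring_UZ])
  next
    case False
    let ?R = "Rht \<sigma> {..<k}"
    note R = subring_Rht[of \<sigma> "{..<k}"] Rht_subset_Csub[of \<sigma> "{..<k}"]
    have RU: "?R \<subseteq> UZ"
      unfolding Rht_def by (rule subring_gen_subset[OF subring_UZ]) (auto intro: less)
    \<comment> \<open>The Witt components below k involve only \<open>htilde\<close> of smaller
      index. The sequence p built from them agrees with \<open>pgh\<close> below k, and its series
      is integral over \<open>?R\<close> in every degree, so e isolates what is new at degree
      k.\<close>
    have "\<exists>a. (\<forall>i. a i \<in> ?R) \<and> (\<forall>r. 0 < r \<longrightarrow> r \<le> k - 1 \<longrightarrow> pgh \<sigma> r = (\<Sum>i=1..k - 1. Teich i (a i) r))"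
      by (rule Dwork[OF R]) (use False in \<open>auto intro: pgh_in_Csub W_pgh_in_Rht\<close>)
    then obtain a where a: "\<And>i. a i \<in> ?R"
      and pgh: "\<And>r. 0 < r \<Longrightarrow> r \<le> k - 1 \<Longrightarrow> pgh \<sigma> r = (\<Sum>i=1..k - 1. Teich i (a i) r)"
      by blast
    define p where "p r = (\<Sum>i=1..k - 1. Teich i (a i) r)" for r
    have p: "p \<in> ghosts ?R"
      unfolding p_def by (rule ghosts_sum[OF R]) (auto intro: ghosts_Teich[OF R] a)
    have pgh_p: "pgh \<sigma> r = p r" if "0 < r" "r < k" for r
      unfolding p_def by (rule pgh) (use that in auto)
    have pC: "p r \<in> Csub \<sigma>" for r using p by (simp add: ghosts_def)
    define e where "e = W (pgh \<sigma>) $ k - W p $ k"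
    have e: "e = qof (- 1 / of_nat k) * (pgh \<sigma> k - p k)"
      unfolding e_def by (rule W_diff) (use False in \<open>auto intro: pgh_in_Csub pC simp: pgh_p\<close>)
    \<comment> \<open>Weighting both \<open>pgh\<close> and p by \<open>Bseq m\<close> gives series
      that differ at degree k by this element. The first is a Cartan factor in \<open>UZ\<close>,
      the second is integral by \<open>ghosts_mult\<close>.\<close>
    have mem: "qof (Bseq m k) * e \<in> UZ" if m: "0 < m" "m dvd k" for m
    proof -
      obtain j where j: "k = m * j" using m(2) by blast
      have "W (\<lambda>r. qof (Bseq m r) * pgh \<sigma> r) $ k - W (\<lambda>r. qof (Bseq m r) * p r) $ k
          = qof (- 1 / of_nat k) * (qof (Bseq m k) * pgh \<sigma> k - qof (Bseq m k) * p k)"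
        by (rule W_diff) (use False in \<open>auto intro: C_qof pgh_in_Csub pC simp: pgh_p\<close>)
      also have "\<dots> = qof (Bseq m k) * e"
        unfolding e by (simp only: right_diff_distrib[symmetric] qof_left_commute[of "qof (- 1 / of_nat k)"])
      finally have "qof (Bseq m k) * e
          = W (\<lambda>r. qof (Bseq m r) * pgh \<sigma> r) $ k - W (\<lambda>r. qof (Bseq m r) * p r) $ k" ..
      moreover have "W (\<lambda>r. qof (Bseq m r) * p r) $ k \<in> UZ"
        using ghosts_mult[OF R p int_ghosts_Bseq[OF m(1)]] RU by (auto simp: ghosts_def coeffs_in_def)
      moreover have "W (\<lambda>r. qof (Bseq m r) * pgh \<sigma> r) $ k \<in> UZ"
        using Hser_in_UZ[of 0 "sgn_of \<sigma> * int m" j] Hser_W[of 0 "sgn_of \<sigma> * int m" \<sigma> m j] m(1)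
        unfolding j W_Bseq[OF m(1)] by (simp add: minus_1_power_mem[OF subring_UZ])
      ultimately show ?thesis by (auto intro: is_subringD[OF subring_UZ])
    qed
    have "1 \<in> {z. of_int z * e \<in> UZ}"
    proof (rule one_in_int_subgroup)
      fix q :: nat assume "prime q"
      then obtain m z where "0 < m" "m dvd k" "Bseq m k = of_int z" "\<not> int q dvd z"
        using Bseq_gcd[of k q] False by blast
      then show "\<exists>z\<in>{z. of_int z * e \<in> UZ}. \<not> int q dvd z"
        using mem[of m] by auto
    qed (auto simp: left_diff_distrib intro: is_subringD[OF subring_UZ])
    then have "e \<in> UZ" by simp
    moreover have "W p $ k \<in> UZ" using p RU by (auto simp: ghosts_def coeffs_in_def)
    ultimately have "W (pgh \<sigma>) $ k \<in> UZ"
      using is_subringD(5)[OF subring_UZ, of e "W p $ k"] by (simp add: e_def)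
    then show ?thesis unfolding htilde_W minus_1_power_mem[OF subring_UZ] .
  qed
qed

subsection \<open>Binomials\<close>

lemma ubinom_0 [simp]: "ubinom y 0 = 1"
  by (simp add: ubinom_def qscale_eq)

lemma ubinom_Suc: "of_nat (Suc k) * ubinom y (Suc k) = ubinom y k * (y - of_nat k)"
proof -
  let ?P = "\<lambda>k. prod_list (map (\<lambda>i. y - of_nat i) [0..<k])"
  have P: "?P (Suc k) = ?P k * (y - of_nat k)" by simp
  have "of_nat (Suc k) * ubinom y (Suc k) = qof (of_nat (Suc k) * (1 / fact (Suc k))) * (?P k * (y - of_nat k))"
    by (simp only: ubinom_def qscale_eq qof_mult qof_of_nat mult.assoc P)
  also have "of_nat (Suc k) * (1 / fact (Suc k)) = (1 / fact k :: rat)"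
    by (simp del: of_nat_Suc)
  finally show ?thesis by (simp only: ubinom_def qscale_eq mult.assoc)
qed

lemma ubinom_unique:
  assumes "B 0 = 1" "\<And>k. of_nat (Suc k) * B (Suc k) = B k * (y - of_nat k)"
  shows "B k = ubinom y k"
proof (induction k)
  case (Suc k)
  have "of_nat (Suc k) * B (Suc k) = of_nat (Suc k) * ubinom y (Suc k)"
    by (simp only: assms(2) ubinom_Suc Suc)
  then show ?case by (rule of_nat_mult_cancel) simp
qed (simp add: assms)

text \<open>The series (1 + u)^y, because \<open>eta_even\<close> is log (1 + u).\<close>

definition Bin :: "uea \<Rightarrow> uea fps"
  where "Bin y = fexp (ser eta_even (\<lambda>_. y))"

lemma ser_const_commute: "x * y = y * x \<Longrightarrow> ser f (\<lambda>_. x) * ser g (\<lambda>_. y) = ser g (\<lambda>_. y) * ser f (\<lambda>_. x)"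
  by (rule fps_commute_coeffs) (simp add: ser_nth qof_mult_commute)

text \<open>Comparing coefficients in (1 + u) dF/du = y F gives the recursion of the
  binomials.\<close>

lemma Bin_nth: "Bin y $ k = ubinom y k"
proof (rule ubinom_unique)
  define G where "G = ser b_even (\<lambda>_. y)"
  have XG: "ser (fps_X * b_even) (\<lambda>_. y) = fps_X * G"
    using ser_shift[of b_even "\<lambda>_. y"] by (simp add: G_def)
  have G: "(1 + fps_X) * G = fps_const y"
  proof (rule fps_ext)
    fix n
    show "((1 + fps_X) * G) $ n = fps_const y $ n"
      by (cases n) (simp_all add: distrib_right G_def ser_nth b_even_nth qof_minus)
  qed
  have "fps_XD (Bin y) = fps_XD (ser eta_even (\<lambda>_. y)) * Bin y"
    unfolding Bin_def
    by (rule coeff_derivation_fexp[OF coeff_derivation_XD])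
      (simp_all add: ser_nth ser_XD ser_const_commute)
  then have XD: "fps_XD (Bin y) = fps_X * G * Bin y"
    by (simp only: ser_XD XD_eta_even XG)
  have "(1 + fps_X) * fps_XD (Bin y) = fps_X * ((1 + fps_X) * G) * Bin y"
    unfolding XD by (simp add: distrib_left distrib_right mult.assoc)
  then have XD': "(1 + fps_X) * fps_XD (Bin y) = fps_X * (fps_const y * Bin y)"
    by (simp only: G mult.assoc)
  have "Bin y * fps_const y = fps_const y * Bin y"
    unfolding Bin_def by (rule fexp_commute, simp add: ser_nth, rule fps_commute_coeffs)
      (simp add: ser_nth mult.assoc qof_left_commute)
  then have comm: "Bin y $ k * y = y * Bin y $ k" for k
    by (metis fps_mult_left_const_nth fps_mult_right_const_nth)
  fix k
  have "of_nat (Suc k) * Bin y $ Suc k + of_nat k * Bin y $ k = y * Bin y $ k"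
    using arg_cong[OF XD', of "\<lambda>f. f $ Suc k"] by (simp add: distrib_right del: of_nat_Suc)
  then have "of_nat (Suc k) * Bin y $ Suc k = y * Bin y $ k - of_nat k * Bin y $ k"
    by (simp only: eq_diff_eq)
  then show "of_nat (Suc k) * Bin y $ Suc k = Bin y $ k * (y - of_nat k)"
    by (simp only: right_diff_distrib comm mult_of_nat_commute[of k])
qed (simp add: Bin_def)

lemma Bin_0: "Bin 0 = 1"
proof -
  have "ser eta_even (\<lambda>_. 0) = (0 :: uea fps)" by (rule fps_ext) (simp add: ser_nth)
  then show ?thesis by (simp add: Bin_def)
qed

lemma Bin_add: "y * z = z * y \<Longrightarrow> Bin (y + z) = Bin y * Bin z"
proof -
  assume "y * z = z * y"
  moreover have "ser eta_even (\<lambda>_. y + z) = ser eta_even (\<lambda>_. y) + ser eta_even (\<lambda>_. z)"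
    by (rule fps_ext) (simp add: ser_nth distrib_left)
  ultimately show ?thesis
    by (simp add: Bin_def fexp_add ser_nth ser_const_commute)
qed

text \<open>Integer multiples of y become powers of the series, and inverses stay over R.\<close>

lemma Bin_of_int_mult:
  assumes R: "is_subring R" and y: "coeffs_in R (Bin y)"
  shows "coeffs_in R (Bin (of_int n * y))"
proof -
  have nat: "coeffs_in R (Bin (of_nat k * y))" for k
  proof (induction k)
    case (Suc k)
    have "Bin (of_nat k * y + y) = Bin (of_nat k * y) * Bin y"
      by (rule Bin_add) (simp add: mult.assoc mult_of_nat_commute[of k])
    then show ?case using Suc y by (simp add: distrib_right add.commute coeffs_in_closed[OF R])
  qed (simp add: Bin_0 coeffs_in_closed[OF R])
  have minus: "coeffs_in R (Bin (- z))" if "coeffs_in R (Bin z)" for z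
  proof (rule coeffs_in_inverse[OF R that])
    show "Bin z * Bin (- z) = 1" using Bin_add[of z "- z"] by (simp add: Bin_0)
  qed (simp add: Bin_nth)
  show ?thesis
  proof (cases "0 \<le> n")
    case True
    then show ?thesis using nat[of "nat n"] by simp
  next
    case False
    then have "of_int n * y = - (of_nat (nat (- n)) * y)" by simp
    then show ?thesis using minus[OF nat[of "nat (- n)"]] by simp
  qed
qed

lemma subring_range_of_int: "is_subring (range (of_int :: int \<Rightarrow> uea))"
  unfolding is_subring_def
proof (intro conjI ballI)
  show "1 \<in> range (of_int :: int \<Rightarrow> uea)" by (metis of_int_1 rangeI)
  fix a b :: uea assume "a \<in> range of_int" "b \<in> range of_int"
  then obtain i j where "a = of_int i" "b = of_int j" by blast
  then show "a - b \<in> range of_int" "a * b \<in> range of_int"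
    by (simp_all flip: of_int_diff of_int_mult)
qed

text \<open>The case y = 1 of \<open>Bin_of_int_mult\<close>, where the series is 1 + u.\<close>

lemma ubinom_of_int: "ubinom (of_int n) k \<in> range of_int"
proof -
  have 0: "ubinom 1 (Suc (Suc k)) = 0" for k
  proof (induction k)
    case 0
    have "of_nat (Suc (Suc 0)) * ubinom 1 (Suc (Suc 0)) = (of_nat (Suc (Suc 0)) * 0 :: uea)"
      using ubinom_Suc[of "Suc 0" 1] by simp
    then show ?case by (rule of_nat_mult_cancel) simp
  next
    case (Suc k)
    have "of_nat (Suc (Suc (Suc k))) * ubinom 1 (Suc (Suc (Suc k))) = (of_nat (Suc (Suc (Suc k))) * 0 :: uea)"
      using ubinom_Suc[of "Suc (Suc k)" 1] Suc by (simp del: of_nat_Suc)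
    then show ?case by (rule of_nat_mult_cancel) simp
  qed
  have 1: "ubinom 1 (Suc 0) = 1" using ubinom_Suc[of 0 1] by simp
  have "coeffs_in (range of_int) (Bin 1)"
    unfolding coeffs_in_def
  proof
    fix k
    consider "k = 0" | "k = Suc 0" | j where "k = Suc (Suc j)" by (metis not0_implies_Suc)
    then show "Bin 1 $ k \<in> range of_int"
      by cases (simp_all only: Bin_nth ubinom_0 0 1 is_subringD[OF subring_range_of_int])
  qed
  from Bin_of_int_mult[OF subring_range_of_int this, of n] show ?thesis
    by (simp add: coeffs_in_def Bin_nth)
qed

lemma Hser_Bin: "r + s = 0 \<Longrightarrow> Hser r s = Bin (h_el 0 + of_int r * c_el)"
proof -
  assume rs: "r + s = 0"
  then have "hh r s = (\<lambda>_. h_el 0 + of_int r * c_el)" by (auto simp: hh_def kdelta_def fun_eq_iff)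
  with rs show ?thesis by (simp add: Hser_def Bin_def eta_def)
qed

lemma htilde_in_UZ_0: "htilde \<sigma> k \<in> UZ_0"
proof (cases "k = 0")
  case True
  then show ?thesis by (simp add: htilde_W is_subringD[OF subring_UZ_0])
next
  case False
  then show ?thesis unfolding UZ_0_def by (intro subring_gen.base) blast
qed

lemma Bin_in_UZ_0: "coeffs_in UZ_0 (Bin (h_el 0))" "coeffs_in UZ_0 (Bin c_el)"
  unfolding coeffs_in_def Bin_nth UZ_0_def by (auto intro!: subring_gen.base)

lemma Hser_in_UZ_0: "Hser r s $ j \<in> UZ_0"
proof (cases "r + s = 0")
  case True
  have "Hser r s = Bin (h_el 0) * Bin (of_int r * c_el)"
    unfolding Hser_Bin[OF True]
    by (rule Bin_add) (rule of_int_c_commute[OF c_commute(1)[symmetric]])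
  then have "coeffs_in UZ_0 (Hser r s)"
    using Bin_in_UZ_0 by (simp add: coeffs_in_closed[OF subring_UZ_0] Bin_of_int_mult[OF subring_UZ_0])
  then show ?thesis by (simp add: coeffs_in_def)
next
  case False
  have "\<exists>\<sigma> m. r + s = sgn_of \<sigma> * int m \<and> 0 < m"
  proof (cases "0 < r + s")
    case True
    then show ?thesis by (intro exI[of _ PlusS] exI[of _ "nat (r + s)"]) simp
  next
    case neg: False
    then show ?thesis using False by (intro exI[of _ MinusS] exI[of _ "nat (- (r + s))"]) simp
  qed
  then obtain \<sigma> m where "r + s = sgn_of \<sigma> * int m" "0 < m" by blast
  then have "Hser r s $ j \<in> Rht \<sigma> UNIV" by (rule Hser_in_Rht)
  moreover have "Rht \<sigma> UNIV \<subseteq> UZ_0"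
    unfolding Rht_def by (rule subring_gen_subset[OF subring_UZ_0]) (auto intro: htilde_in_UZ_0)
  ultimately show ?thesis by blast
qed

text \<open>The binomials of c come from a quotient of Cartan factors: (r, s) = (1, -1) gives (1 +
  u)^(h_0 + c), and (0, 0) gives (1 + u)^(h_0).\<close>

theorem UZ_0_subset_UZ: "UZ_0 \<subseteq> UZ"
proof -
  have h: "coeffs_in UZ (Bin (h_el 0))"
    using Hser_in_UZ[of 0 0] by (simp add: coeffs_in_def Hser_Bin)
  have hc: "coeffs_in UZ (Bin (h_el 0 + c_el))"
    using Hser_in_UZ[of 1 "- 1"] by (simp add: coeffs_in_def Hser_Bin)
  have "Bin (of_int (- 1) * h_el 0 + (h_el 0 + c_el)) = Bin (of_int (- 1) * h_el 0) * Bin (h_el 0 + c_el)"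
    by (rule Bin_add) (simp add: distrib_left distrib_right c_commute)
  then have "coeffs_in UZ (Bin c_el)"
    using coeffs_in_closed(6)[OF subring_UZ Bin_of_int_mult[OF subring_UZ h, of "- 1"] hc] by simp
  then show ?thesis
    unfolding UZ_0_def using h
    by (intro subring_gen_subset[OF subring_UZ]) (auto simp: coeffs_in_def Bin_nth htilde_in_UZ)
qed

subsection \<open>Commuting the Cartan part past the nilpotent parts\<close>

text \<open>The argument of \<open>fexp_graded\<close> for one divided power, with all coefficients
  of A counted in the same degree.\<close>

lemma dpow_graded:
  fixes A :: "'a::rat_algebra fps"
  assumes K: "graded_family K" and comm: "\<And>i j. A $ i * A $ j = A $ j * A $ i"
    and dpow: "\<And>j i. dpow (A $ j) i \<in> K i"
  shows "dpow A n $ m \<in> K n"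
proof -
  define T where "T N = (\<Sum>j<N. fps_const (A $ j) * fps_X ^ j)" for N
  have T_nth: "T N $ i = (if i < N then A $ i else 0)" for N i
  proof -
    have "T N $ i = (\<Sum>j<N. if j = i then A $ i else 0)"
      unfolding T_def fps_sum_nth by (rule sum.cong) auto
    then show ?thesis by simp
  qed
  have T: "dpow (T N) n $ m \<in> K n" for N n m
  proof (induction N arbitrary: n m)
    case 0
    show ?case
      using graded_familyD(1,2)[OF K] by (cases n; cases m) (simp_all add: T_def dpow_0_left)
  next
    case (Suc N)
    let ?M = "fps_const (A $ N) * fps_X ^ N"
    have "T (Suc N) = T N + ?M" by (simp add: T_def)
    also have "dpow \<dots> n = (\<Sum>i\<le>n. dpow (T N) (n - i) * dpow ?M i)"
      by (rule dpow_add, rule fps_commute_coeffs) (auto simp: T_nth comm)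
    finally have "dpow (T (Suc N)) n $ m = (\<Sum>i\<le>n. \<Sum>j=0..m. dpow (T N) (n - i) $ j * dpow ?M i $ (m - j))"
      by (simp only: fps_sum_nth fps_mult_nth)
    also have "\<dots> \<in> K n"
    proof (intro graded_family_sum[OF K])
      fix i j assume i: "i \<in> {..n}"
      have "dpow ?M i $ (m - j) \<in> K i"
        using dpow[of N i] graded_familyD(2)[OF K] by (simp add: dpow_const_X_power)
      from graded_familyD(5)[OF K Suc.IH[of "n - i" j] this] i
      show "dpow (T N) (n - i) $ j * dpow ?M i $ (m - j) \<in> K n" by simp
    qed
    finally show ?case .
  qed
  define B where "B = A - T (Suc m)"
  have B_nth: "B $ i = (if i \<le> m then 0 else A $ i)" for i
    by (simp add: B_def T_nth)
  have "dpow A n = (\<Sum>i\<le>n. dpow (T (Suc m)) (n - i) * dpow B i)"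
    using dpow_add[of "T (Suc m)" B n] by (simp add: fps_commute_coeffs T_nth B_nth comm) (simp add: B_def)
  then have "dpow A n $ m = (\<Sum>i\<le>n. (dpow (T (Suc m)) (n - i) * dpow B i) $ m)"
    by (simp only: fps_sum_nth)
  also have "\<dots> = (\<Sum>i\<le>n. if i = 0 then dpow (T (Suc m)) n $ m else 0)"
  proof (rule sum.cong[OF refl])
    fix i
    show "(dpow (T (Suc m)) (n - i) * dpow B i) $ m = (if i = 0 then dpow (T (Suc m)) n $ m else 0)"
    proof (cases i)
      case (Suc i')
      have B1: "ord_ge B (Suc m)" by (simp add: ord_ge_def B_nth)
      have "ord_ge (B ^ Suc i') (Suc m + 0)"
        unfolding power_Suc by (rule ord_ge_mult[OF B1]) simp
      then have "ord_ge (dpow B i) (Suc m)" by (simp add: ord_ge_def dpow_def Suc)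
      then have "ord_ge (dpow (T (Suc m)) (n - i) * dpow B i) (0 + Suc m)"
        by (intro ord_ge_mult) simp_all
      then show ?thesis using Suc by (simp add: ord_ge_def)
    qed simp
  qed
  finally show ?thesis using T by simp
qed

lemma fexp_conj1':
  fixes a Z0 Z1 :: "'a::rat_algebra fps"
  assumes "a $ 0 = 0" "a * Z0 = Z0 * a + Z1" "a * Z1 = Z1 * a"
  shows "fexp a * Z0 = (Z0 + Z1) * fexp a"
proof -
  have "Z0 * fexp (- a) = fexp (- a) * (Z0 + Z1 + 0 + 0)"
    by (rule fexp_conj3) (use assms in simp_all)
  then have "fexp a * (Z0 * fexp (- a)) * fexp a = fexp a * (fexp (- a) * (Z0 + Z1)) * fexp a"
    by simp
  also have "fexp a * (Z0 * fexp (- a)) * fexp a = fexp a * Z0"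
    by (simp add: mult.assoc fexp_uminus(2)[OF assms(1)])
  also have "fexp a * (fexp (- a) * (Z0 + Z1)) * fexp a = (Z0 + Z1) * fexp a"
    by (simp add: fexp_uminus(1)[OF assms(1)] flip: mult.assoc)
  finally show ?thesis .
qed

text \<open>The coefficient of t^n in exp (t (a + b)) = exp (t a) exp (t b) exp (- t^2 c), both
  sides solving the same equation in t. Writing the bracket as 2c lets its half appear without a
  denominator.\<close>

lemma dpow_BCH:
  fixes a b c :: "'a::rat_algebra"
  assumes ab: "a * b = b * a + 2 * c" and ac: "a * c = c * a" and bc: "b * c = c * b"
  shows "dpow (a + b) n = (\<Sum>i=0..n. (\<Sum>j=0..i. dpow a j * dpow b (i - j)) *
    (if even (n - i) then dpow (- c) ((n - i) div 2) else 0))"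
proof -
  let ?X = "fps_X :: 'a fps"
  define u v w where "u = ?X * fps_const a" and "v = ?X * fps_const b" and "w = fps_const (- c) * ?X ^ 2"
  have nth: "u $ n = (if n = 1 then a else 0)" "v $ n = (if n = 1 then b else 0)" "w $ n = (if n = 2 then - c else 0)" for n
    by (auto simp: u_def v_def w_def)
  have uv: "u * v = v * u + - (2 * w)"
  proof -
    have "u * v = ?X * (?X * fps_const (a * b))" "v * u = ?X * (?X * fps_const (b * a))"
      unfolding u_def v_def by (simp_all add: mult.assoc) (metis fps_const_mult fps_mult_fps_X_commute mult.assoc)+
    moreover have "- (2 * w) = ?X * (?X * fps_const (2 * c))"
      by (rule fps_ext) (simp add: w_def fps_numeral_fps_const power2_eq_square mult.assoc)
    ultimately show ?thesis by (simp add: ab distrib_left flip: fps_const_add)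
  qed
  have uw: "u * w = w * u" and vw: "v * w = w * v"
    by (rule fps_commute_coeffs; simp add: nth ac bc)+
  have XDu: "fps_XD u = u" and XDv: "fps_XD v = v" and XDw: "fps_XD w = 2 * w"
    by (rule fps_ext; simp add: nth fps_numeral_fps_const)+
  define G where "G = fexp u * fexp v * fexp w"
  have z: "u $ 0 = 0" "v $ 0 = 0" "w $ 0 = 0" by (simp_all add: nth)
  have d: "fps_XD (fexp x) = fps_XD x * fexp x" if "x $ 0 = 0" "fps_XD x * x = x * fps_XD x" for x :: "'a fps"
    by (rule coeff_derivation_fexp[OF coeff_derivation_XD that])
  have du: "fps_XD (fexp u) = u * fexp u" and dv: "fps_XD (fexp v) = v * fexp v"
    using d[of u] d[of v] z by (simp_all add: XDu XDv)
  have dw: "fps_XD (fexp w) = 2 * w * fexp w"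
    using d[of w] z mult_of_nat_commute[of 2 "w * w"] unfolding XDw
    by (simp add: mult.assoc qof_left_commute[of w 2, unfolded qof_numeral])
  have "fexp u * v = (v + - (2 * w)) * fexp u"
  proof (rule fexp_conj1'[OF z(1) uv])
    show "u * - (2 * w) = - (2 * w) * u"
      using qof_left_commute[of u 2 w] by (simp add: uw mult.assoc)
  qed
  then have euv: "fexp u * v = v * fexp u - 2 * w * fexp u" by (simp add: left_diff_distrib)
  have wuv: "fexp u * fexp v * (2 * w) = 2 * w * (fexp u * fexp v)"
  proof -
    have "fexp u * w = w * fexp u" "fexp v * w = w * fexp v"
      using fexp_commute[OF z(1) uw] fexp_commute[OF z(2) vw] .
    then have "fexp u * fexp v * w = w * (fexp u * fexp v)" by (metis mult.assoc)
    then show ?thesis using qof_left_commute[of "fexp u * fexp v" 2 w] by (simp add: mult.assoc)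
  qed
  have "fps_XD G = u * fexp u * fexp v * fexp w + fexp u * v * fexp v * fexp w + fexp u * fexp v * (2 * w) * fexp w"
    unfolding G_def XD_mult du dv dw by (simp only: distrib_right mult.assoc add.assoc)
  also have "\<dots> = (u + v) * G"
    unfolding euv wuv G_def by (simp only: distrib_right left_diff_distrib mult.assoc) simp
  finally have XDG: "fps_XD G = (u + v) * G" .
  have uv0: "u + v = ?X * fps_const (a + b)"
    by (simp add: u_def v_def distrib_left flip: fps_const_add)
  have "fps_XD (fexp (u + v)) = (u + v) * fexp (u + v)"
    using d[of "u + v"] z by (simp add: XD_add XDu XDv)
  from XD_ode_unique[OF this XDG] have "fexp (u + v) = G"
    by (simp add: G_def z)
  then have "dpow (a + b) n = G $ n" unfolding uv0 by (simp flip: fexp_X_const_nth)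
  moreover have "fexp w $ m = (if even m then dpow (- c) (m div 2) else 0)" for m
  proof -
    have "fexp w $ m = (\<Sum>k\<le>m. if m = 2 * k then dpow (- c) k else 0)"
      unfolding fexp_def fsum_def fps_nth_Abs_fps w_def by (rule sum.cong) (auto simp: dpow_const_X_power)
    also have "\<dots> = (if even m then dpow (- c) (m div 2) else 0)"
    proof (cases "even m")
      case True
      then obtain j where m: "m = 2 * j" by blast
      have "(\<Sum>k\<le>m. if m = 2 * k then dpow (- c) k else 0) = (\<Sum>k\<le>m. if k = j then dpow (- c) j else 0)"
        by (rule sum.cong) (auto simp: m)
      then show ?thesis by (simp add: m)
    qed (auto intro!: sum.neutral)
    finally show ?thesis .
  qed
  moreover have "(fexp u * fexp v) $ i = (\<Sum>j=0..i. dpow a j * dpow b (i - j))" for i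
    by (simp add: fps_mult_nth u_def v_def fexp_X_const_nth)
  ultimately show ?thesis by (simp only: G_def fps_mult_nth[of _ "fexp w"])
qed

definition xser :: "pmsign \<Rightarrow> int \<Rightarrow> pmsign \<Rightarrow> nat \<Rightarrow> uea"
  where "xser \<sigma> r \<tau> j = x_el \<sigma> (r + sgn_of \<tau> * int j)"

lemma graded_family_gr: "graded_family (\<lambda>n. {a. gr \<sigma> (int k * int n) a})"
  unfolding graded_family_def
  by (auto intro: gr.intros simp: distrib_left dest: gr_mult)

text \<open>Terms of equal index parity commute, and the mixed brackets lie in the X. As the odd
  coefficients of \<open>phi\<close> are even, half of the bracket is still integral, so the
  correction in \<open>dpow_BCH\<close> consists of integral divided powers of X.\<close>

lemma dpow_xser_gr: "gr \<sigma> (int n) (dpow (ser phi (xser \<sigma> r \<tau>)) n $ m)"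
proof -
  obtain \<kappa> where \<kappa>: "int_series \<kappa>" and phi: "phi = 1 + fps_X\<^sup>2 + 2 * \<kappa>" by (rule phi_mod_2)
  define f0 where "f0 = Abs_fps (\<lambda>n. if even n then phi $ n else 0)"
  define k1 where "k1 = Abs_fps (\<lambda>n. if odd n then \<kappa> $ n else 0)"
  have phi_int: "int_series phi"
    unfolding phi using \<kappa> by (simp add: int_series_closed int_series_power int_series_numeral)
  have f0: "parity True f0" "int_series f0" and k1: "parity False k1" "int_series k1"
    using phi_int \<kappa> by (auto simp: parity_def f0_def k1_def coeffs_in_def)
  have phi_eq: "phi = f0 + 2 * k1"
  proof (rule fps_ext)
    fix n
    show "phi $ n = (f0 + 2 * k1) $ n"
      by (cases "even n") (auto simp: f0_def k1_def phi fps_numeral_fps_const odd_pos)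
  qed
  define a b where "a = ser f0 (xser \<sigma> r \<tau>)" and "b = ser (2 * k1) (xser \<sigma> r \<tau>)"
  define Xs where "Xs j = X_el \<sigma> (2 * r + sgn_of \<tau> * int j)" for j
  define A :: rat where "A = of_int (- (sgn_of \<sigma> * alt r))"
  define c where "c = ser (qof A * (f0 * k1)) Xs"
  have A: "A \<in> \<int>" unfolding A_def by simp
  have sgn: "odd (sgn_of \<tau>)" by (cases \<tau>) auto
  have par2: "parity False (2 * k1)" using parity_qof[OF k1(1), of 2] by simp
  have parc: "parity False (qof A * (f0 * k1))" using parity_qof[OF parity_mult[OF f0(1) k1(1)]] by simp
  have comm: "xser \<sigma> r \<tau> i * xser \<sigma> r \<tau> j = xser \<sigma> r \<tau> j * xser \<sigma> r \<tau> i" if "even i = even j" for i j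
    unfolding xser_def by (rule x_x_even) (use that sgn in auto)
  have ab: "a * b = b * a + 2 * c"
  proof -
    have "a * b = b * a + ser (qof A * (f0 * (2 * k1))) Xs"
      unfolding a_def b_def
    proof (rule ser_bracket)
      fix i j assume "f0 $ i \<noteq> 0" "(2 * k1) $ j \<noteq> 0"
      then have ij: "even i" "odd j" using f0(1) par2 by (auto simp: parity_def)
      have "r + sgn_of \<tau> * int i + (r + sgn_of \<tau> * int j) = 2 * r + sgn_of \<tau> * int (i + j)"
        by (simp add: algebra_simps)
      moreover have "odd (r + sgn_of \<tau> * int i + (r + sgn_of \<tau> * int j))" using ij sgn by simp
      moreover have "alt (r + sgn_of \<tau> * int j) = - alt r" using ij sgn by (auto simp: alt_def)
      ultimately show "xser \<sigma> r \<tau> i * xser \<sigma> r \<tau> j = xser \<sigma> r \<tau> j * xser \<sigma> r \<tau> i + qof A * Xs (i + j)"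
        using x_x_odd[of "r + sgn_of \<tau> * int i" "r + sgn_of \<tau> * int j" \<sigma>]
        unfolding xser_def Xs_def A_def qof_of_int by simp
    qed
    also have "qof A * (f0 * (2 * k1)) = qof 2 * (qof A * (f0 * k1))" by (simp add: mult_ac)
    finally show ?thesis unfolding c_def using ser_qof[of 2 "qof A * (f0 * k1)" Xs]
      by (simp only: qof_numeral)
  qed
  have oddX: "odd (2 * r + sgn_of \<tau> * int j)" if "(qof A * (f0 * k1)) $ j \<noteq> 0" for j
    using that parc sgn by (auto simp: parity_def)
  have ac: "ser f (xser \<sigma> r \<tau>) * c = c * ser f (xser \<sigma> r \<tau>)" for f
  proof (rule fps_commute_coeffs)
    fix i j
    show "ser f (xser \<sigma> r \<tau>) $ i * c $ j = c $ j * ser f (xser \<sigma> r \<tau>) $ i"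
      unfolding c_def ser_nth by (rule qof_mult_commute) (use oddX[of j] x_X in \<open>simp add: xser_def Xs_def\<close>)
  qed
  have ga: "gr \<sigma> (int i) (dpow (ser f (xser \<sigma> r \<tau>)) i $ m)" if "int_series f" "parity e f" for f e i m
  proof -
    have "dpow (ser f (xser \<sigma> r \<tau>)) i $ m \<in> {a. gr \<sigma> (int 1 * int i) a}"
    proof (rule dpow_graded[OF graded_family_gr[of \<sigma> 1]])
      fix j l
      show "ser f (xser \<sigma> r \<tau>) $ j * ser f (xser \<sigma> r \<tau>) $ l = ser f (xser \<sigma> r \<tau>) $ l * ser f (xser \<sigma> r \<tau>) $ j"
        unfolding ser_nth by (rule qof_mult_commute) (use that(2) in \<open>auto simp: parity_def intro!: comm\<close>)
      show "dpow (ser f (xser \<sigma> r \<tau>) $ j) l \<in> {a. gr \<sigma> (int 1 * int l) a}"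
        using gr_dpow_int_mult[of "f $ j", OF _ gr_x] that(1) by (simp add: ser_nth coeffs_in_def xser_def)
    qed
    then show ?thesis by simp
  qed
  have gc: "gr \<sigma> (2 * int i) (dpow (- c) i $ m)" for i m
  proof -
    have intc: "int_series (- (qof A * (f0 * k1)))"
    proof -
      have "int_series (qof A)" using A by (auto simp: coeffs_in_def qof_nth)
      then show ?thesis using f0 k1 by (simp add: int_series_closed)
    qed
    have c': "- c = ser (- (qof A * (f0 * k1))) Xs" by (simp add: c_def ser_minus)
    have "dpow (- c) i $ m \<in> {a. gr \<sigma> (int 2 * int i) a}"
    proof (rule dpow_graded[OF graded_family_gr[of \<sigma> 2]])
      fix j l
      show "(- c) $ j * (- c) $ l = (- c) $ l * (- c) $ j"
        unfolding c' ser_nth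
        by (rule qof_mult_commute) (use oddX[of j] oddX[of l] X_X in \<open>simp add: Xs_def\<close>)
      show "dpow ((- c) $ j) l \<in> {a. gr \<sigma> (int 2 * int l) a}"
      proof (cases "(qof A * (f0 * k1)) $ j = 0")
        case True
        then have "(- c) $ j = 0" unfolding c' ser_nth by auto
        then show ?thesis by (cases l) (simp_all add: dpow_0_left gr.intros)
      next
        case False
        then show ?thesis
          using gr_dpow_int_mult[of "(- (qof A * (f0 * k1))) $ j" \<sigma> "2 * int l" "Xs j" l] gr_X[OF oddX[OF False], of \<sigma> l] intc
          unfolding c' ser_nth by (simp add: coeffs_in_def Xs_def)
      qed
    qed
    then show ?thesis by simp
  qed
  have "ser phi (xser \<sigma> r \<tau>) = a + b" by (simp add: a_def b_def flip: ser_add) (simp only: phi_eq)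
  then have "dpow (ser phi (xser \<sigma> r \<tau>)) n = (\<Sum>i=0..n. (\<Sum>j=0..i. dpow a j * dpow b (i - j)) *
      (if even (n - i) then dpow (- c) ((n - i) div 2) else 0))"
    using dpow_BCH[OF ab, of n] ac by (simp add: a_def b_def)
  then have "dpow (ser phi (xser \<sigma> r \<tau>)) n $ m = (\<Sum>i=0..n. ((\<Sum>j=0..i. dpow a j * dpow b (i - j)) *
      (if even (n - i) then dpow (- c) ((n - i) div 2) else 0)) $ m)"
    by (simp only: fps_sum_nth)
  also have "gr \<sigma> (int n) \<dots>"
  proof (rule gr_sum)
    fix i assume i: "i \<in> {0..n}"
    have mult: "gr \<sigma> (d + e) ((f * g) $ m)" if "\<And>m. gr \<sigma> d (f $ m)" "\<And>m. gr \<sigma> e (g $ m)" for d e f g m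
      unfolding fps_mult_nth by (intro gr_sum gr_mult that)
    have 1: "gr \<sigma> (int i) ((\<Sum>j=0..i. dpow a j * dpow b (i - j)) $ m)" for m
      unfolding fps_sum_nth
    proof (rule gr_sum)
      fix j assume j: "j \<in> {0..i}"
      have "int_series (2 * k1)" using k1(2) by (simp add: int_series_closed int_series_numeral)
      then have "gr \<sigma> (int j + int (i - j)) ((dpow a j * dpow b (i - j)) $ m)"
        unfolding a_def b_def by (intro mult ga[OF f0(2,1)] ga[OF _ par2])
      then show "gr \<sigma> (int i) ((dpow a j * dpow b (i - j)) $ m)" using j by simp
    qed
    show "gr \<sigma> (int n) (((\<Sum>j=0..i. dpow a j * dpow b (i - j)) *
      (if even (n - i) then dpow (- c) ((n - i) div 2) else 0)) $ m)"
    proof (cases "even (n - i)")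
      case True
      have "2 * int ((n - i) div 2) = int (n - i)"
        using arg_cong[OF dvd_mult_div_cancel[OF True], of int] by (simp only: of_nat_mult of_nat_numeral)
      then have "gr \<sigma> (int (n - i)) (dpow (- c) ((n - i) div 2) $ m)" for m
        using gc[of "(n - i) div 2" m] by simp
      from mult[OF 1 this, of m] True i show ?thesis by simp
    qed (simp add: gr_0)
  qed
  finally show ?thesis .
qed

lemma ubinom_shift:
  assumes "x * y = (y + t) * x"
  shows "x * ubinom y k = ubinom (y + t) k * x"
proof (induction k)
  case (Suc k)
  have xy: "x * (y - of_nat k) = (y + t - of_nat k) * x"
    by (simp add: right_diff_distrib left_diff_distrib assms mult_of_nat_commute[of k])
  have "of_nat (Suc k) * (x * ubinom y (Suc k)) = x * (of_nat (Suc k) * ubinom y (Suc k))"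
    by (metis mult.assoc mult_of_nat_commute)
  also have "\<dots> = x * ubinom y k * (y - of_nat k)" by (simp only: ubinom_Suc mult.assoc)
  also have "\<dots> = ubinom (y + t) k * (y + t - of_nat k) * x" by (simp only: Suc mult.assoc xy)
  also have "\<dots> = of_nat (Suc k) * (ubinom (y + t) (Suc k) * x)"
    by (simp only: mult.assoc[symmetric] ubinom_Suc)
  finally show ?case by (rule of_nat_mult_cancel) simp
qed simp

lemma dpow_shift:
  fixes x y :: uea
  assumes "x * y = (y + of_int t) * x"
  shows "dpow x n * y = (y + of_int (int n * t)) * dpow x n"
proof -
  have "x ^ n * y = (y + of_int (int n * t)) * x ^ n"
  proof (induction n)
    case (Suc n)
    have "x ^ Suc n * y = x * (x ^ n * y)" by (simp add: mult.assoc)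
    also have "\<dots> = (x * y + of_int (int n * t) * x) * x ^ n"
      unfolding Suc by (simp only: mult.assoc[symmetric] distrib_left mult_of_int_commute[symmetric])
    also have "\<dots> = (y + of_int t + of_int (int n * t)) * x * x ^ n"
      by (simp only: assms distrib_right)
    also have "y + of_int t + of_int (int n * t) = y + of_int (int (Suc n) * t)"
      by (simp add: distrib_right add.assoc)
    finally show ?case by (simp only: mult.assoc power_Suc)
  qed simp
  then show ?thesis by (simp only: dpow_def mult.assoc qof_left_commute[of "y + of_int (int n * t)"])
qed

lemma h_0_shift:
  "dpow (x_el \<sigma> r) n * ubinom (h_el 0) k = ubinom (h_el 0 + of_int (- 2 * sgn_of \<sigma> * int n)) k * dpow (x_el \<sigma> r) n"
    (is ?right)
  "ubinom (h_el 0) k * dpow (x_el \<sigma> r) n = dpow (x_el \<sigma> r) n * ubinom (h_el 0 + of_int (2 * sgn_of \<sigma> * int n)) k"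
    (is ?left)
proof -
  have hx: "x_el \<sigma> r * (h_el 0 + of_int m) = (h_el 0 + of_int m + of_int (- 2 * sgn_of \<sigma>)) * x_el \<sigma> r" for m
    using h_x[of 0 \<sigma> r] mult_of_int_commute[of m "x_el \<sigma> r"]
    by (cases \<sigma>) (simp_all add: distrib_left distrib_right left_diff_distrib)
  note * = ubinom_shift[OF dpow_shift[OF hx]]
  show ?right using *[of n 0 k] by (simp add: mult_ac)
  show ?left using *[of n "2 * sgn_of \<sigma> * int n" k] by (simp add: mult_ac)
qed

text \<open>Vandermonde's identity, read off from (1 + u)^(y + m).\<close>

lemma ubinom_add_of_int:
  "\<exists>g. (\<forall>i. g i \<in> range of_int) \<and> ubinom (y + of_int m) k = (\<Sum>i=0..k. ubinom y i * g i)"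
proof (intro exI conjI allI)
  show "ubinom (of_int m) (k - i) \<in> range of_int" for i by (rule ubinom_of_int)
  have "Bin (y + of_int m) = Bin y * Bin (of_int m)"
    by (rule Bin_add) (simp add: mult_of_int_commute)
  then show "ubinom (y + of_int m) k = (\<Sum>i=0..k. ubinom y i * ubinom (of_int m) (k - i))"
    by (simp only: fps_mult_nth Bin_nth flip: Bin_nth[of _ k])
qed

lemma log_series_ser:
  "log_series \<tau> = ser (lam True) (\<lambda>j. h_el (sgn_of \<tau> * int j)) + ser (lam False) (\<lambda>j. h_el (sgn_of \<tau> * int j))"
  by (rule fps_ext) (simp add: log_series_def qscale_eq ser_nth lam_def)

lemma fsum_ser: "fsum (\<lambda>i. ser (dpow \<psi> i) p) = ser (fexp \<psi>) p"
proof (rule fps_ext)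
  fix n
  have "qof (\<Sum>k\<le>m. dpow \<psi> k $ n) = (\<Sum>k\<le>m. qof (dpow \<psi> k $ n) :: 'a)" for m
    by (induction m) (simp_all add: qof_add)
  then show "fsum (\<lambda>i. ser (dpow \<psi> i) p) $ n = ser (fexp \<psi>) p $ n"
    by (simp add: fsum_def fexp_def ser_nth sum_distrib_right)
qed

text \<open>Commutation with \<open>log_series\<close> multiplies the current by a scalar series
  \<open>\<psi>\<close>, so conjugation multiplies it by \<open>fexp \<psi>\<close>, which is
  \<open>phi\<close>. The directions are those of the decomposition: Cartan elements move left past
  x^+ and right past x^-.\<close>

lemma htilde_series_conj:
  "fps_const (x_el PlusS r) * fexp (log_series \<tau>) = fexp (log_series \<tau>) * ser phi (xser PlusS r \<tau>)"
  "fexp (log_series \<tau>) * fps_const (x_el MinusS r) = ser phi (xser MinusS r \<tau>) * fexp (log_series \<tau>)"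
proof -
  define \<psi> where "\<psi> = - (2 * lam True) - 6 * lam False"
  define hs where "hs j = h_el (sgn_of \<tau> * int j)" for j
  define Z where "Z \<sigma> i = ser (dpow \<psi> i) (xser \<sigma> r \<tau>)" for \<sigma> i
  have sgn: "odd (sgn_of \<tau>)" by (cases \<tau>) auto
  have Z0: "Z \<sigma> 0 = fps_const (x_el \<sigma> r)" for \<sigma>
    by (rule fps_ext) (simp add: Z_def ser_nth xser_def)
  have fs: "fsum (Z \<sigma>) = ser phi (xser \<sigma> r \<tau>)" for \<sigma>
    unfolding Z_def by (simp add: fsum_ser \<psi>_def fexp_lam)
  have log: "log_series \<tau> = ser (lam True) hs + ser (lam False) hs"
    by (simp add: log_series_ser hs_def[abs_def])
  have par: "even j = e" if "lam e $ j \<noteq> 0" for e j using parity_lam[of e] that by (auto simp: parity_def)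
  have Suc: "qof (- 2) * (dpow \<psi> i * lam True) + qof (- 6) * (dpow \<psi> i * lam False) = of_nat (Suc i) * dpow \<psi> (Suc i)" for i
  proof -
    have "qof (- 2) * (dpow \<psi> i * lam True) + qof (- 6) * (dpow \<psi> i * lam False) = \<psi> * dpow \<psi> i"
      by (simp add: \<psi>_def algebra_simps qof_minus)
    then show ?thesis by (simp only: dpow_Suc)
  qed
  have add: "ser (of_nat (Suc i) * f) p = of_nat (Suc i) * ser f p" for i f and p :: "nat \<Rightarrow> uea"
    using ser_qof[of "of_nat (Suc i)" f p] by (simp only: qof_of_nat)
  have sh: "r + sgn_of \<tau> * int j + sgn_of \<tau> * int i = r + sgn_of \<tau> * int (i + j)" for i j
    by (simp add: algebra_simps)
  have plus: "ser f (xser PlusS r \<tau>) * ser (lam e) hs = ser (lam e) hs * ser f (xser PlusS r \<tau>)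
      + ser (qof (if e then - 2 else - 6) * (f * lam e)) (xser PlusS r \<tau>)" for f e
  proof (rule ser_bracket)
    fix i j assume "lam e $ j \<noteq> 0"
    then show "xser PlusS r \<tau> i * hs j = hs j * xser PlusS r \<tau> i + qof (if e then - 2 else - 6) * xser PlusS r \<tau> (i + j)"
      using h_x[of "sgn_of \<tau> * int j" PlusS "r + sgn_of \<tau> * int i"] par[of e j] sgn
      by (auto simp: xser_def hs_def qof_minus algebra_simps)
  qed
  have minus: "ser (lam e) hs * ser f (xser MinusS r \<tau>) = ser f (xser MinusS r \<tau>) * ser (lam e) hs
      + ser (qof (if e then - 2 else - 6) * (lam e * f)) (xser MinusS r \<tau>)" for f e
  proof (rule ser_bracket)
    fix i j assume "lam e $ i \<noteq> 0"
    then show "hs i * xser MinusS r \<tau> j = xser MinusS r \<tau> j * hs i + qof (if e then - 2 else - 6) * xser MinusS r \<tau> (i + j)"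
      using h_x[of "sgn_of \<tau> * int i" MinusS "r + sgn_of \<tau> * int j"] par[of e i] sgn
      by (auto simp: xser_def hs_def qof_minus algebra_simps)
  qed
  have Zplus: "Z PlusS i * log_series \<tau> = log_series \<tau> * Z PlusS i + of_nat (Suc i) * Z PlusS (Suc i)" for i
  proof -
    have "Z PlusS i * log_series \<tau> = log_series \<tau> * Z PlusS i
        + (ser (qof (- 2) * (dpow \<psi> i * lam True)) (xser PlusS r \<tau>) + ser (qof (- 6) * (dpow \<psi> i * lam False)) (xser PlusS r \<tau>))"
      unfolding log Z_def distrib_left plus distrib_right by (simp add: add_ac)
    then show ?thesis unfolding ser_add[symmetric] Suc add Z_def .
  qed
  have Zminus: "log_series \<tau> * Z MinusS i = Z MinusS i * log_series \<tau> + of_nat (Suc i) * Z MinusS (Suc i)" for i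
  proof -
    have "log_series \<tau> * Z MinusS i = Z MinusS i * log_series \<tau>
        + (ser (qof (- 2) * (dpow \<psi> i * lam True)) (xser MinusS r \<tau>) + ser (qof (- 6) * (dpow \<psi> i * lam False)) (xser MinusS r \<tau>))"
      unfolding log Z_def distrib_left distrib_right minus mult.commute[of "lam _"] by (simp add: add_ac)
    then show ?thesis unfolding ser_add[symmetric] Suc add Z_def .
  qed
  show "fps_const (x_el PlusS r) * fexp (log_series \<tau>) = fexp (log_series \<tau>) * ser phi (xser PlusS r \<tau>)"
    using fexp_conj[of "log_series \<tau>" "Z PlusS", OF log_series_nth_0 Zplus] by (simp only: Z0 fs)
  show "fexp (log_series \<tau>) * fps_const (x_el MinusS r) = ser phi (xser MinusS r \<tau>) * fexp (log_series \<tau>)"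
    using fexp_conj'[of "log_series \<tau>" "Z MinusS", OF log_series_nth_0 Zminus] by (simp only: Z0 fs)
qed

lemma dpow_intertwine:
  fixes a b h :: "'a::rat_algebra"
  assumes "a * h = h * b" shows "dpow a n * h = h * dpow b n"
proof -
  have "a ^ n * h = h * b ^ n"
  proof (induction n)
    case (Suc n)
    have "a ^ Suc n * h = a * h * b ^ n" by (simp add: Suc mult.assoc)
    then show ?case by (simp add: assms mult.assoc)
  qed simp
  then show ?thesis by (simp add: dpow_def mult.assoc qof_left_commute[of h])
qed

lemma dpow_fps_const: "dpow (fps_const a) n = fps_const (dpow a n :: 'a::rat_algebra)"
  using dpow_const_X_power[of a 0 n] by simp

lemma htilde_shift:
  "dpow (x_el PlusS r) n * htilde \<tau> k = (\<Sum>i=0..k. htilde \<tau> i * dpow (ser phi (xser PlusS r \<tau>)) n $ (k - i))"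
  "htilde \<tau> k * dpow (x_el MinusS r) n = (\<Sum>i=0..k. dpow (ser phi (xser MinusS r \<tau>)) n $ i * htilde \<tau> (k - i))"
  using arg_cong[OF dpow_intertwine[OF htilde_series_conj(1)[of r \<tau>], of n], of "\<lambda>f. f $ k"]
    arg_cong[OF dpow_intertwine[OF htilde_series_conj(2)[of \<tau> r, symmetric], of n], of "\<lambda>f. f $ k"]
  by (simp_all add: dpow_fps_const fps_mult_nth[of "fexp _"] fps_mult_nth[of "dpow (ser _ _) _"] htilde_fexp)

section \<open>Cartan elements moved through spans of products\<close>

lemma int_span_mult:
  assumes "x \<in> int_span S" "\<And>s. s \<in> S \<Longrightarrow> l * s * r \<in> int_span T"
  shows "l * x * r \<in> int_span T"
  using assms(1)
proof (induction rule: int_module.span_induct_alt)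
  case base
  then show ?case by (simp add: int_module.span_zero)
next
  case (step n s y)
  have "l * (of_int n * s + y) * r = of_int n * (l * s * r) + l * y * r"
    by (simp only: distrib_left distrib_right of_int_left_commute[of l] mult.assoc)
  then show ?case using assms(2)[OF step(1)] step(2)
    by (simp add: int_module.span_add int_module.span_scale)
qed

text \<open>Here index 0 of \<open>htilde\<close> is included: its value is 1, and the sums in
  \<open>htilde_shift\<close> run down to it.\<close>

definition cartan_gens :: "uea set"
  where "cartan_gens = {htilde \<tau> k | \<tau> k. True} \<union> {ubinom (h_el 0) k | k. True} \<union> {ubinom c_el k | k. True}"

lemma UZ_0_eq: "UZ_0 = subring_gen cartan_gens"
proof
  show "UZ_0 \<subseteq> subring_gen cartan_gens"
    unfolding UZ_0_def
  by (rule subring_gen_subset[OF is_subring_subring_gen], rule subsetI, rule subring_gen.base)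
      (auto simp: cartan_gens_def)
  show "subring_gen cartan_gens \<subseteq> UZ_0"
    unfolding cartan_gens_def using Bin_in_UZ_0
    by (intro subring_gen_subset subring_UZ_0) (auto simp: htilde_in_UZ_0 coeffs_in_def Bin_nth)
qed

lemma dpow_x_c_commute: "dpow (x_el \<sigma> r) n * ubinom c_el k = ubinom c_el k * dpow (x_el \<sigma> r) n"
proof -
  have "x_el \<sigma> r * c_el = (c_el + of_int 0) * x_el \<sigma> r" by (simp add: c_commute)
  from ubinom_shift[OF dpow_shift[OF this]] show ?thesis by simp
qed

abbreviation cartan_plus :: "uea set \<Rightarrow> int \<Rightarrow> uea set"
  where "cartan_plus Z d \<equiv> {z * g | z g. z \<in> Z \<and> gr PlusS d g}"

abbreviation minus_cartan :: "uea set \<Rightarrow> int \<Rightarrow> uea set"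
  where "minus_cartan Z d \<equiv> {g * z | z g. z \<in> Z \<and> gr MinusS d g}"

lemma cartan_gen_pass:
  assumes "z \<in> cartan_gens"
  shows "dpow (x_el PlusS r) n * z \<in> int_span (cartan_plus cartan_gens (int n))" (is "_ \<in> ?P")
    and "z * dpow (x_el MinusS r) n \<in> int_span (minus_cartan cartan_gens (int n))" (is "_ \<in> ?M")
proof -
  have P: "z' * g \<in> ?P" if "z' \<in> cartan_gens" "gr PlusS (int n) g" for z' g
    using that by (intro int_module.span_base) blast
  have M: "g * z' \<in> ?M" if "z' \<in> cartan_gens" "gr MinusS (int n) g" for z' g
    using that by (intro int_module.span_base) blast
  have gens: "htilde \<tau> k \<in> cartan_gens" "ubinom (h_el 0) k \<in> cartan_gens" "ubinom c_el k \<in> cartan_gens" for \<tau> k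
    by (auto simp: cartan_gens_def)
  consider \<tau> k where "z = htilde \<tau> k" | k where "z = ubinom (h_el 0) k" | k where "z = ubinom c_el k"
    using assms by (auto simp: cartan_gens_def)
  then have "dpow (x_el PlusS r) n * z \<in> ?P \<and> z * dpow (x_el MinusS r) n \<in> ?M"
  proof cases
    case 1
    show ?thesis unfolding 1 htilde_shift
      by (intro conjI int_span_sum P M gens dpow_xser_gr)
  next
    case 2
    have gr: "gr \<sigma> (int n) (u * dpow (x_el \<sigma> r) n)" if "u \<in> range of_int" for u \<sigma>
      using that by (auto intro: gr_of_int_mult gr_x)
    from ubinom_add_of_int[of "h_el 0" "- 2 * sgn_of PlusS * int n" k] obtain g where g: "\<And>i. g i \<in> range of_int"
        "ubinom (h_el 0 + of_int (- 2 * sgn_of PlusS * int n)) k = (\<Sum>i=0..k. ubinom (h_el 0) i * g i)" by blast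
    have 1: "dpow (x_el PlusS r) n * z \<in> ?P"
      unfolding 2 h_0_shift(1) g(2) unfolding sum_distrib_right mult.assoc
      by (intro int_span_sum P gens gr g(1))
    from ubinom_add_of_int[of "h_el 0" "2 * sgn_of MinusS * int n" k] obtain f where f: "\<And>i. f i \<in> range of_int"
        "ubinom (h_el 0 + of_int (2 * sgn_of MinusS * int n)) k = (\<Sum>i=0..k. ubinom (h_el 0) i * f i)" by blast
    have "dpow (x_el MinusS r) n * (ubinom (h_el 0) i * f i) = (f i * dpow (x_el MinusS r) n) * ubinom (h_el 0) i" for i
      using f(1)[of i] by (auto simp: mult.assoc of_int_left_commute[of "dpow _ _"] mult_of_int_commute)
    then have "z * dpow (x_el MinusS r) n \<in> ?M"
      unfolding 2 h_0_shift(2) f(2) sum_distrib_left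
      by (auto intro!: int_span_sum M gens gr f(1))
    with 1 show ?thesis ..
  next
    case 3
    show ?thesis unfolding 3 dpow_x_c_commute[of PlusS] dpow_x_c_commute[of MinusS, symmetric]
      by (intro conjI P M gens gr_x)
  qed
  then show "dpow (x_el PlusS r) n * z \<in> ?P" "z * dpow (x_el MinusS r) n \<in> ?M" by auto
qed

text \<open>A Cartan generator passes one divided power at a time and emerges as a combination of
  single generators, not of products; this is why the induction closes with the fixed set
  \<open>cartan_gens\<close>.\<close>

lemma gr_cartan_gen_pass:
  "gr PlusS d g \<Longrightarrow> z \<in> cartan_gens \<Longrightarrow> g * z \<in> int_span (cartan_plus cartan_gens d)"
proof (induction arbitrary: z rule: gr.induct)
  case (gr_0 d)
  then show ?case by (simp add: int_module.span_zero)
next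
  case gr_1
  have "z * 1 \<in> int_span (cartan_plus cartan_gens 0)"
    using gr_1 gr.gr_1 by (intro int_module.span_base) blast
  then show ?case by simp
next
  case (gr_diff d a b)
  then show ?case by (simp add: left_diff_distrib int_module.span_diff)
next
  case (gr_gen_mult k d a r)
  have "dpow (x_el PlusS r) k * (a * z) * 1 \<in> int_span (cartan_plus cartan_gens (d + int k))"
  proof (rule int_span_mult[OF gr_gen_mult.IH[OF gr_gen_mult.prems]])
    fix s assume "s \<in> cartan_plus cartan_gens d"
    then obtain z' g' where s: "s = z' * g'" "z' \<in> cartan_gens" "gr PlusS d g'" by blast
    have "1 * (dpow (x_el PlusS r) k * z') * g' \<in> int_span (cartan_plus cartan_gens (d + int k))"
    proof (rule int_span_mult[OF cartan_gen_pass(1)[OF s(2)]])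
      fix t assume "t \<in> cartan_plus cartan_gens (int k)"
      then obtain z'' g'' where t: "t = z'' * g''" "z'' \<in> cartan_gens" "gr PlusS (int k) g''" by blast
      have "gr PlusS (d + int k) (g'' * g')" using gr_mult[OF t(3) s(3)] by (simp add: add.commute)
      then show "1 * t * g' \<in> int_span (cartan_plus cartan_gens (d + int k))"
        using t by (intro int_module.span_base) (auto simp: mult.assoc)
    qed
    then show "dpow (x_el PlusS r) k * s * 1 \<in> int_span (cartan_plus cartan_gens (d + int k))"
      by (simp add: s(1) mult.assoc)
  qed
  then show ?case by (simp add: mult.assoc)
qed

lemma gr_cartan_gen_pass':
  "gr MinusS d g \<Longrightarrow> z \<in> cartan_gens \<Longrightarrow> z * g \<in> int_span (minus_cartan cartan_gens d)"
proof (induction arbitrary: z rule: gr.induct)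
  case (gr_0 d)
  then show ?case by (simp add: int_module.span_zero)
next
  case gr_1
  have "1 * z \<in> int_span (minus_cartan cartan_gens 0)"
    using gr_1 gr.gr_1 by (intro int_module.span_base) blast
  then show ?case by simp
next
  case (gr_diff d a b)
  then show ?case by (simp add: right_diff_distrib int_module.span_diff)
next
  case (gr_gen_mult k d a r)
  have "1 * (z * dpow (x_el MinusS r) k) * a \<in> int_span (minus_cartan cartan_gens (d + int k))"
  proof (rule int_span_mult[OF cartan_gen_pass(2)[OF gr_gen_mult.prems]])
    fix s assume "s \<in> minus_cartan cartan_gens (int k)"
    then obtain z' g' where s: "s = g' * z'" "z' \<in> cartan_gens" "gr MinusS (int k) g'" by blast
    have "g' * (z' * a) * 1 \<in> int_span (minus_cartan cartan_gens (d + int k))"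
    proof (rule int_span_mult[OF gr_gen_mult.IH[OF s(2)]])
      fix t assume "t \<in> minus_cartan cartan_gens d"
      then obtain z'' g'' where t: "t = g'' * z''" "z'' \<in> cartan_gens" "gr MinusS d g''" by blast
      have "gr MinusS (d + int k) (g' * g'')" using gr_mult[OF s(3) t(3)] by (simp add: add.commute)
      then have "g' * g'' * z'' \<in> int_span (minus_cartan cartan_gens (d + int k))"
        using t(2) by (intro int_module.span_base) blast
      then show "g' * t * 1 \<in> int_span (minus_cartan cartan_gens (d + int k))"
        by (simp add: t(1) mult.assoc)
    qed
    then show "1 * s * a \<in> int_span (minus_cartan cartan_gens (d + int k))"
      by (simp add: s(1) mult.assoc)
  qed
  then show ?case by (simp add: mult.assoc)
qed

text \<open>Induction on z this time, from the generators to the ring they generate, with g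
  arbitrary because it changes at each passage.\<close>

lemma gr_UZ_0_pass:
  assumes "z \<in> UZ_0" "gr PlusS d g"
  shows "g * z \<in> int_span (cartan_plus UZ_0 d)"
  using assms unfolding UZ_0_eq
proof (induction arbitrary: g rule: subring_gen.induct)
  case (base z)
  from gr_cartan_gen_pass[OF base(2,1)] show ?case
    by (rule subsetD[OF int_module.span_mono, rotated]) (auto intro: subring_gen.base)
next
  case zero
  then show ?case by (simp add: int_module.span_zero)
next
  case one
  have "1 * g \<in> int_span (cartan_plus (subring_gen cartan_gens) d)"
    using one subring_gen.one by (intro int_module.span_base) blast
  then show ?case by simp
next
  case (diff a b)
  then show ?case by (simp add: right_diff_distrib int_module.span_diff)
next
  case (mult a b)
  have "1 * (g * a) * b \<in> int_span (cartan_plus (subring_gen cartan_gens) d)"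
  proof (rule int_span_mult[OF mult.IH(1)[OF mult.prems]])
    fix s assume "s \<in> cartan_plus (subring_gen cartan_gens) d"
    then obtain z' g' where s: "s = z' * g'" "z' \<in> subring_gen cartan_gens" "gr PlusS d g'" by blast
    have "z' * (g' * b) * 1 \<in> int_span (cartan_plus (subring_gen cartan_gens) d)"
    proof (rule int_span_mult[OF mult.IH(2)[OF s(3)]])
      fix t assume "t \<in> cartan_plus (subring_gen cartan_gens) d"
      then obtain z'' g'' where t: "t = z'' * g''" "z'' \<in> subring_gen cartan_gens" "gr PlusS d g''" by blast
      then have "(z' * z'') * g'' \<in> int_span (cartan_plus (subring_gen cartan_gens) d)"
        using subring_gen.mult[OF s(2) t(2)] by (intro int_module.span_base) blast
      then show "z' * t * 1 \<in> int_span (cartan_plus (subring_gen cartan_gens) d)"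
        by (simp add: t(1) mult.assoc)
    qed
    then show "1 * s * b \<in> int_span (cartan_plus (subring_gen cartan_gens) d)"
      by (simp add: s(1) mult.assoc)
  qed
  then show ?case by (simp add: mult.assoc)
qed

lemma gr_UZ_0_pass':
  assumes "z \<in> UZ_0" "gr MinusS d g"
  shows "z * g \<in> int_span (minus_cartan UZ_0 d)"
  using assms unfolding UZ_0_eq
proof (induction arbitrary: g rule: subring_gen.induct)
  case (base z)
  from gr_cartan_gen_pass'[OF base(2,1)] show ?case
    by (rule subsetD[OF int_module.span_mono, rotated]) (auto intro: subring_gen.base)
next
  case zero
  then show ?case by (simp add: int_module.span_zero)
next
  case one
  have "g * 1 \<in> int_span (minus_cartan (subring_gen cartan_gens) d)"
    using one subring_gen.one by (intro int_module.span_base) blast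
  then show ?case by simp
next
  case (diff a b)
  then show ?case by (simp add: left_diff_distrib int_module.span_diff)
next
  case (mult a b)
  have "a * (b * g) * 1 \<in> int_span (minus_cartan (subring_gen cartan_gens) d)"
  proof (rule int_span_mult[OF mult.IH(2)[OF mult.prems]])
    fix s assume "s \<in> minus_cartan (subring_gen cartan_gens) d"
    then obtain z' g' where s: "s = g' * z'" "z' \<in> subring_gen cartan_gens" "gr MinusS d g'" by blast
    have "1 * (a * g') * z' \<in> int_span (minus_cartan (subring_gen cartan_gens) d)"
    proof (rule int_span_mult[OF mult.IH(1)[OF s(3)]])
      fix t assume "t \<in> minus_cartan (subring_gen cartan_gens) d"
      then obtain z'' g'' where t: "t = g'' * z''" "z'' \<in> subring_gen cartan_gens" "gr MinusS d g''" by blast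
      then have "g'' * (z'' * z') \<in> int_span (minus_cartan (subring_gen cartan_gens) d)"
        using subring_gen.mult[OF t(2) s(2)] by (intro int_module.span_base) blast
      then show "1 * t * z' \<in> int_span (minus_cartan (subring_gen cartan_gens) d)"
        by (simp add: t(1) mult.assoc)
    qed
    then show "a * s * 1 \<in> int_span (minus_cartan (subring_gen cartan_gens) d)"
      by (simp add: s(1) mult.assoc)
  qed
  then show ?case by (simp add: mult.assoc)
qed

section \<open>Triangular spans and termination of the straightening\<close>

lemma int_span_mult_tri:
  assumes "t \<in> tri H l k"
    and "\<And>a h d l' k'. h \<in> H \<Longrightarrow> l' \<le> l \<Longrightarrow> k' \<le> k \<Longrightarrow> gr MinusS l' a \<Longrightarrow> gr PlusS k' d \<Longrightarrow>
      x * (a * h * d) * y \<in> int_span T"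
  shows "x * t * y \<in> int_span T"
  by (rule int_span_mult[OF assms(1)[unfolded tri_def]]) (use assms(2) in blast)

text \<open>The inner Cartan elements move to the middle: h crosses the x^- part to its right, h'
  the x^+ part to its left, and neither passage changes a degree.\<close>

lemma tri_mult:
  assumes t: "t \<in> tri UZ_0 l k" and h: "h \<in> UZ_0" "h' \<in> UZ_0" and a: "gr MinusS l0 a" and d: "gr PlusS k0 d"
  shows "a * h * t * (h' * d) \<in> tri UZ_0 (l0 + l) (k + k0)"
  unfolding tri_def
proof (rule int_span_mult_tri[OF t], fold tri_def)
  fix a1 h1 d1 l1 k1
  assume 1: "h1 \<in> UZ_0" "l1 \<le> l" "k1 \<le> k" "gr MinusS l1 a1" "gr PlusS k1 d1"
  have "a * (h * a1) * (h1 * (d1 * h') * d) \<in> tri UZ_0 (l0 + l) (k + k0)"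
    unfolding tri_def
  proof (rule int_span_mult[OF gr_UZ_0_pass'[OF h(1) 1(4)]], fold tri_def)
    fix s assume "s \<in> minus_cartan UZ_0 l1"
    then obtain h2 a2 where s: "s = a2 * h2" "h2 \<in> UZ_0" "gr MinusS l1 a2" by blast
    have "(a * s * h1) * (d1 * h') * d \<in> tri UZ_0 (l0 + l) (k + k0)"
      unfolding tri_def
    proof (rule int_span_mult[OF gr_UZ_0_pass[OF h(2) 1(5)]], fold tri_def)
      fix t assume "t \<in> cartan_plus UZ_0 k1"
      then obtain h3 d3 where t: "t = h3 * d3" "h3 \<in> UZ_0" "gr PlusS k1 d3" by blast
      have "(a * a2) * (h2 * h1 * h3) * (d3 * d) \<in> tri UZ_0 (l0 + l) (k + k0)"
      proof (rule triI)
        show "h2 * h1 * h3 \<in> UZ_0" using s(2) 1(1) t(2) by (simp add: is_subringD[OF subring_UZ_0])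
      qed (use gr_mult[OF a s(3)] gr_mult[OF t(3) d] 1 in auto)
      then show "(a * s * h1) * t * d \<in> tri UZ_0 (l0 + l) (k + k0)"
        by (simp only: s t mult.assoc)
    qed
    then show "a * s * (h1 * (d1 * h') * d) \<in> tri UZ_0 (l0 + l) (k + k0)"
      by (simp only: mult.assoc)
  qed
  then show "a * h * (a1 * h1 * d1) * (h' * d) \<in> tri UZ_0 (l0 + l) (k + k0)"
    by (simp only: mult.assoc)
qed

lemma one_UZ_0: "1 \<in> UZ_0"
  by (simp add: is_subringD[OF subring_UZ_0])

lemma tri_mono: "l \<le> l' \<Longrightarrow> k \<le> k' \<Longrightarrow> tri H l k \<subseteq> tri H l' k'"
  unfolding tri_def by (rule int_module.span_mono) (use order_trans in blast)

text \<open>Induction on a bound for the total degree. After one swap the factors still to be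
  exchanged have lost a divided power of positive degree, while the new ones have not grown.\<close>

lemma tri_swap_bounded:
  "gr PlusS k a \<Longrightarrow> gr MinusS l b \<Longrightarrow> k + l < int N \<Longrightarrow> a * b \<in> tri UZ_0 l k"
proof (induction N arbitrary: k l a b)
  case 0
  then have "a = 0 \<or> b = 0" using gr_neg[OF 0(1)] gr_neg[OF 0(2)] by auto
  then show ?case by (auto simp: tri_def int_module.span_zero)
next
  case (Suc N)
  \<comment> \<open>The case of a single positive divided power. For general a, the induction
    hypothesis exchanges the rest of a with b, leaving one divided power against a negative factor
    of degree at most l.\<close>
  have step: "dpow (x_el PlusS r) i * b \<in> tri UZ_0 l (int i)"
    if "gr MinusS l b" "0 < i" "int i + l < int (Suc N)" for r i l b
    using that
  proof (induction rule: gr.induct)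
    case (gr_0 d)
    then show ?case by (simp add: tri_def int_module.span_zero)
  next
    case gr_1
    have "1 * 1 * dpow (x_el PlusS r) i \<in> tri UZ_0 0 (int i)"
      by (rule triI[OF one_UZ_0 gr.gr_1 gr_x]) simp_all
    then show ?case by simp
  next
    case (gr_diff d a b)
    then show ?case by (simp add: tri_def right_diff_distrib int_module.span_diff)
  next
    case (gr_gen_mult m d b s)
    have "1 * (dpow (x_el PlusS r) i * dpow (x_el MinusS s) m) * b \<in> tri UZ_0 (d + int m) (int i)"
      unfolding tri_def
    proof (rule int_span_mult_tri[OF dpow_swap[OF Hser_in_UZ_0]], fold tri_def)
      fix a1 h1 d1 l1 k1
      assume 1: "h1 \<in> UZ_0" "l1 \<le> int m" "k1 \<le> int i" "gr MinusS l1 a1" "gr PlusS k1 d1"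
      \<comment> \<open>From k1 \<le> i and m > 0, the sum k1 + d is strictly below i + d +
        m.\<close>
      have "d1 * b \<in> tri UZ_0 d k1"
        by (rule Suc.IH[OF 1(5) gr_gen_mult.hyps(2)]) (use gr_gen_mult 1(3) in auto)
      from tri_mult[OF this 1(1) one_UZ_0 1(4) gr.gr_1]
      have "a1 * h1 * (d1 * b) \<in> tri UZ_0 (l1 + d) k1" by simp
      then have "a1 * h1 * (d1 * b) \<in> tri UZ_0 (d + int m) (int i)"
        by (rule subsetD[OF tri_mono, rotated 2]) (use 1 in auto)
      then show "1 * (a1 * h1 * d1) * b \<in> tri UZ_0 (d + int m) (int i)"
        by (simp add: mult.assoc)
    qed
    then show ?case by (simp add: mult.assoc)
  qed
  from Suc.prems(1,3) show ?case
  proof (induction rule: gr.induct)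
    case (gr_0 d)
    then show ?case by (simp add: tri_def int_module.span_zero)
  next
    case gr_1
    have "b * 1 * 1 \<in> tri UZ_0 l 0"
      by (rule triI[OF one_UZ_0 Suc.prems(2) gr.gr_1]) simp_all
    then show ?case by simp
  next
    case (gr_diff d a b)
    then show ?case by (simp add: tri_def left_diff_distrib int_module.span_diff)
  next
    case (gr_gen_mult i d a r)
    show ?case
    \<comment> \<open>For nonzero a the degree d is nonnegative, so i + l1 \<le> d + i + l: the
      bound that \<open>step\<close> asks for.\<close>
    proof (cases "a = 0")
      case True
      then show ?thesis by (simp add: tri_def int_module.span_zero)
    next
      case False
      then have d: "0 \<le> d" using gr_neg[OF gr_gen_mult.hyps(2)] by simp
      have ab: "a * b \<in> tri UZ_0 l d"
        by (rule Suc.IH[OF gr_gen_mult.hyps(2) Suc.prems(2)]) (use gr_gen_mult in auto)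
      have "dpow (x_el PlusS r) i * (a * b) * 1 \<in> tri UZ_0 l (d + int i)"
        unfolding tri_def
      proof (rule int_span_mult_tri[OF ab], fold tri_def)
        fix a1 h1 d1 l1 k1
        assume 1: "h1 \<in> UZ_0" "l1 \<le> l" "k1 \<le> d" "gr MinusS l1 a1" "gr PlusS k1 d1"
        have "dpow (x_el PlusS r) i * a1 \<in> tri UZ_0 l1 (int i)"
          by (rule step[OF 1(4) gr_gen_mult.hyps(1)]) (use gr_gen_mult.prems 1 d in auto)
        from tri_mult[OF this one_UZ_0 1(1) gr.gr_1 1(5)]
        have "dpow (x_el PlusS r) i * a1 * (h1 * d1) \<in> tri UZ_0 l1 (int i + k1)" by simp
        then have "dpow (x_el PlusS r) i * a1 * (h1 * d1) \<in> tri UZ_0 l (d + int i)"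
          by (rule subsetD[OF tri_mono, rotated 2]) (use 1 in auto)
        then show "dpow (x_el PlusS r) i * (a1 * h1 * d1) * 1 \<in> tri UZ_0 l (d + int i)"
          by (simp add: mult.assoc)
      qed
      then show ?thesis by (simp add: mult.assoc)
    qed
  qed
qed

lemma tri_swap: "gr PlusS k a \<Longrightarrow> gr MinusS l b \<Longrightarrow> a * b \<in> tri UZ_0 l k"
  by (rule tri_swap_bounded[of _ _ _ _ "Suc (nat (k + l))"]) auto

section \<open>The triangular decomposition\<close>

lemma gr_UZ_pm: "gr \<sigma> d a \<Longrightarrow> a \<in> UZ_pm \<sigma>"
  by (rule gr_in_subring[OF subring_UZ_pm dpow_x_in_UZ_pm])

lemma UZ_pm_span: "a \<in> UZ_pm \<sigma> \<Longrightarrow> a \<in> int_span {g. \<exists>d. gr \<sigma> d g}"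
  unfolding UZ_pm_def
proof (induction rule: subring_gen.induct)
  case (base a)
  then have "\<exists>k r. a = dpow (x_el \<sigma> r) k" by (auto simp: divpow_eq)
  then show ?case using gr_x by (intro int_module.span_base) blast
next
  case one
  then show ?case using gr.gr_1 by (intro int_module.span_base) blast
next
  case (mult a b)
  have "1 * a * b \<in> int_span {g. \<exists>d. gr \<sigma> d g}"
  proof (rule int_span_mult[OF mult.IH(1)])
    fix s assume "s \<in> {g. \<exists>d. gr \<sigma> d g}"
    then have "s * b * 1 \<in> int_span {g. \<exists>d. gr \<sigma> d g}"
      by (intro int_span_mult[OF mult.IH(2)] int_module.span_base) (use gr_mult in fastforce)
    then show "1 * s * b \<in> int_span {g. \<exists>d. gr \<sigma> d g}" by simp
  qed
  then show ?case by simp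
qed (simp_all add: int_module.span_zero int_module.span_diff)

theorem proposition6p41:
  shows "UZ_0 \<subseteq> UZ \<and>
         UZ = int_span {a * b * d | a b d. a \<in> UZ_pm MinusS \<and> b \<in> UZ_0 \<and> d \<in> UZ_pm PlusS}"
proof (intro conjI UZ_0_subset_UZ subset_antisym subsetI)
  let ?S = "{a * b * d | a b d. a \<in> UZ_pm MinusS \<and> b \<in> UZ_0 \<and> d \<in> UZ_pm PlusS}"
  have S: "a * b * d \<in> int_span ?S" if "a \<in> UZ_pm MinusS" "b \<in> UZ_0" "d \<in> UZ_pm PlusS" for a b d
    using that by (intro int_module.span_base) blast
  have 1: "1 \<in> UZ_pm \<sigma>" for \<sigma> by (simp add: is_subringD[OF subring_UZ_pm])
  \<comment> \<open>The span is stable under left multiplication by \<open>UZ\<close>; applied to 1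
    this gives the inclusion of \<open>UZ\<close>. The trailing factor 1 fits the shape of
    \<open>int_span_mult\<close>.\<close>
  have "u * m * 1 \<in> int_span ?S" if "u \<in> UZ" "m \<in> int_span ?S" for u m
    using that unfolding UZ_def
  proof (induction arbitrary: m rule: subring_gen.induct)
    case (base u)
    then obtain \<sigma> r k where u: "u = dpow (x_el \<sigma> r) k" by (auto simp: divpow_eq)
    show ?case
    proof (rule int_span_mult[OF base(2)])
      fix s assume "s \<in> ?S"
      then obtain a b d where s: "s = a * b * d" and abd: "a \<in> UZ_pm MinusS" "b \<in> UZ_0" "d \<in> UZ_pm PlusS" by blast
      show "u * s * 1 \<in> int_span ?S"
      proof (cases \<sigma>)
        case PlusS
        \<comment> \<open>The positive divided power crosses a by \<open>tri_swap\<close>; the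
          positive part so produced then crosses b by \<open>gr_UZ_0_pass\<close>.\<close>
        have "u * a * (b * d) \<in> int_span ?S"
        proof (rule int_span_mult[OF UZ_pm_span[OF abd(1)]])
          fix g assume "g \<in> {g. \<exists>d. gr MinusS d g}"
          then obtain l where "gr MinusS l g" by blast
          then have ug: "u * g \<in> tri UZ_0 l (int k)" unfolding u PlusS by (rule tri_swap[OF gr_x])
          have "1 * (u * g) * (b * d) \<in> int_span ?S"
          proof (rule int_span_mult_tri[OF ug])
            fix a1 h1 d1 l1 k1
            assume 1: "h1 \<in> UZ_0" "gr MinusS l1 a1" "gr PlusS k1 d1"
            have "(a1 * h1) * (d1 * b) * d \<in> int_span ?S"
            proof (rule int_span_mult[OF gr_UZ_0_pass[OF abd(2) 1(3)]])
              fix t assume "t \<in> cartan_plus UZ_0 k1"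
              then obtain h3 d3 where t: "t = h3 * d3" "h3 \<in> UZ_0" "gr PlusS k1 d3" by blast
              have "a1 * (h1 * h3) * (d3 * d) \<in> int_span ?S"
                using gr_UZ_pm[OF 1(2)] gr_UZ_pm[OF t(3)] 1(1) t(2) abd
                by (intro S is_subringD(6)[OF subring_UZ_0] is_subringD(6)[OF subring_UZ_pm])
              then show "(a1 * h1) * t * d \<in> int_span ?S" by (simp only: t(1) mult.assoc)
            qed
            then show "1 * (a1 * h1 * d1) * (b * d) \<in> int_span ?S" by (simp add: mult.assoc)
          qed
          then show "u * g * (b * d) \<in> int_span ?S" by simp
        qed
        then show ?thesis by (simp add: s mult.assoc)
      next
        case MinusS
        have "(u * a) * b * d \<in> int_span ?S"
          using abd by (intro S is_subringD[OF subring_UZ_pm]) (simp_all add: u MinusS dpow_x_in_UZ_pm)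
        then show ?thesis by (simp add: s mult.assoc)
      qed
    qed
  next
    case (mult a b)
    from mult.IH(1)[OF mult.IH(2)[OF mult.prems]] show ?case by (simp add: mult.assoc)
  qed (simp_all add: int_module.span_zero int_module.span_diff left_diff_distrib)
  from this[of _ 1] S[OF 1 one_UZ_0 1] show "u \<in> int_span ?S" if "u \<in> UZ" for u
    using that by simp
  have pm: "UZ_pm \<sigma> \<subseteq> UZ" for \<sigma>
    unfolding UZ_pm_def using dpow_x_in_UZ
    by (intro subring_gen_subset[OF subring_UZ]) (auto simp: divpow_eq)
  fix u assume "u \<in> int_span ?S"
  then show "u \<in> UZ"
  proof (induction rule: int_module.span_induct_alt)
    case base
    then show ?case by (simp add: is_subringD[OF subring_UZ])
  next
    case (step n s y)
    then obtain a b d where "s = a * b * d" "a \<in> UZ" "b \<in> UZ" "d \<in> UZ"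
      using pm UZ_0_subset_UZ by blast
    then have "of_int n * s \<in> UZ"
      by (simp add: is_subringD[OF subring_UZ] is_subring_of_int[OF subring_UZ])
    then show ?case using step(2) by (simp add: is_subringD[OF subring_UZ])
  qed
qed

end
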